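(* Let $d\ge 1$ be an integer, $\alpha\in(0,\infty)$, $\gamma\in\mathbb R^d$, and let $\nu$ be a finite Borel measure on $\mathbb R^d$ with $\nu(\{0\})=0$ and $\int_{|x|>2}(\log|x|)^\alpha\,\nu(\mathrm dx)<\infty$. Let $X\sim L^*_\alpha(\nu,\gamma)$ and fix $\theta>0$. If $\{Y_t:t\ge0\}$ is a Lévy process on $\mathbb R^d$ with $Y_1\sim \mathrm{ID}_0(\nu',\gamma')$, where $\nu'=\nu/\theta$ and $\gamma'=\gamma/(\theta\,\Gamma(\alpha))$, then $$X\stackrel{d}{=}\int_0^\infty e^{-\left(\frac{\alpha s}{\theta}\right)^{1/\alpha}}\,\mathrm dY_s,$$ where the stochastic integral is absolutely definable.
   Context: $\Gamma$ is the gamma function and $\stackrel{d}{=}$ denotes equality in distribution. For a Borel measure $M$ on $\mathbb R^d$ with $M(\{0\})=0$ and $\int_{\mathbb R^d}(|x|\wedge 1)M(\mathrm dx)<\infty$, and $\gamma\in\mathbb R^d$, $\mathrm{ID}_0(M,\gamma)$ denotes the infinitely divisible distribution on $\mathbb R^d$ with characteristic function $z\mapsto\exp\{C(z)\}$, $C(z)=i\langle\gamma,z\rangle+\int_{\mathbb R^d}(e^{i\langle z,x\rangle}-1)M(\mathrm dx)$; $C$ is called its cumulant generating function (cgf). For a Borel measure $\nu$ as in the claim, put $$M_\alpha(B)=\int_{\mathbb R^d}\int_0^1 1_B(yr)(-\log r)^{\alpha-1}r^{-1}\,\mathrm dr\,\nu(\mathrm dy),\quad B\in\mathfrak B(\mathbb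 R^d).$$ Then $\int(|x|\wedge1)M_\alpha(\mathrm dx)<\infty$, and $L^*_\alpha(\nu,\gamma)$ denotes the distribution $\mathrm{ID}_0(M_\alpha,\gamma)$. Absolutely definable (in the sense of Sato, 2006): for a Lévy process $\{Y_t\}$ whose time-one distribution has cgf $C_1$ and a deterministic function $f$ on $[0,\infty)$ for which $\int_0^t f(s)\,\mathrm dY_s$ is defined for each $t$, the improper integral $\int_0^\infty f(s)\,\mathrm dY_s$ is the limit in probability of $\int_0^t f(s)\,\mathrm dY_s$ as $t\to\infty$ (when it exists); it is called absolutely definable if $\int_0^\infty|C_1(f(s)z)|\,\mathrm ds<\infty$ for all $z\in\mathbb R^d$ (which implies that this limit exists). *)

theory Defs
  imports "HOL-Probability.Probability"
begin

section \<open>Infinitely divisible distributions\<close>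

definition char_fn :: "'a::euclidean_space measure \<Rightarrow> 'a \<Rightarrow> complex" where
  "char_fn \<mu> z = (CLINT x|\<mu>. iexp (z \<bullet> x))"

definition cgf :: "'a::euclidean_space measure \<Rightarrow> 'a \<Rightarrow> 'a \<Rightarrow> complex" where
  "cgf M \<gamma> z = \<i> * complex_of_real (\<gamma> \<bullet> z) + (CLINT x|M. (iexp (z \<bullet> x) - 1))"

text \<open>
  \<open>is_ID0 M \<gamma> \<mu>\<close> says that \<open>\<mu>\<close> is the law \<open>ID\<^sub>0(M, \<gamma>)\<close>; a law is determined by its characteristic
  function. The predicate is meaningful only for Borel measures \<open>M\<close> with \<open>M {0} = 0\<close> that integrate
  \<open>min (norm x) 1\<close>: otherwise the Bochner integral in \<^const>\<open>cgf\<close> may be the default value \<open>0\<close>.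
\<close>

definition is_ID0 :: "'a::euclidean_space measure \<Rightarrow> 'a \<Rightarrow> 'a measure \<Rightarrow> bool" where
  "is_ID0 M \<gamma> \<mu> \<longleftrightarrow> prob_space \<mu> \<and> sets \<mu> = sets borel \<and> (\<forall>z. char_fn \<mu> z = exp (cgf M \<gamma> z))"

definition M_alpha :: "real \<Rightarrow> 'a::euclidean_space measure \<Rightarrow> 'a measure" where
  "M_alpha \<alpha> \<nu> = measure_of UNIV (sets borel)
     (\<lambda>B. \<integral>\<^sup>+ y. (\<integral>\<^sup>+ r \<in> {0<..<1}.
        indicator B (r *\<^sub>R y) * ennreal ((- ln r) powr (\<alpha> - 1) * inverse r) \<partial>lborel) \<partial>\<nu>)"

lemma sets_M_alpha [simp, measurable_cong]: "sets (M_alpha \<alpha> \<nu>) = sets borel"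
  unfolding M_alpha_def using sets.sets_measure_of_eq[of borel] by simp

text \<open>The set function in the definition is countably additive, so it is the measure that
  \<^const>\<open>measure_of\<close> returns.\<close>

lemma emeasure_M_alpha:
  fixes \<nu> :: "'a::euclidean_space measure"
  assumes \<nu>: "sets \<nu> = sets borel" and B: "B \<in> sets borel"
  shows "emeasure (M_alpha \<alpha> \<nu>) B =
     (\<integral>\<^sup>+ y. (\<integral>\<^sup>+ r \<in> {0<..<1}.
        indicator B (r *\<^sub>R y) * ennreal ((- ln r) powr (\<alpha> - 1) * inverse r) \<partial>lborel) \<partial>\<nu>)"
proof (rule emeasure_measure_of[OF M_alpha_def])
  let ?k = "\<lambda>B (y::'a) (r::real). indicator B (r *\<^sub>R y) *
      ennreal ((- ln r) powr (\<alpha> - 1) * inverse r) * indicator {0<..<1} r"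
  let ?m = "\<lambda>B. \<integral>\<^sup>+ y. (\<integral>\<^sup>+ r. ?k B y r \<partial>lborel) \<partial>\<nu>"
  note [measurable_cong] = \<nu>
  show "positive (sets (M_alpha \<alpha> \<nu>)) ?m"
    by (simp add: positive_def)
  show "countably_additive (sets (M_alpha \<alpha> \<nu>)) ?m"
  proof (rule countably_additiveI)
    fix A :: "nat \<Rightarrow> 'a set"
    assume A: "range A \<subseteq> sets (M_alpha \<alpha> \<nu>)" and disj: "disjoint_family A"
    then have [measurable]: "\<And>i. A i \<in> sets borel" by auto
    have "(\<Sum>i. ?m (A i)) = (\<integral>\<^sup>+ y. (\<Sum>i. \<integral>\<^sup>+ r. ?k (A i) y r \<partial>lborel) \<partial>\<nu>)"
      by (rule nn_integral_suminf[symmetric]) measurable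
    also have "\<dots> = (\<integral>\<^sup>+ y. (\<integral>\<^sup>+ r. (\<Sum>i. ?k (A i) y r) \<partial>lborel) \<partial>\<nu>)"
      by (intro nn_integral_cong nn_integral_suminf[symmetric]) measurable
    also have "\<dots> = ?m (\<Union>i. A i)"
      by (simp only: ennreal_suminf_multc suminf_indicator[OF disj])
    finally show "(\<Sum>i. ?m (A i)) = ?m (\<Union>i. A i)" .
  qed
qed (use B in auto)

definition is_L_star :: "real \<Rightarrow> 'a::euclidean_space measure \<Rightarrow> 'a \<Rightarrow> 'a measure \<Rightarrow> bool" where
  "is_L_star \<alpha> \<nu> \<gamma> \<mu> \<longleftrightarrow> is_ID0 (M_alpha \<alpha> \<nu>) \<gamma> \<mu>"

section \<open>Levy processes\<close>

definition levy_process ::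
    "'w measure \<Rightarrow> (real \<Rightarrow> 'w \<Rightarrow> 'a::euclidean_space) \<Rightarrow> bool" where
  "levy_process P Y \<longleftrightarrow>
     prob_space P \<and>
     (\<forall>t\<ge>0. Y t \<in> borel_measurable P) \<and>
     (AE \<omega> in P. Y 0 \<omega> = 0) \<and>
     (\<forall>n (t::nat \<Rightarrow> real). 0 \<le> t 0 \<and> (\<forall>i<n. t i < t (Suc i)) \<longrightarrow>
        prob_space.indep_vars P (\<lambda>_. borel)
          (\<lambda>i \<omega>. if i = 0 then Y (t 0) \<omega> else Y (t i) \<omega> - Y (t (i - 1)) \<omega>) {..n}) \<and>
     (\<forall>s\<ge>0. \<forall>t\<ge>0.
        distr P borel (\<lambda>\<omega>. Y (s + t) \<omega> - Y s \<omega>) = distr P borel (\<lambda>\<omega>. Y t \<omega> - Y 0 \<omega>)) \<and>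
     (\<forall>t\<ge>0. \<forall>\<epsilon>>0.
        ((\<lambda>s. measure P {\<omega> \<in> space P. \<epsilon> < norm (Y s \<omega> - Y t \<omega>)}) \<longlongrightarrow> 0) (at t within {0..})) \<and>
     (AE \<omega> in P.
        (\<forall>t\<ge>0. ((\<lambda>s. Y s \<omega>) \<longlongrightarrow> Y t \<omega>) (at_right t)) \<and>
        (\<forall>t>0. \<exists>l. ((\<lambda>s. Y s \<omega>) \<longlongrightarrow> l) (at_left t)))"

section \<open>Stochastic integrals of deterministic functions\<close>

definition tendsto_in_prob ::
    "'w measure \<Rightarrow> ('i \<Rightarrow> 'w \<Rightarrow> 'a::euclidean_space) \<Rightarrow> ('w \<Rightarrow> 'a) \<Rightarrow> 'i filter \<Rightarrow> bool" where
  "tendsto_in_prob P Z J F \<longleftrightarrow>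
     (\<forall>\<epsilon>>0. ((\<lambda>i. measure P {\<omega> \<in> space P. \<epsilon> < norm (Z i \<omega> - J \<omega>)}) \<longlongrightarrow> 0) F)"

definition bounded_borel :: "real set set" where
  "bounded_borel = {B \<in> sets borel. B \<subseteq> {0..} \<and> bounded B}"

text \<open>
  \<open>random_measure P Y \<Lambda>\<close>: \<open>\<Lambda>\<close> is the random measure on the bounded Borel subsets of \<open>[0, \<infinity>)\<close> induced
  by \<open>Y\<close>, countably additive in the sense of convergence in probability. By a \<open>\<pi>\<close>-\<open>\<lambda>\<close> argument every
  \<open>\<Lambda> B\<close> is almost surely determined by \<open>Y\<close>; hence, when \<open>Y\<close> has independent increments, \<open>\<Lambda>\<close> is
  automatically independently scattered (and its series converge almost surely).
\<close>

definition random_measure ::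
    "'w measure \<Rightarrow> (real \<Rightarrow> 'w \<Rightarrow> 'a::euclidean_space) \<Rightarrow> (real set \<Rightarrow> 'w \<Rightarrow> 'a) \<Rightarrow> bool" where
  "random_measure P Y \<Lambda> \<longleftrightarrow>
     (\<forall>B\<in>bounded_borel. \<Lambda> B \<in> borel_measurable P) \<and>
     (\<forall>t\<ge>0. AE \<omega> in P. \<Lambda> {0..t} \<omega> = Y t \<omega>) \<and>
     (\<forall>A::nat \<Rightarrow> real set.
        disjoint_family A \<and> range A \<subseteq> bounded_borel \<and> (\<Union>i. A i) \<in> bounded_borel \<longrightarrow>
        tendsto_in_prob P (\<lambda>n \<omega>. \<Sum>i<n. \<Lambda> (A i) \<omega>) (\<Lambda> (\<Union>i. A i)) sequentially)"

definition simple_stoch_integral ::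
    "(real set \<Rightarrow> 'w \<Rightarrow> 'a::euclidean_space) \<Rightarrow> (real \<Rightarrow> real) \<Rightarrow> real set \<Rightarrow> 'w \<Rightarrow> 'a" where
  "simple_stoch_integral \<Lambda> g B \<omega> = (\<Sum>a\<in>range g. a *\<^sub>R \<Lambda> (B \<inter> g -` {a}) \<omega>)"

text \<open>
  \<open>J\<close> is (a version of) \<open>\<integral>\<^sub>0\<^sup>t f(s) dY\<^sub>s\<close>, in the sense of Urbanik--Woyczynski, Rajput--Rosinski and
  Sato. Convergence over all Borel subsets \<open>B\<close>, and not only over \<open>[0, t]\<close>, is what makes the limit
  independent of the approximating sequence \<open>g\<close>.
\<close>

definition has_stoch_integral ::
    "'w measure \<Rightarrow> (real \<Rightarrow> 'w \<Rightarrow> 'a::euclidean_space) \<Rightarrow> (real \<Rightarrow> real) \<Rightarrow> real \<Rightarrow> ('w \<Rightarrow> 'a) \<Rightarrow> bool"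
  where
  "has_stoch_integral P Y f t J \<longleftrightarrow>
     J \<in> borel_measurable P \<and>
     (\<exists>\<Lambda> g. random_measure P Y \<Lambda> \<and>
        (\<forall>n::nat. simple_function borel (g n)) \<and>
        (AE s in lborel. s \<in> {0..t} \<longrightarrow> (\<lambda>n. g n s) \<longlonglongrightarrow> f s) \<and>
        (\<forall>B\<in>sets borel. B \<subseteq> {0..t} \<longrightarrow>
           (\<exists>K\<in>borel_measurable P.
              tendsto_in_prob P (\<lambda>n. simple_stoch_integral \<Lambda> (g n) B) K sequentially)) \<and>
        tendsto_in_prob P (\<lambda>n. simple_stoch_integral \<Lambda> (g n) {0..t}) J sequentially)"

definition has_improper_stoch_integral ::
    "'w measure \<Rightarrow> (real \<Rightarrow> 'w \<Rightarrow> 'a::euclidean_space) \<Rightarrow> (real \<Rightarrow> real) \<Rightarrow> ('w \<Rightarrow> 'a) \<Rightarrow> bool" where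
  "has_improper_stoch_integral P Y f J \<longleftrightarrow>
     J \<in> borel_measurable P \<and>
     (\<exists>Z. (\<forall>t\<ge>0. has_stoch_integral P Y f t (Z t)) \<and> tendsto_in_prob P Z J at_top)"

text \<open>\<open>C\<close> is the cumulant generating function of the law of the Levy process at time \<open>1\<close>.\<close>

definition absolutely_definable :: "('a::euclidean_space \<Rightarrow> complex) \<Rightarrow> (real \<Rightarrow> real) \<Rightarrow> bool" where
  "absolutely_definable C f \<longleftrightarrow>
     (\<forall>z. (\<integral>\<^sup>+ s\<in>{0..}. ennreal (cmod (C (f s *\<^sub>R z))) \<partial>lborel) < \<infinity>)"

end

(*
  Since nu is finite, K u = |gamma| u + integral of min 2 (u |y|) nu(dy) dominates the cumulant function
  along rays, and rho h = integral of K |h(s)| ds controls the Wiener type integral of a step function h: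
  by independence of the increments its characteristic function at z is exp (integral of C (h(s) z) ds), so
  a tail estimate turns rho h -> 0 into convergence to 0 in probability. Hence the integral extends
  continuously, with the same formula for its characteristic function, from step functions to every h in
  their rho-closure: to indicators of bounded Borel sets (which yields the random measure induced by Y), to
  f on [0, t], and, because the logarithmic moment of nu makes rho f finite, to f on [0, oo). There
  the substitution s = theta u^alpha / alpha, r = exp (-u) identifies M_alpha with the image of
  nu' (x) ds under (y, s) |-> f(s) y, so the exponent is the cumulant function of X, and uniqueness of
  characteristic functions concludes.
*)
theory Submission
  imports Defs
begin

section \<open>Convergence in probability and characteristic functions\<close>

text \<open>\<open>Y\<close> need not have moments, so no L2 isometry is at hand; the subadditive
  functional \<rho> takes its place. Truncating the jump term at 2, the trivial bound for the
  distance of two points of the unit circle, makes \<rho> finite on bounded functions of bounded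
  support. The integral is kept as a relation, the closure of a graph, so that linearity and
  closedness are statements about approximations. The stochastic integral is defined through a
  random measure on all bounded Borel sets, whereas \<open>Y\<close> yields values on intervals
  only; hence the closure has to reach the indicators of such sets. The law of \<open>Y\<close> is
  given at time 1 alone, and as complex logarithms are many-valued, the other times need a separate
  continuity argument. The integral of \<open>f\<close> over the half-line is \<theta>
  \<Gamma>(\<alpha>), whence the inverse factor in \<gamma>'; the image of ds under \<open>f\<close>
  is \<theta> (- ln r)^(\<alpha> - 1) dr / r on (0, 1), whence \<nu>' = \<nu> / \<theta>.\<close>

lemma cmod_iexp_diff_le: "cmod (iexp a - iexp b) \<le> min 2 \<bar>a - b\<bar>"
proof -
  have "iexp a - iexp b = iexp b * (iexp (a - b) - 1)"
    by (simp add: algebra_simps flip: exp_add)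
  then have "cmod (iexp a - iexp b) = cmod (iexp (a - b) - 1)"
    by (simp add: norm_mult)
  also have "\<dots> \<le> \<bar>a - b\<bar>"
    using iexp_approx1[of "a - b" 0] by simp
  finally have "cmod (iexp a - iexp b) \<le> \<bar>a - b\<bar>" .
  moreover have "cmod (iexp a - iexp b) \<le> 2"
    using norm_triangle_ineq4[of "iexp a" "iexp b"] by simp
  ultimately show ?thesis by simp
qed

lemma cmod_iexp_minus_one_le: "cmod (iexp a - 1) \<le> min 2 \<bar>a\<bar>"
  using cmod_iexp_diff_le[of a 0] by simp

section \<open>Tail bounds from characteristic functions near the origin\<close>

lemma nn_integral_one_minus_cos:
  assumes "0 \<le> \<delta>" "x \<noteq> 0"
  shows "(\<integral>\<^sup>+ t. ennreal (1 - cos (t * x)) * indicator {0..\<delta>} t \<partial>lborel) = ennreal (\<delta> - sin (\<delta> * x) / x)"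
  using assms
  by (subst nn_integral_FTC_Icc[where F = "\<lambda>t. t - sin (t * x) / x"])
     (auto intro!: derivative_eq_intros)

text \<open>Averaging \<open>1 - cos (t * U)\<close> over \<open>t\<close> in
  \<open>[0, \<delta>]\<close> gives \<open>\<delta> - sin (\<delta> * U) / U\<close>, which is at
  least \<open>\<delta> / 2\<close> as soon as \<open>\<bar>U\<bar> \<ge> 2 / \<delta>\<close>. Its
  expectation is at most \<open>m * \<delta>\<close>, because \<open>1 - cos\<close> is minus the
  real part of what \<open>m\<close> bounds.\<close>

lemma (in prob_space) char_tail_bound:
  fixes U :: "'a \<Rightarrow> real"
  assumes U [measurable]: "U \<in> borel_measurable M" and "\<delta> > 0"
    and le: "\<And>t. 0 \<le> t \<Longrightarrow> t \<le> \<delta> \<Longrightarrow> cmod ((CLINT \<omega>|M. iexp (t * U \<omega>)) - 1) \<le> m"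
  shows "prob {\<omega> \<in> space M. 2 / \<delta> \<le> \<bar>U \<omega>\<bar>} \<le> 2 * m"
proof -
  have m0: "0 \<le> m" using le[of 0] \<open>\<delta> > 0\<close> by (meson norm_ge_zero order_trans less_imp_le order_refl)
  let ?A = "{\<omega> \<in> space M. 2 / \<delta> \<le> \<bar>U \<omega>\<bar>}"
  have inner: "(\<integral>\<^sup>+ \<omega>. ennreal (1 - cos (t * U \<omega>)) \<partial>M) \<le> ennreal m" if "0 \<le> t" "t \<le> \<delta>" for t
  proof -
    have int: "complex_integrable M (\<lambda>\<omega>. iexp (t * U \<omega>))"
      by (rule integrable_const_bound[where B = 1]) (auto simp del: of_real_mult)
    have [simp]: "integrable M (\<lambda>\<omega>. cos (t * U \<omega>))"
      by (rule integrable_const_bound[where B = 1]) auto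
    have "Re (CLINT \<omega>|M. iexp (t * U \<omega>)) = (\<integral>\<omega>. cos (t * U \<omega>) \<partial>M)"
      by (subst integral_Re[OF int, symmetric]) (simp add: Re_exp)
    then have "(\<integral>\<omega>. 1 - cos (t * U \<omega>) \<partial>M) = - Re ((CLINT \<omega>|M. iexp (t * U \<omega>)) - 1)"
      by (simp add: prob_space)
    also have "\<dots> \<le> m"
      using le[OF that] abs_Re_le_cmod[of "(CLINT \<omega>|M. iexp (t * U \<omega>)) - 1"] by linarith
    finally show ?thesis
      by (subst nn_integral_eq_integral) (auto intro: ennreal_leI)
  qed
  have "ennreal (\<delta> / 2) * emeasure M ?A = (\<integral>\<^sup>+ \<omega>. ennreal (\<delta> / 2) * indicator ?A \<omega> \<partial>M)"
    by (simp add: nn_integral_cmult_indicator)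
  also have "\<dots> \<le> (\<integral>\<^sup>+ \<omega>. (\<integral>\<^sup>+ t. ennreal (1 - cos (t * U \<omega>)) * indicator {0..\<delta>} t \<partial>lborel) \<partial>M)"
  proof (intro nn_integral_mono, goal_cases)
    case (1 \<omega>)
    show ?case
    proof (cases "\<omega> \<in> ?A")
      case True
      then have b: "2 \<le> \<delta> * \<bar>U \<omega>\<bar>" and nz: "U \<omega> \<noteq> 0"
        using \<open>\<delta> > 0\<close> by (auto simp: field_simps)
      have "\<bar>sin (\<delta> * U \<omega>) / U \<omega>\<bar> \<le> 1 / \<bar>U \<omega>\<bar>"
        by (simp add: abs_divide divide_right_mono)
      also have "\<dots> \<le> \<delta> / 2"
        using b nz by (simp add: field_simps)
      finally have "\<delta> / 2 \<le> \<delta> - sin (\<delta> * U \<omega>) / U \<omega>" by linarith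
      with True nz show ?thesis
        using \<open>\<delta> > 0\<close> by (simp add: nn_integral_one_minus_cos ennreal_leI)
    qed simp
  qed
  also have "\<dots> = (\<integral>\<^sup>+ t. (\<integral>\<^sup>+ \<omega>. ennreal (1 - cos (t * U \<omega>)) * indicator {0..\<delta>} t \<partial>M) \<partial>lborel)"
  proof -
    interpret pair_sigma_finite M lborel ..
    show ?thesis
      by (subst Fubini') (simp_all)
  qed
  also have "\<dots> = (\<integral>\<^sup>+ t. (\<integral>\<^sup>+ \<omega>. ennreal (1 - cos (t * U \<omega>)) \<partial>M) * indicator {0..\<delta>} t \<partial>lborel)"
    by (simp add: nn_integral_multc)
  also have "\<dots> \<le> (\<integral>\<^sup>+ t. ennreal m * indicator {0..\<delta>} t \<partial>lborel)"
    by (intro nn_integral_mono) (auto split: split_indicator intro: inner)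
  also have "\<dots> = ennreal (m * \<delta>)"
    using \<open>\<delta> > 0\<close> m0 by (simp add: nn_integral_cmult_indicator ennreal_mult)
  finally have "ennreal (\<delta> / 2 * prob ?A) \<le> ennreal (m * \<delta>)"
    using \<open>\<delta> > 0\<close> by (subst ennreal_mult) (simp_all add: emeasure_eq_measure)
  then have "\<delta> / 2 * prob ?A \<le> m * \<delta>"
    using m0 \<open>\<delta> > 0\<close> by (subst (asm) ennreal_le_iff) auto
  then show ?thesis
    using \<open>\<delta> > 0\<close> by (simp add: field_simps)
qed

lemma (in prob_space) prob_norm_gt_le_sum:
  fixes J :: "'a \<Rightarrow> 'b::euclidean_space"
  assumes J [measurable]: "J \<in> borel_measurable M"
  shows "prob {\<omega> \<in> space M. \<epsilon> < norm (J \<omega>)}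
    \<le> (\<Sum>b\<in>Basis. prob {\<omega> \<in> space M. \<epsilon> / DIM('b) \<le> \<bar>J \<omega> \<bullet> b\<bar>})"
proof -
  have "prob {\<omega> \<in> space M. \<epsilon> < norm (J \<omega>)} \<le> prob (\<Union>b\<in>(Basis :: 'b set). {\<omega> \<in> space M. \<epsilon> / DIM('b) \<le> \<bar>J \<omega> \<bullet> b\<bar>})"
  proof (intro finite_measure_mono subsetI)
    fix \<omega> assume \<omega>: "\<omega> \<in> {\<omega> \<in> space M. \<epsilon> < norm (J \<omega>)}"
    show "\<omega> \<in> (\<Union>b\<in>(Basis :: 'b set). {\<omega> \<in> space M. \<epsilon> / DIM('b) \<le> \<bar>J \<omega> \<bullet> b\<bar>})"
    proof (rule ccontr)
      assume "\<not> ?thesis"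
      then have "\<And>b. b \<in> Basis \<Longrightarrow> \<bar>J \<omega> \<bullet> b\<bar> \<le> \<epsilon> / DIM('b)"
        using \<omega> by force
      then have "(\<Sum>b\<in>Basis. \<bar>J \<omega> \<bullet> b\<bar>) \<le> \<epsilon>"
        using sum_bounded_above[of "Basis :: 'b set" "\<lambda>b. \<bar>J \<omega> \<bullet> b\<bar>" "\<epsilon> / DIM('b)"] by simp
      with norm_le_l1[of "J \<omega>"] \<omega> show False by simp
    qed
  qed (intro sets.finite_UN; measurable)
  also have "\<dots> \<le> (\<Sum>b\<in>Basis. prob {\<omega> \<in> space M. \<epsilon> / DIM('b) \<le> \<bar>J \<omega> \<bullet> b\<bar>})"
    by (intro measure_UNION_le) auto
  finally show ?thesis .
qed

text \<open>The growth \<open>(1 + norm z) * m\<close> is the one that cumulant functions of the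
  form \<open>C (h s *\<^sub>R z)\<close> will supply. The bound is linear in \<open>m\<close>, so
  \<open>m\<close> tending to 0 forces convergence to 0 in probability.\<close>

lemma (in prob_space) tail_bound_of_char:
  fixes J :: "'a \<Rightarrow> 'b::euclidean_space"
  assumes J [measurable]: "J \<in> borel_measurable M" and "\<epsilon> > 0" "0 \<le> m"
    and le: "\<And>z. cmod ((CLINT \<omega>|M. iexp (z \<bullet> J \<omega>)) - 1) \<le> (1 + norm z) * m"
  shows "prob {\<omega> \<in> space M. \<epsilon> < norm (J \<omega>)} \<le> 2 * DIM('b) * (1 + 2 * DIM('b) / \<epsilon>) * m"
proof -
  \<comment> \<open>With this choice \<open>2 / ?\<delta>\<close> is the coordinate threshold
    \<open>\<epsilon> / DIM('b)\<close> of \<open>prob_norm_gt_le_sum\<close>.\<close>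
  let ?\<delta> = "2 * DIM('b) / \<epsilon>"
  have \<delta>: "?\<delta> > 0" using \<open>\<epsilon> > 0\<close> by simp
  have "prob {\<omega> \<in> space M. \<epsilon> / DIM('b) \<le> \<bar>J \<omega> \<bullet> b\<bar>} \<le> 2 * ((1 + ?\<delta>) * m)" if b: "b \<in> Basis" for b
  proof -
    have "prob {\<omega> \<in> space M. 2 / ?\<delta> \<le> \<bar>J \<omega> \<bullet> b\<bar>} \<le> 2 * ((1 + ?\<delta>) * m)"
    proof (rule char_tail_bound[OF _ \<delta>])
      fix t assume t: "0 \<le> t" "t \<le> ?\<delta>"
      have "cmod ((CLINT \<omega>|M. iexp (t * (J \<omega> \<bullet> b))) - 1) \<le> (1 + t) * m"
        using le[of "t *\<^sub>R b"] b t by (simp add: inner_commute)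
      also have "\<dots> \<le> (1 + ?\<delta>) * m"
        using t \<open>0 \<le> m\<close> by (intro mult_right_mono) auto
      finally show "cmod ((CLINT \<omega>|M. iexp (t * (J \<omega> \<bullet> b))) - 1) \<le> (1 + ?\<delta>) * m" .
    qed simp
    then show ?thesis by simp
  qed
  then have "(\<Sum>b\<in>Basis. prob {\<omega> \<in> space M. \<epsilon> / DIM('b) \<le> \<bar>J \<omega> \<bullet> b\<bar>}) \<le> DIM('b) * (2 * ((1 + ?\<delta>) * m))"
    using sum_bounded_above by force
  with prob_norm_gt_le_sum[OF J, of \<epsilon>] show ?thesis
    by (simp add: mult_ac)
qed

section \<open>Continuity of characteristic functions under convergence in probability\<close>

text \<open>Where the two variables are within \<epsilon>, the integrands differ by at most
  \<open>norm z * \<epsilon>\<close>; on the remaining event the trivial bound 2 is used.\<close>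

lemma (in prob_space) char_diff_le:
  fixes J J' :: "'a \<Rightarrow> 'b::euclidean_space"
  assumes [measurable]: "J \<in> borel_measurable M" "J' \<in> borel_measurable M" and "\<epsilon> > 0"
  shows "cmod ((CLINT \<omega>|M. iexp (z \<bullet> J \<omega>)) - (CLINT \<omega>|M. iexp (z \<bullet> J' \<omega>)))
    \<le> norm z * \<epsilon> + 2 * prob {\<omega> \<in> space M. \<epsilon> < norm (J \<omega> - J' \<omega>)}"
proof -
  let ?A = "{\<omega> \<in> space M. \<epsilon> < norm (J \<omega> - J' \<omega>)}"
  have [simp]: "complex_integrable M (\<lambda>\<omega>. iexp (z \<bullet> J \<omega>))" "complex_integrable M (\<lambda>\<omega>. iexp (z \<bullet> J' \<omega>))"
    by (rule integrable_const_bound[where B = 1]; simp)+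
  have "cmod ((CLINT \<omega>|M. iexp (z \<bullet> J \<omega>)) - (CLINT \<omega>|M. iexp (z \<bullet> J' \<omega>)))
    = cmod (CLINT \<omega>|M. iexp (z \<bullet> J \<omega>) - iexp (z \<bullet> J' \<omega>))"
    by simp
  also have "\<dots> \<le> (\<integral>\<omega>. cmod (iexp (z \<bullet> J \<omega>) - iexp (z \<bullet> J' \<omega>)) \<partial>M)"
    by (rule integral_norm_bound)
  also have "\<dots> \<le> (\<integral>\<omega>. norm z * \<epsilon> + 2 * indicator ?A \<omega> \<partial>M)"
  proof (rule integral_mono)
    fix \<omega> assume \<omega>: "\<omega> \<in> space M"
    have "\<bar>z \<bullet> J \<omega> - z \<bullet> J' \<omega>\<bar> \<le> norm z * norm (J \<omega> - J' \<omega>)"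
      by (metis Cauchy_Schwarz_ineq2 inner_diff_right)
    then have "min 2 \<bar>z \<bullet> J \<omega> - z \<bullet> J' \<omega>\<bar> \<le> norm z * \<epsilon> + 2 * indicator ?A \<omega>"
      using \<omega> \<open>\<epsilon> > 0\<close> mult_left_mono[of "norm (J \<omega> - J' \<omega>)" \<epsilon> "norm z"]
      by (auto split: split_indicator intro: min.coboundedI2 min.coboundedI1)
    then show "cmod (iexp (z \<bullet> J \<omega>) - iexp (z \<bullet> J' \<omega>)) \<le> norm z * \<epsilon> + 2 * indicator ?A \<omega>"
      using cmod_iexp_diff_le order_trans by blast
  qed (auto intro!: integrable_real_indicator simp: less_top[symmetric])
  also have "\<dots> = norm z * \<epsilon> + 2 * prob ?A"
    by (subst Bochner_Integration.integral_add)
       (auto intro!: integrable_real_indicator simp: prob_space less_top[symmetric])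
  finally show ?thesis .
qed

lemma (in prob_space) tendsto_char:
  fixes Z :: "'i \<Rightarrow> 'a \<Rightarrow> 'b::euclidean_space"
  assumes [measurable]: "J \<in> borel_measurable M"
    and Z: "eventually (\<lambda>i. Z i \<in> borel_measurable M) F"
    and lim: "tendsto_in_prob M Z J F"
  shows "((\<lambda>i. CLINT \<omega>|M. iexp (z \<bullet> Z i \<omega>)) \<longlongrightarrow> (CLINT \<omega>|M. iexp (z \<bullet> J \<omega>))) F"
proof (rule tendstoI)
  fix e :: real assume "e > 0"
  \<comment> \<open>The 1 added to \<open>norm z\<close> keeps the quotient meaningful at
    \<open>z = 0\<close>. The other half of \<open>e\<close> is spent on twice a probability below
    \<open>e / 4\<close>.\<close>
  define \<epsilon> where "\<epsilon> = e / (2 * (1 + norm z))"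
  have pos: "1 + norm z > 0" by (simp add: add_pos_nonneg)
  have \<epsilon>: "\<epsilon> > 0" "norm z * \<epsilon> < e / 2"
  proof -
    show "\<epsilon> > 0" using pos \<open>e > 0\<close> by (simp add: \<epsilon>_def)
    then have "norm z * \<epsilon> < (1 + norm z) * \<epsilon>" by (simp add: algebra_simps)
    also have "\<dots> = e / 2" using pos by (simp add: \<epsilon>_def field_simps)
    finally show "norm z * \<epsilon> < e / 2" .
  qed
  have "eventually (\<lambda>i. prob {\<omega> \<in> space M. \<epsilon> < norm (Z i \<omega> - J \<omega>)} < e / 4) F"
    using lim \<epsilon>(1) \<open>e > 0\<close> unfolding tendsto_in_prob_def
    by (intro order_tendstoD(2)[where y = 0]) simp_all
  with Z show "eventually (\<lambda>i. dist (CLINT \<omega>|M. iexp (z \<bullet> Z i \<omega>)) (CLINT \<omega>|M. iexp (z \<bullet> J \<omega>)) < e) F"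
  proof eventually_elim
    case (elim i)
    have [measurable]: "Z i \<in> borel_measurable M" by (fact elim)
    show ?case
      using char_diff_le[of "Z i" J \<epsilon> z] elim \<epsilon> by (simp add: dist_norm)
  qed
qed

section \<open>Completeness of convergence in probability\<close>

lemma (in prob_space) prob_diff_triangle:
  fixes X X' X'' :: "'a \<Rightarrow> 'b::euclidean_space"
  assumes [measurable]: "X \<in> borel_measurable M" "X' \<in> borel_measurable M" "X'' \<in> borel_measurable M"
    and "a + b \<le> c"
  shows "prob {\<omega> \<in> space M. c < norm (X \<omega> - X'' \<omega>)}
    \<le> prob {\<omega> \<in> space M. a < norm (X \<omega> - X' \<omega>)} + prob {\<omega> \<in> space M. b < norm (X' \<omega> - X'' \<omega>)}"
proof -
  have "prob {\<omega> \<in> space M. c < norm (X \<omega> - X'' \<omega>)}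
    \<le> prob ({\<omega> \<in> space M. a < norm (X \<omega> - X' \<omega>)} \<union> {\<omega> \<in> space M. b < norm (X' \<omega> - X'' \<omega>)})"
  proof (intro finite_measure_mono subsetI)
    fix \<omega> assume "\<omega> \<in> {\<omega> \<in> space M. c < norm (X \<omega> - X'' \<omega>)}"
    then show "\<omega> \<in> {\<omega> \<in> space M. a < norm (X \<omega> - X' \<omega>)} \<union> {\<omega> \<in> space M. b < norm (X' \<omega> - X'' \<omega>)}"
      using \<open>a + b \<le> c\<close> norm_triangle_ineq[of "X \<omega> - X' \<omega>" "X' \<omega> - X'' \<omega>"] by auto
  qed simp
  also have "\<dots> \<le> prob {\<omega> \<in> space M. a < norm (X \<omega> - X' \<omega>)} + prob {\<omega> \<in> space M. b < norm (X' \<omega> - X'' \<omega>)}"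
    by (intro measure_Un_le) auto
  finally show ?thesis .
qed

lemma (in prob_space) tendsto_in_prob_of_AE:
  fixes Z :: "nat \<Rightarrow> 'a \<Rightarrow> 'b::euclidean_space"
  assumes [measurable]: "\<And>n. Z n \<in> borel_measurable M" "J \<in> borel_measurable M"
    and lim: "AE \<omega> in M. (\<lambda>n. Z n \<omega>) \<longlonglongrightarrow> J \<omega>"
  shows "tendsto_in_prob M Z J sequentially"
  unfolding tendsto_in_prob_def
proof (intro allI impI)
  fix \<epsilon> :: real assume "\<epsilon> > 0"
  have "(\<lambda>n. \<integral>\<omega>. indicator {\<omega> \<in> space M. \<epsilon> < norm (Z n \<omega> - J \<omega>)} \<omega> \<partial>M) \<longlonglongrightarrow> (\<integral>\<omega>. 0 \<partial>M :: real)"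
  proof (rule integral_dominated_convergence[where w = "\<lambda>_. 1"])
    show "AE \<omega> in M. (\<lambda>n. indicator {\<omega> \<in> space M. \<epsilon> < norm (Z n \<omega> - J \<omega>)} \<omega> :: real) \<longlonglongrightarrow> 0"
      using lim
    proof eventually_elim
      case (elim \<omega>)
      have "eventually (\<lambda>n. norm (Z n \<omega> - J \<omega>) < \<epsilon>) sequentially"
        using tendstoD[OF elim \<open>\<epsilon> > 0\<close>] by (simp add: dist_norm)
      then show ?case
        by (intro tendsto_eventually) (auto elim: eventually_mono)
    qed
  qed (auto split: split_indicator)
  then show "(\<lambda>n. prob {\<omega> \<in> space M. \<epsilon> < norm (Z n \<omega> - J \<omega>)}) \<longlonglongrightarrow> 0"
    by simp
qed

text \<open>A subsequence whose consecutive gaps exceed \<open>(1/2)^k\<close> with probability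
  below \<open>(1/2)^k\<close> converges almost surely by Borel-Cantelli, and the Cauchy property
  carries the whole sequence to the same limit.\<close>

lemma (in prob_space) Cauchy_in_prob_convergent:
  fixes Z :: "nat \<Rightarrow> 'a \<Rightarrow> 'b::euclidean_space"
  assumes Z [measurable]: "\<And>n. Z n \<in> borel_measurable M"
    and Cauchy: "\<And>\<epsilon>. \<epsilon> > 0 \<Longrightarrow> \<exists>N. \<forall>m\<ge>N. \<forall>n\<ge>N. prob {\<omega> \<in> space M. \<epsilon> < norm (Z m \<omega> - Z n \<omega>)} < \<epsilon>"
  obtains J where "J \<in> borel_measurable M" "tendsto_in_prob M Z J sequentially"
proof -
  let ?p = "\<lambda>\<epsilon> m n. prob {\<omega> \<in> space M. \<epsilon> < norm (Z m \<omega> - Z n \<omega>)}"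
  have "\<exists>N. \<forall>k. \<forall>m\<ge>N k. \<forall>n\<ge>N k. ?p ((1/2)^k) m n < (1/2)^k"
    by (intro choice allI Cauchy) simp
  then obtain N where N: "\<And>k m n. m \<ge> N k \<Longrightarrow> n \<ge> N k \<Longrightarrow> ?p ((1/2)^k) m n < (1/2)^k"
    by blast
  \<comment> \<open>\<open>Suc rk\<close> forces strict growth, and \<open>N (Suc k)\<close> moves
    past the index from which gaps above \<open>(1/2)^(Suc k)\<close> are rare.\<close>
  define r where "r = rec_nat (N 0) (\<lambda>k rk. max (Suc rk) (N (Suc k)))"
  have r_Suc: "r (Suc k) = max (Suc (r k)) (N (Suc k))" for k by (simp add: r_def)
  have r_ge: "N k \<le> r k" for k by (cases k) (simp_all add: r_def)
  have r_mono: "strict_mono r" by (rule strict_monoI_Suc) (simp add: r_Suc less_Suc_eq_le)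
  have "AE \<omega> in M. eventually (\<lambda>k. \<omega> \<in> space M - {\<omega> \<in> space M. (1/2)^k < norm (Z (r k) \<omega> - Z (r (Suc k)) \<omega>)}) sequentially"
  proof (rule borel_cantelli_AE1)
    show "summable (\<lambda>k. ?p ((1/2)^k) (r k) (r (Suc k)))"
    proof (rule summable_comparison_test')
      show "summable (\<lambda>k. (1/2::real)^k)" by (simp add: summable_geometric)
      show "norm (?p ((1/2)^k) (r k) (r (Suc k))) \<le> (1/2)^k" for k
      proof -
        have "r k \<le> r (Suc k)" by (simp add: r_Suc)
        then show ?thesis using N[of k "r k" "r (Suc k)"] r_ge[of k] by simp
      qed
    qed
  qed (auto simp: less_top[symmetric])
  then have conv: "AE \<omega> in M. convergent (\<lambda>k. Z (r k) \<omega>)"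
  proof eventually_elim
    case (elim \<omega>)
    then obtain k0 where k0: "\<And>k. k \<ge> k0 \<Longrightarrow> norm (Z (r k) \<omega> - Z (r (Suc k)) \<omega>) \<le> (1/2)^k" 
      by (auto simp: eventually_sequentially not_less)
    have "summable (\<lambda>k. Z (r (Suc k)) \<omega> - Z (r k) \<omega>)"
    proof (rule summable_comparison_test')
      show "summable (\<lambda>k. (1/2::real)^k)" by (simp add: summable_geometric)
      show "norm (Z (r (Suc k)) \<omega> - Z (r k) \<omega>) \<le> (1/2)^k" if "k \<ge> k0" for k
        using k0[OF that] by (simp add: norm_minus_commute)
    qed
    then have "convergent (\<lambda>n. \<Sum>k<n. Z (r (Suc k)) \<omega> - Z (r k) \<omega>)"
      by (simp add: summable_iff_convergent)
    then have "convergent (\<lambda>n. Z (r n) \<omega> - Z (r 0) \<omega>)"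
      using sum_lessThan_telescope[of "\<lambda>k. Z (r k) \<omega>"] by simp
    from convergent_add[OF this convergent_const[of "Z (r 0) \<omega>"]] show ?case by simp
  qed
  \<comment> \<open>Where the subsequence diverges, which is a null event, \<open>lim\<close> is an
    unspecified value; \<open>J\<close> is measurable all the same.\<close>
  define J where "J \<omega> = lim (\<lambda>k. Z (r k) \<omega>)" for \<omega>
  have J [measurable]: "J \<in> borel_measurable M" unfolding J_def by measurable
  have sub: "tendsto_in_prob M (\<lambda>k. Z (r k)) J sequentially"
    by (rule tendsto_in_prob_of_AE) (use conv in \<open>auto simp: J_def convergent_LIMSEQ_iff\<close>)
  have "tendsto_in_prob M Z J sequentially"
    unfolding tendsto_in_prob_def
  proof (intro allI impI tendstoI)
    fix \<epsilon> e :: real assume "\<epsilon> > 0" "e > 0"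
    define d where "d = min (\<epsilon> / 2) (e / 2)"
    have "d > 0" using \<open>\<epsilon> > 0\<close> \<open>e > 0\<close> by (simp add: d_def)
    obtain n0 where n0: "\<And>m n. m \<ge> n0 \<Longrightarrow> n \<ge> n0 \<Longrightarrow> ?p d m n < d"
      using Cauchy[OF \<open>d > 0\<close>] by blast
    have "eventually (\<lambda>k. prob {\<omega> \<in> space M. \<epsilon> / 2 < norm (Z (r k) \<omega> - J \<omega>)} < e / 2) sequentially"
      using sub \<open>\<epsilon> > 0\<close> \<open>e > 0\<close> unfolding tendsto_in_prob_def
      by (intro order_tendstoD(2)[where y = 0]) (simp_all only: half_gt_zero)
    moreover have "eventually (\<lambda>k. k \<ge> n0) sequentially" by (rule eventually_ge_at_top)
    ultimately have "eventually (\<lambda>k. prob {\<omega> \<in> space M. \<epsilon> / 2 < norm (Z (r k) \<omega> - J \<omega>)} < e / 2 \<and> k \<ge> n0) sequentially"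
      by eventually_elim simp
    then obtain k where k: "prob {\<omega> \<in> space M. \<epsilon> / 2 < norm (Z (r k) \<omega> - J \<omega>)} < e / 2" "k \<ge> n0"
      by (auto dest: eventually_happens)
    have rk: "r k \<ge> n0" using k(2) strict_mono_imp_increasing[OF r_mono, of k] by linarith
    have "prob {\<omega> \<in> space M. \<epsilon> < norm (Z n \<omega> - J \<omega>)} < e" if "n \<ge> n0" for n
    proof -
      have "prob {\<omega> \<in> space M. \<epsilon> < norm (Z n \<omega> - J \<omega>)} \<le> ?p d n (r k) + prob {\<omega> \<in> space M. \<epsilon> / 2 < norm (Z (r k) \<omega> - J \<omega>)}"
        by (rule prob_diff_triangle) (simp_all add: d_def)
      also have "\<dots> < d + e / 2" using n0[OF that rk] k(1) by simp
      also have "\<dots> \<le> e" by (simp add: d_def)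
      finally show ?thesis .
    qed
    then show "eventually (\<lambda>n. dist (prob {\<omega> \<in> space M. \<epsilon> < norm (Z n \<omega> - J \<omega>)}) 0 < e) sequentially"
      by (auto simp: eventually_sequentially)
  qed
  with J that show thesis by blast
qed

section \<open>Uniqueness of multivariate characteristic functions\<close>

text \<open>The one-dimensional step of multivariate uniqueness: \<open>V\<close> will carry the
  restrictions on the coordinates already treated, and \<open>U\<close> is the next coordinate. A
  positive normalised weight pushed forward along \<open>U\<close> is a probability measure on the
  line with a known characteristic function.\<close>

lemma integral_eq_of_weighted_char:
  fixes \<mu> \<mu>' :: "'b measure" and U V :: "'b \<Rightarrow> real"
  assumes "prob_space \<mu>" "prob_space \<mu>'" and sets: "sets \<mu> = sets \<mu>'"
    and U [measurable]: "U \<in> borel_measurable \<mu>" and V [measurable]: "V \<in> borel_measurable \<mu>"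
    and V1: "\<And>x. \<bar>V x\<bar> \<le> 1"
    and eqU: "\<And>s. (CLINT x|\<mu>. iexp (s * U x)) = (CLINT x|\<mu>'. iexp (s * U x))"
    and eqV: "\<And>s. (CLINT x|\<mu>. V x *\<^sub>R iexp (s * U x)) = (CLINT x|\<mu>'. V x *\<^sub>R iexp (s * U x))"
    and A [measurable]: "A \<in> sets borel"
  shows "(\<integral>x. V x * indicator A (U x) \<partial>\<mu>) = (\<integral>x. V x * indicator A (U x) \<partial>\<mu>')"
proof -
  interpret M: prob_space \<mu> by fact
  interpret M': prob_space \<mu>' by fact
  note [measurable_cong] = sets
  \<comment> \<open>Shifting the weight by 2 makes it positive, so that the uniqueness theorem for probability
    measures on the line applies.\<close>
  have step: "(\<integral>x. (2 + W x) * indicator A (U x) \<partial>\<mu>) = (\<integral>x. (2 + W x) * indicator A (U x) \<partial>\<mu>')"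
    if W [measurable]: "W \<in> borel_measurable \<mu>" and W1: "\<And>x. \<bar>W x\<bar> \<le> 1"
      and eqW: "\<And>s. (CLINT x|\<mu>. W x *\<^sub>R iexp (s * U x)) = (CLINT x|\<mu>'. W x *\<^sub>R iexp (s * U x))" for W
  proof -
    have int_ind: "integrable m (\<lambda>x. (2 + W x) * indicator B (U x))"
      if "prob_space m" "sets m = sets \<mu>" "B \<in> sets borel" for m :: "'b measure" and B :: "real set"
    proof -
      interpret m: prob_space m by fact
      note [measurable_cong] = that(2) and [measurable] = that(3)
      have "\<bar>2 + W x\<bar> \<le> 3" for x using W1[of x] by linarith
      then show ?thesis
        by (intro m.integrable_const_bound[where B = 3]) (auto split: split_indicator)
    qed
    have int_W: "integrable m (\<lambda>x. W x *\<^sub>R iexp (s * U x))" "integrable m (\<lambda>x. iexp (s * U x))" "integrable m W"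
      if "prob_space m" "sets m = sets \<mu>" for m :: "'b measure" and s
    proof -
      interpret m: prob_space m by fact
      note [measurable_cong] = that(2)
      show "integrable m (\<lambda>x. W x *\<^sub>R iexp (s * U x))" "integrable m (\<lambda>x. iexp (s * U x))" "integrable m W"
        by (rule m.integrable_const_bound[where B = 1]; use W1 in \<open>simp del: of_real_mult\<close>)+
    qed
    define c where "c = (\<integral>x. 2 + W x \<partial>\<mu>)"
    \<comment> \<open>At \<open>s = 0\<close> the hypothesis on \<open>W\<close> equates its two
      integrals, so one normalising constant serves both measures.\<close>
    have c': "c = (\<integral>x. 2 + W x \<partial>\<mu>')"
      using eqW[of 0] int_W(3)[of \<mu>] int_W(3)[of \<mu>'] M.prob_space_axioms M'.prob_space_axioms sets
      by (simp add: c_def M.prob_space M'.prob_space scaleR_conv_of_real)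
    have "0 \<le> 1 + W x" for x using abs_le_D2[OF W1[of x]] by linarith
    then have "(\<integral>x. 1 \<partial>\<mu>) \<le> (\<integral>x. 2 + W x \<partial>\<mu>)"
      using int_W(3)[of \<mu>] M.prob_space_axioms by (intro integral_mono) auto
    then have c: "c \<ge> 1" by (simp add: c_def M.prob_space)
    define N where "N m = distr (density m (\<lambda>x. ennreal ((2 + W x) / c))) borel U" for m
    have pos: "2 + W x \<ge> 0" for x using W1[of x] by linarith
    have N: "real_distribution (N m)" "measure (N m) A = (\<integral>x. (2 + W x) * indicator A (U x) \<partial>m) / c"
        "char (N m) s = (2 * (CLINT x|m. iexp (s * U x)) + (CLINT x|m. W x *\<^sub>R iexp (s * U x))) / c"
      if m: "prob_space m" "sets m = sets \<mu>" and mc: "(\<integral>x. 2 + W x \<partial>m) = c" for m s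
    proof -
      interpret m: prob_space m by fact
      note [measurable_cong] = that(2)
      have em: "emeasure (N m) B = ennreal ((\<integral>x. (2 + W x) * indicator B (U x) \<partial>m) / c)"
        if [measurable]: "B \<in> sets borel" for B
      proof -
        have "emeasure (N m) B = (\<integral>\<^sup>+ x. ennreal ((2 + W x) / c) * indicator (U -` B \<inter> space m) x \<partial>m)"
          unfolding N_def by (subst emeasure_distr) (auto simp: emeasure_density)
        also have "\<dots> = (\<integral>\<^sup>+ x. ennreal ((2 + W x) * indicator B (U x) / c) \<partial>m)"
          by (intro nn_integral_cong) (auto split: split_indicator)
        also have "\<dots> = ennreal (\<integral>x. (2 + W x) * indicator B (U x) / c \<partial>m)"
          using int_ind[OF m that] pos c by (intro nn_integral_eq_integral) auto
        finally show ?thesis by simp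
      qed
      show "real_distribution (N m)"
      proof (intro real_distribution.intro prob_spaceI real_distribution_axioms.intro)
        show "emeasure (N m) (space (N m)) = 1"
          using em[of UNIV] mc c by (simp add: N_def)
      qed (simp add: N_def)
      show "measure (N m) A = (\<integral>x. (2 + W x) * indicator A (U x) \<partial>m) / c"
        using em[OF A] c pos by (simp add: measure_def)
      have "char (N m) s = (CLINT x|m. ((2 + W x) / c) *\<^sub>R iexp (s * U x))"
        unfolding char_def N_def using pos c
        by (subst integral_distr) (auto simp: integral_density)
      also have "\<dots> = (CLINT x|m. (1 / c) *\<^sub>R (2 *\<^sub>R iexp (s * U x) + W x *\<^sub>R iexp (s * U x)))"
        by (intro Bochner_Integration.integral_cong) (simp_all add: scaleR_conv_of_real field_simps add_divide_distrib)
      also have "\<dots> = (1 / c) *\<^sub>R (2 *\<^sub>R (CLINT x|m. iexp (s * U x)) + (CLINT x|m. W x *\<^sub>R iexp (s * U x)))"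
        using int_W(1,2)[OF m, of s]
        by (subst integral_scaleR_right, subst Bochner_Integration.integral_add) simp_all
      finally show "char (N m) s = (2 * (CLINT x|m. iexp (s * U x)) + (CLINT x|m. W x *\<^sub>R iexp (s * U x))) / c"
        by (simp add: scaleR_conv_of_real)
    qed
    have NM: "real_distribution (N \<mu>)" "measure (N \<mu>) A = (\<integral>x. (2 + W x) * indicator A (U x) \<partial>\<mu>) / c"
        "char (N \<mu>) s = (2 * (CLINT x|\<mu>. iexp (s * U x)) + (CLINT x|\<mu>. W x *\<^sub>R iexp (s * U x))) / c" for s
      using N[of \<mu>] M.prob_space_axioms c_def by auto
    have NM': "real_distribution (N \<mu>')" "measure (N \<mu>') A = (\<integral>x. (2 + W x) * indicator A (U x) \<partial>\<mu>') / c"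
        "char (N \<mu>') s = (2 * (CLINT x|\<mu>'. iexp (s * U x)) + (CLINT x|\<mu>'. W x *\<^sub>R iexp (s * U x))) / c" for s
      using N[of \<mu>'] M'.prob_space_axioms sets c' by auto
    have "N \<mu> = N \<mu>'"
      using NM(1) NM'(1) by (rule Levy_uniqueness) (rule ext, simp only: NM(3) NM'(3) eqU eqW)
    then show ?thesis
      using NM(2) NM'(2) c by simp
  qed
  have int: "integrable m (\<lambda>x. V x * indicator A (U x))" "integrable m (\<lambda>x. indicator A (U x) :: real)"
    if "prob_space m" "sets m = sets \<mu>" for m :: "'b measure"
  proof -
    interpret m: prob_space m by fact
    note [measurable_cong] = that(2)
    show "integrable m (\<lambda>x. V x * indicator A (U x))" "integrable m (\<lambda>x. indicator A (U x) :: real)"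
      by (rule m.integrable_const_bound[where B = 1]; use V1 in \<open>auto split: split_indicator\<close>)+
  qed
  \<comment> \<open>The weight 0 isolates the contribution of the shift by 2, which is then
    subtracted from the statement for \<open>V\<close>.\<close>
  have "(\<integral>x. indicator A (U x) \<partial>\<mu>) = (\<integral>x. indicator A (U x) \<partial>\<mu>' :: real)"
    using step[of "\<lambda>_. 0"] by simp
  then show ?thesis
    using step[OF V V1 eqV] int[OF M.prob_space_axioms] int[OF M'.prob_space_axioms] sets
    by (simp add: distrib_right)
qed

text \<open>Induction on the coordinates that are confined to Borel sets. Keeping the factor
  \<open>iexp (z \<bullet> x)\<close> with arbitrary \<open>z\<close> makes it close: multiplication
  by \<open>iexp (s * (x \<bullet> b))\<close> only shifts the frequency to
  \<open>z + s *\<^sub>R b\<close>, where the induction hypothesis applies again.\<close>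

lemma integral_box_char_fn_eq:
  fixes \<mu> \<mu>' :: "'a::euclidean_space measure" and A :: "'a \<Rightarrow> real set"
  assumes "prob_space \<mu>" "prob_space \<mu>'" and sets: "sets \<mu> = sets borel" "sets \<mu>' = sets borel"
    and char: "\<And>z. char_fn \<mu> z = char_fn \<mu>' z"
    and S: "finite S" and A [measurable]: "\<And>b. A b \<in> sets borel"
  shows "(CLINT x|\<mu>. (\<Prod>b\<in>S. indicator (A b) (x \<bullet> b) :: real) *\<^sub>R iexp (z \<bullet> x))
       = (CLINT x|\<mu>'. (\<Prod>b\<in>S. indicator (A b) (x \<bullet> b) :: real) *\<^sub>R iexp (z \<bullet> x))"
  using S
proof (induction S arbitrary: z)
  case empty
  then show ?case using char by (simp add: char_fn_def)
next
  case (insert b S)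
  interpret M: prob_space \<mu> by fact
  interpret M': prob_space \<mu>' by fact
  note [measurable_cong] = sets
  define w where "w x = (\<Prod>b\<in>S. indicator (A b) (x \<bullet> b) :: real)" for x :: 'a
  have [measurable]: "w \<in> borel_measurable borel" unfolding w_def by measurable
  have w: "0 \<le> w x" "w x \<le> 1" for x
    unfolding w_def by (auto intro!: prod_nonneg prod_le_1 split: split_indicator)
  note IH = insert.IH[folded w_def]
  have int: "integrable m (\<lambda>x. w x *\<^sub>R iexp (z \<bullet> x))" if "prob_space m" "sets m = sets borel" for m z
  proof -
    interpret m: prob_space m by fact
    note [measurable_cong] = that(2)
    show ?thesis by (rule m.integrable_const_bound[where B = 1]) (use w in auto)
  qed
  \<comment> \<open>The one-dimensional step wants real weights, so
    \<open>iexp (z \<bullet> x)\<close> is split into cosine and sine. Each is a combination of the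
    frequencies \<open>z\<close> and \<open>-z\<close>, with Euler's coefficients as
    \<open>p\<close> and \<open>q\<close>.\<close>
  have trig: "(CLINT x|\<mu>. V x *\<^sub>R iexp (s * (x \<bullet> b))) = (CLINT x|\<mu>'. V x *\<^sub>R iexp (s * (x \<bullet> b)))"
    if V: "\<And>x. complex_of_real (V x) = p * (w x *\<^sub>R iexp (z \<bullet> x)) + q * (w x *\<^sub>R iexp ((-z) \<bullet> x))" for V p q s
  proof -
    have *: "V x *\<^sub>R iexp (s * (x \<bullet> b)) =
        p * (w x *\<^sub>R iexp ((z + s *\<^sub>R b) \<bullet> x)) + q * (w x *\<^sub>R iexp ((- z + s *\<^sub>R b) \<bullet> x))" for x
      unfolding scaleR_conv_of_real V
      by (simp add: algebra_simps inner_add_left inner_commute flip: exp_add)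
    have "(CLINT x|m. V x *\<^sub>R iexp (s * (x \<bullet> b))) = p * (CLINT x|m. w x *\<^sub>R iexp ((z + s *\<^sub>R b) \<bullet> x))
        + q * (CLINT x|m. w x *\<^sub>R iexp ((- z + s *\<^sub>R b) \<bullet> x))" if "prob_space m" "sets m = sets borel" for m
      unfolding *
      by (subst Bochner_Integration.integral_add)
         (auto simp only: integral_mult_right_zero intro!: integrable_mult_right int that)
    then show ?thesis
      using IH M.prob_space_axioms M'.prob_space_axioms sets by simp
  qed
  have key: "(\<integral>x. V x * indicator (A b) (x \<bullet> b) \<partial>\<mu>) = (\<integral>x. V x * indicator (A b) (x \<bullet> b) \<partial>\<mu>')"
    if [measurable]: "V \<in> borel_measurable borel" and "\<And>x. \<bar>V x\<bar> \<le> 1"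
      and "\<And>x. complex_of_real (V x) = p * (w x *\<^sub>R iexp (z \<bullet> x)) + q * (w x *\<^sub>R iexp ((-z) \<bullet> x))" for V p q
  proof (rule integral_eq_of_weighted_char)
    show "(CLINT x|\<mu>. iexp (s * (x \<bullet> b))) = (CLINT x|\<mu>'. iexp (s * (x \<bullet> b)))" for s
      using char[of "s *\<^sub>R b"] by (simp add: char_fn_def inner_commute)
    show "(CLINT x|\<mu>. V x *\<^sub>R iexp (s * (x \<bullet> b))) = (CLINT x|\<mu>'. V x *\<^sub>R iexp (s * (x \<bullet> b)))" for s
      using that(3) by (rule trig)
  qed (use that sets \<open>prob_space \<mu>\<close> \<open>prob_space \<mu>'\<close> in auto)
  have wb: "\<bar>w x * t\<bar> \<le> 1" if "\<bar>t\<bar> \<le> 1" for x t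
    using w[of x] that by (simp add: abs_mult mult_le_one)
  have re: "(\<integral>x. (w x * cos (z \<bullet> x)) * indicator (A b) (x \<bullet> b) \<partial>\<mu>) = (\<integral>x. (w x * cos (z \<bullet> x)) * indicator (A b) (x \<bullet> b) \<partial>\<mu>')"
  proof (rule key)
    show "complex_of_real (w x * cos (z \<bullet> x)) = (1/2) * (w x *\<^sub>R iexp (z \<bullet> x)) + (1/2) * (w x *\<^sub>R iexp ((-z) \<bullet> x))" for x
      by (simp add: complex_eq_iff Re_exp Im_exp)
  qed (use wb in auto)
  have im: "(\<integral>x. (w x * sin (z \<bullet> x)) * indicator (A b) (x \<bullet> b) \<partial>\<mu>) = (\<integral>x. (w x * sin (z \<bullet> x)) * indicator (A b) (x \<bullet> b) \<partial>\<mu>')"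
  proof (rule key)
    show "complex_of_real (w x * sin (z \<bullet> x)) = (-\<i>/2) * (w x *\<^sub>R iexp (z \<bullet> x)) + (\<i>/2) * (w x *\<^sub>R iexp ((-z) \<bullet> x))" for x
      by (simp add: complex_eq_iff Re_exp Im_exp)
  qed (use wb in auto)
  have split: "(CLINT x|m. (w x * indicator (A b) (x \<bullet> b)) *\<^sub>R iexp (z \<bullet> x)) =
      complex_of_real (\<integral>x. (w x * cos (z \<bullet> x)) * indicator (A b) (x \<bullet> b) \<partial>m)
      + \<i> * complex_of_real (\<integral>x. (w x * sin (z \<bullet> x)) * indicator (A b) (x \<bullet> b) \<partial>m)"
    if "prob_space m" "sets m = sets borel" for m
  proof -
    interpret m: prob_space m by fact
    note [measurable_cong] = that(2)
    have [simp]: "integrable m (\<lambda>x. (w x * cos (z \<bullet> x)) * indicator (A b) (x \<bullet> b))"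
        "integrable m (\<lambda>x. (w x * sin (z \<bullet> x)) * indicator (A b) (x \<bullet> b))"
      by (rule m.integrable_const_bound[where B = 1]; use wb in \<open>auto split: split_indicator\<close>)+
    have "(CLINT x|m. (w x * indicator (A b) (x \<bullet> b)) *\<^sub>R iexp (z \<bullet> x)) =
      (CLINT x|m. complex_of_real ((w x * cos (z \<bullet> x)) * indicator (A b) (x \<bullet> b))
         + \<i> * complex_of_real ((w x * sin (z \<bullet> x)) * indicator (A b) (x \<bullet> b)))"
      by (intro Bochner_Integration.integral_cong) (auto simp: complex_eq_iff Re_exp Im_exp)
    then show ?thesis
      by (subst (asm) Bochner_Integration.integral_add)
         (simp_all only: integral_mult_right_zero integral_complex_of_real,
           auto simp: complex_of_real_integrable_eq simp del: of_real_mult intro!: integrable_mult_right)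
  qed
  have "(\<Prod>b\<in>insert b S. indicator (A b) (x \<bullet> b) :: real) = w x * indicator (A b) (x \<bullet> b)" for x
    using insert by (simp add: w_def)
  then show ?case
    using split re im sets M.prob_space_axioms M'.prob_space_axioms by simp
qed

text \<open>Open boxes are an intersection-stable generator, and their measure is the box integral
  at frequency 0.\<close>

theorem char_fn_uniqueness:
  fixes \<mu> \<mu>' :: "'a::euclidean_space measure"
  assumes \<mu>: "prob_space \<mu>" "prob_space \<mu>'" and sets: "sets \<mu> = sets borel" "sets \<mu>' = sets borel"
    and char: "\<And>z. char_fn \<mu> z = char_fn \<mu>' z"
  shows "\<mu> = \<mu>'"
proof (rule measure_eqI_generator_eq)
  let ?E = "range (\<lambda>(a, b). box a b :: 'a set)"
  interpret M: prob_space \<mu> by fact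
  interpret M': prob_space \<mu>' by fact
  show "Int_stable ?E"
    by (auto simp: Int_stable_def box_Int_box)
  show "?E \<subseteq> Pow UNIV" "sets \<mu> = sigma_sets UNIV ?E" "sets \<mu>' = sigma_sets UNIV ?E"
    by (simp_all add: borel_eq_box sets)
  let ?B = "\<lambda>n::nat. box (- (real n *\<^sub>R One)) (real n *\<^sub>R One) :: 'a set"
  show "range ?B \<subseteq> ?E" "(\<Union>i. ?B i) = UNIV"
    unfolding UN_box_eq_UNIV by auto
  show "emeasure \<mu> (?B i) \<noteq> \<infinity>" for i
    by simp
  fix X assume "X \<in> ?E"
  then obtain l u where X: "X = box l u" by auto
  have prod: "(\<Prod>b\<in>Basis. indicator {l \<bullet> b <..< u \<bullet> b} (x \<bullet> b) :: real) = indicator X x" for x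
    by (auto simp: X box_def split: split_indicator intro: prod.neutral)
  have "complex_of_real (measure \<mu> X) = complex_of_real (measure \<mu>' X)"
    using integral_box_char_fn_eq[OF \<mu> sets char finite_Basis, of "\<lambda>b. {l \<bullet> b <..< u \<bullet> b}" 0]
    by (simp add: prod X sets scaleR_conv_of_real)
  then show "emeasure \<mu> X = emeasure \<mu>' X"
    by (simp add: M.emeasure_eq_measure M'.emeasure_eq_measure)
qed

section \<open>Cumulant functions of finite Levy measures\<close>

lemma min_add_le: "r \<le> p + q \<Longrightarrow> 0 \<le> p \<Longrightarrow> 0 \<le> q \<Longrightarrow> min 2 r \<le> min 2 p + min 2 (q::real)"
  by (auto simp: min_def)

lemma min_mult_le:
  assumes "0 \<le> c" "0 \<le> p" shows "min 2 (c * p) \<le> (1 + c) * min 2 (p::real)"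
proof (cases "p \<le> 2")
  case True
  have "min 2 (c * p) \<le> c * p" by simp
  also have "\<dots> \<le> (1 + c) * p" using assms by (simp add: algebra_simps)
  finally show ?thesis using True by simp
qed (use assms in simp)

lemma ennreal_le_mult: "0 \<le> a \<Longrightarrow> 0 \<le> b \<Longrightarrow> x \<le> a * b \<Longrightarrow> ennreal x \<le> ennreal a * ennreal b"
  by (simp add: ennreal_leI flip: ennreal_mult)

section \<open>The control function of the cumulant function\<close>

locale finite_jumps =
  fixes \<nu> :: "'a::euclidean_space measure" and \<gamma> :: 'a
  assumes finite_\<nu>: "finite_measure \<nu>" and sets_\<nu> [simp, measurable_cong]: "sets \<nu> = sets borel"
begin

sublocale \<nu>: finite_measure \<nu> by (rule finite_\<nu>)

text \<open>With absolute values inside, \<open>K\<close> is even and subadditive on the whole line,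
  so it can be applied to differences of integrands and not only to their sizes.\<close>

definition K :: "real \<Rightarrow> real" where
  "K x = norm \<gamma> * \<bar>x\<bar> + (\<integral>y. min 2 (\<bar>x\<bar> * norm y) \<partial>\<nu>)"

abbreviation C :: "'a \<Rightarrow> complex" where "C \<equiv> cgf \<nu> \<gamma>"

lemma integrable_min_norm [simp]: "0 \<le> x \<Longrightarrow> integrable \<nu> (\<lambda>y. min 2 (x * norm y))"
  by (rule \<nu>.integrable_const_bound[where B = 2]) auto

lemma integrable_iexp_minus_one [simp]: "complex_integrable \<nu> (\<lambda>y. iexp (z \<bullet> y) - 1)"
  by (rule \<nu>.integrable_const_bound[where B = 2])
     (auto intro!: AE_I2 order_trans[OF cmod_iexp_minus_one_le])

lemma K_measurable [measurable]: "K \<in> borel_measurable borel"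
  unfolding K_def by measurable

lemma K_nonneg [simp]: "0 \<le> K x"
  unfolding K_def by (intro add_nonneg_nonneg mult_nonneg_nonneg integral_nonneg) auto

lemma K_0 [simp]: "K 0 = 0"
  by (simp add: K_def)

lemma K_mono: "\<bar>x\<bar> \<le> \<bar>y\<bar> \<Longrightarrow> K x \<le> K y"
  unfolding K_def
  by (intro add_mono mult_left_mono integral_mono) (auto intro!: min.mono mult_right_mono simp del: min.bounded_iff)

lemma K_abs [simp]: "K \<bar>x\<bar> = K x" "K (- x) = K x"
  by (simp_all add: K_def)

lemma K_add: "K (x + y) \<le> K x + K y"
proof -
  have "(\<integral>w. min 2 (\<bar>x + y\<bar> * norm w) \<partial>\<nu>) \<le> (\<integral>w. min 2 (\<bar>x\<bar> * norm w) + min 2 (\<bar>y\<bar> * norm w) \<partial>\<nu>)"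
  proof (rule integral_mono)
    fix w
    have "\<bar>x + y\<bar> * norm w \<le> \<bar>x\<bar> * norm w + \<bar>y\<bar> * norm w"
      by (metis abs_triangle_ineq distrib_right mult_right_mono norm_ge_zero)
    then show "min 2 (\<bar>x + y\<bar> * norm w) \<le> min 2 (\<bar>x\<bar> * norm w) + min 2 (\<bar>y\<bar> * norm w)"
      by (rule min_add_le) auto
  qed auto
  moreover have "norm \<gamma> * \<bar>x + y\<bar> \<le> norm \<gamma> * \<bar>x\<bar> + norm \<gamma> * \<bar>y\<bar>"
    by (metis abs_triangle_ineq distrib_left mult_left_mono norm_ge_zero)
  ultimately show ?thesis
    by (simp add: K_def)
qed

text \<open>The truncated term does not scale: for small arguments it grows like
  \<open>\<bar>c\<bar>\<close>, and elsewhere it is capped. The factor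
  \<open>1 + \<bar>c\<bar>\<close> dominates both \<open>\<bar>c\<bar>\<close> and 1.\<close>

lemma K_mult: "K (c * x) \<le> (1 + \<bar>c\<bar>) * K x"
proof -
  have "(\<integral>w. min 2 (\<bar>c * x\<bar> * norm w) \<partial>\<nu>) \<le> (\<integral>w. (1 + \<bar>c\<bar>) * min 2 (\<bar>x\<bar> * norm w) \<partial>\<nu>)"
  proof (rule integral_mono)
    fix w
    show "min 2 (\<bar>c * x\<bar> * norm w) \<le> (1 + \<bar>c\<bar>) * min 2 (\<bar>x\<bar> * norm w)"
      using min_mult_le[of "\<bar>c\<bar>" "\<bar>x\<bar> * norm w"] by (simp add: abs_mult mult.assoc)
  qed auto
  moreover have "norm \<gamma> * \<bar>c * x\<bar> \<le> (1 + \<bar>c\<bar>) * (norm \<gamma> * \<bar>x\<bar>)"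
    by (simp add: abs_mult algebra_simps)
  ultimately show ?thesis
    by (simp add: K_def distrib_left)
qed

lemma isCont_K [simp]: "isCont K x"
proof (rule continuous_at_sequentiallyI)
  fix u :: "nat \<Rightarrow> real" assume u: "u \<longlonglongrightarrow> x"
  have "(\<lambda>n. \<integral>y. min 2 (\<bar>u n\<bar> * norm y) \<partial>\<nu>) \<longlonglongrightarrow> (\<integral>y. min 2 (\<bar>x\<bar> * norm y) \<partial>\<nu>)"
    by (rule integral_dominated_convergence[where w = "\<lambda>_. 2"])
       (auto intro!: tendsto_intros u)
  then show "(\<lambda>n. K (u n)) \<longlonglongrightarrow> K x"
    unfolding K_def by (intro tendsto_intros u)
qed

lemma C_0 [simp]: "C 0 = 0"
  by (simp add: cgf_def)

lemma C_diff: "cmod (C z - C z') \<le> K (norm (z - z'))"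
proof -
  have "C z - C z' = \<i> * complex_of_real (\<gamma> \<bullet> (z - z')) + (CLINT y|\<nu>. (iexp (z \<bullet> y) - 1) - (iexp (z' \<bullet> y) - 1))"
    unfolding cgf_def by (subst Bochner_Integration.integral_diff) (simp_all add: algebra_simps inner_diff_right)
  also have "cmod \<dots> \<le> \<bar>\<gamma> \<bullet> (z - z')\<bar> + (\<integral>y. cmod ((iexp (z \<bullet> y) - 1) - (iexp (z' \<bullet> y) - 1)) \<partial>\<nu>)"
    by (rule norm_triangle_le, rule add_mono) (simp add: norm_mult, rule integral_norm_bound)
  also have "(\<integral>y. cmod ((iexp (z \<bullet> y) - 1) - (iexp (z' \<bullet> y) - 1)) \<partial>\<nu>) \<le> (\<integral>y. min 2 (\<bar>norm (z - z')\<bar> * norm y) \<partial>\<nu>)"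
  proof (rule integral_mono)
    fix y
    have "\<bar>z \<bullet> y - z' \<bullet> y\<bar> \<le> \<bar>norm (z - z')\<bar> * norm y"
      by (metis Cauchy_Schwarz_ineq2 abs_norm_cancel inner_diff_left)
    then show "cmod ((iexp (z \<bullet> y) - 1) - (iexp (z' \<bullet> y) - 1)) \<le> min 2 (\<bar>norm (z - z')\<bar> * norm y)"
      using cmod_iexp_diff_le[of "z \<bullet> y" "z' \<bullet> y"] by simp
  qed (intro Bochner_Integration.integrable_norm Bochner_Integration.integrable_diff[OF integrable_iexp_minus_one integrable_iexp_minus_one], simp)
  also have "\<bar>\<gamma> \<bullet> (z - z')\<bar> \<le> norm \<gamma> * \<bar>norm (z - z')\<bar>"
    using Cauchy_Schwarz_ineq2[of \<gamma> "z - z'"] by simp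
  finally show ?thesis
    by (simp add: K_def)
qed

text \<open>The direction \<open>z\<close> leaves only the factor \<open>1 + norm z\<close>, so a
  single function \<open>K\<close> of the scalar controls all directions at once.\<close>

lemma C_scale_diff: "cmod (C (x *\<^sub>R z) - C (x' *\<^sub>R z)) \<le> (1 + norm z) * K (x - x')"
proof -
  have "norm (x *\<^sub>R z - x' *\<^sub>R z) = \<bar>norm z * (x - x')\<bar>"
    by (simp add: abs_mult flip: scaleR_diff_left)
  then have "cmod (C (x *\<^sub>R z) - C (x' *\<^sub>R z)) \<le> K (norm z * (x - x'))"
    using C_diff[of "x *\<^sub>R z" "x' *\<^sub>R z"] by simp
  also have "\<dots> \<le> (1 + norm z) * K (x - x')"
    using K_mult[of "norm z"] by simp
  finally show ?thesis .
qed

lemma C_scale: "cmod (C (x *\<^sub>R z)) \<le> (1 + norm z) * K x"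
  using C_scale_diff[of x z 0] by simp

lemma isCont_C [simp]: "isCont C z"
proof (rule continuous_at_sequentiallyI)
  fix u :: "nat \<Rightarrow> 'a" assume u: "u \<longlonglongrightarrow> z"
  have "(\<lambda>n. norm (u n - z)) \<longlonglongrightarrow> norm (z - z)" by (intro tendsto_intros u)
  then have "(\<lambda>n. K (norm (u n - z))) \<longlonglongrightarrow> K 0"
    by (intro isCont_tendsto_compose[of 0 K]) simp_all
  then have "(\<lambda>n. K (norm (u n - z))) \<longlonglongrightarrow> 0" by simp
  then have "(\<lambda>n. C (u n) - C z) \<longlonglongrightarrow> 0"
    by (rule Lim_null_comparison[rotated]) (simp add: C_diff)
  then show "(\<lambda>n. C (u n)) \<longlonglongrightarrow> C z"
    by (simp add: LIM_zero_iff)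
qed

lemma continuous_on_C: "continuous_on S C"
  by (simp add: continuous_at_imp_continuous_on)

lemma C_measurable [measurable]: "C \<in> borel_measurable borel"
  by (rule borel_measurable_continuous_onI) (rule continuous_on_C)

text \<open>This confines exponents to the half-plane on which \<open>exp\<close> is 1-Lipschitz
  (\<open>norm_exp_diff_le\<close>).\<close>

lemma Re_C_nonpos: "Re (C z) \<le> 0"
proof -
  have "Re (C z) = (\<integral>y. cos (z \<bullet> y) - 1 \<partial>\<nu>)"
    by (simp add: cgf_def Re_exp flip: integral_Re)
  also have "\<dots> \<le> (\<integral>y. 0 \<partial>\<nu>)"
    by (rule integral_mono) (auto intro!: \<nu>.integrable_const_bound[where B = 2] order_trans[OF abs_triangle_ineq4])
  finally show ?thesis by simp
qed

section \<open>The modular on integrands\<close>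

text \<open>It stands in for the L2 norm of the Wiener integral: even, subadditive, and compatible
  with scalars up to the factor in \<open>\<rho>_mult\<close>. Values in \<open>ennreal\<close>
  spare integrability conditions.\<close>

definition \<rho> :: "(real \<Rightarrow> real) \<Rightarrow> ennreal" where
  "\<rho> h = (\<integral>\<^sup>+ s. ennreal (K (h s)) \<partial>lborel)"

lemma \<rho>_cong_AE: "AE s in lborel. h s = h' s \<Longrightarrow> \<rho> h = \<rho> h'"
  unfolding \<rho>_def by (intro nn_integral_cong_AE) auto

lemma \<rho>_0 [simp]: "\<rho> (\<lambda>_. 0) = 0"
  by (simp add: \<rho>_def)

lemma \<rho>_add:
  assumes [measurable]: "h \<in> borel_measurable borel" "h' \<in> borel_measurable borel"
  shows "\<rho> (\<lambda>s. h s + h' s) \<le> \<rho> h + \<rho> h'"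
proof -
  have "\<rho> (\<lambda>s. h s + h' s) \<le> (\<integral>\<^sup>+ s. ennreal (K (h s)) + ennreal (K (h' s)) \<partial>lborel)"
    unfolding \<rho>_def by (intro nn_integral_mono) (simp add: K_add ennreal_leI flip: ennreal_plus)
  also have "\<dots> = \<rho> h + \<rho> h'"
    unfolding \<rho>_def by (rule nn_integral_add) auto
  finally show ?thesis .
qed

lemma \<rho>_mult:
  assumes [measurable]: "h \<in> borel_measurable borel"
  shows "\<rho> (\<lambda>s. c * h s) \<le> ennreal (1 + \<bar>c\<bar>) * \<rho> h"
proof -
  have "\<rho> (\<lambda>s. c * h s) \<le> (\<integral>\<^sup>+ s. ennreal (1 + \<bar>c\<bar>) * ennreal (K (h s)) \<partial>lborel)"
    unfolding \<rho>_def by (intro nn_integral_mono) (auto intro!: ennreal_le_mult K_mult simp del: ennreal_plus)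
  also have "\<dots> = ennreal (1 + \<bar>c\<bar>) * \<rho> h"
    unfolding \<rho>_def by (rule nn_integral_cmult) auto
  finally show ?thesis .
qed

lemma \<rho>_minus: "\<rho> (\<lambda>s. h s - h' s) = \<rho> (\<lambda>s. h' s - h s)"
  unfolding \<rho>_def using K_abs(2) by (metis minus_diff_eq)

lemma \<rho>_diff_triangle:
  assumes [measurable]: "h \<in> borel_measurable borel" "h' \<in> borel_measurable borel" "h'' \<in> borel_measurable borel"
  shows "\<rho> (\<lambda>s. h s - h'' s) \<le> \<rho> (\<lambda>s. h s - h' s) + \<rho> (\<lambda>s. h' s - h'' s)"
  using \<rho>_add[of "\<lambda>s. h s - h' s" "\<lambda>s. h' s - h'' s"] by simp

lemma \<rho>_indicator: "B \<in> sets borel \<Longrightarrow> \<rho> (\<lambda>s. a * indicator B s) = ennreal (K a) * emeasure lborel B"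
proof -
  assume B: "B \<in> sets borel"
  have "\<rho> (\<lambda>s. a * indicator B s) = (\<integral>\<^sup>+ s. ennreal (K a) * indicator B s \<partial>lborel)"
    unfolding \<rho>_def by (intro nn_integral_cong) (auto split: split_indicator)
  then show ?thesis using B by (simp add: nn_integral_cmult_indicator)
qed

lemma \<rho>_dominated_convergence:
  fixes g :: "nat \<Rightarrow> real \<Rightarrow> real"
  assumes [measurable]: "\<And>n. g n \<in> borel_measurable borel" "h \<in> borel_measurable borel" "w \<in> borel_measurable borel"
    and w: "\<rho> w < \<infinity>" and lim: "AE s in lborel. (\<lambda>n. g n s) \<longlonglongrightarrow> h s"
    and bound: "\<And>n. AE s in lborel. \<bar>g n s - h s\<bar> \<le> \<bar>w s\<bar>"
  shows "(\<lambda>n. \<rho> (\<lambda>s. g n s - h s)) \<longlonglongrightarrow> 0"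
proof -
  have "(\<lambda>n. \<integral>\<^sup>+ s. ennreal (K (g n s - h s)) \<partial>lborel) \<longlonglongrightarrow> (\<integral>\<^sup>+ (s::real). ennreal (K 0) \<partial>lborel)"
  proof (rule nn_integral_dominated_convergence[where w = "\<lambda>s. ennreal (K (w s))"])
    show "AE s in lborel. ennreal (K (g n s - h s)) \<le> ennreal (K (w s))" for n
      using bound[of n] by eventually_elim (auto intro: K_mono ennreal_leI)
    show "AE s in lborel. (\<lambda>n. ennreal (K (g n s - h s))) \<longlonglongrightarrow> ennreal (K 0)"
      using lim
    proof eventually_elim
      case (elim s)
      have "(\<lambda>n. g n s - h s) \<longlonglongrightarrow> 0" using elim by (simp add: LIM_zero_iff)
      then show ?case
        by (intro tendsto_ennrealI isCont_tendsto_compose[of 0 K]) simp_all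
    qed
  qed (use w in \<open>auto simp: \<rho>_def\<close>)
  then show ?thesis by (simp add: \<rho>_def)
qed

lemma C_integrable:
  assumes [measurable]: "h \<in> borel_measurable borel" and h: "\<rho> h < \<infinity>"
  shows "complex_integrable lborel (\<lambda>s. C (h s *\<^sub>R z))"
proof (rule integrableI_bounded)
  have "(\<integral>\<^sup>+ s. ennreal (cmod (C (h s *\<^sub>R z))) \<partial>lborel) \<le> (\<integral>\<^sup>+ s. ennreal (1 + norm z) * ennreal (K (h s)) \<partial>lborel)"
    by (intro nn_integral_mono) (auto intro!: ennreal_le_mult C_scale simp del: ennreal_plus)
  also have "\<dots> = ennreal (1 + norm z) * \<rho> h"
    unfolding \<rho>_def by (rule nn_integral_cmult) auto
  also have "\<dots> < \<infinity>" using h by (simp add: ennreal_mult_less_top)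
  finally show "(\<integral>\<^sup>+ s. ennreal (cmod (C (h s *\<^sub>R z))) \<partial>lborel) < \<infinity>" .
qed simp

text \<open>The exponent of the characteristic function is Lipschitz in \<rho> with a constant
  depending on \<open>z\<close> only. This is the analytic half of the passage to the closure;
  convergence in probability is the other.\<close>

lemma C_integral_diff:
  assumes [measurable]: "h \<in> borel_measurable borel" "h' \<in> borel_measurable borel"
    and h: "\<rho> h < \<infinity>" "\<rho> h' < \<infinity>"
  shows "ennreal (cmod ((CLBINT s. C (h s *\<^sub>R z)) - (CLBINT s. C (h' s *\<^sub>R z))))
    \<le> ennreal (1 + norm z) * \<rho> (\<lambda>s. h s - h' s)"
proof -
  have "(CLBINT s. C (h s *\<^sub>R z)) - (CLBINT s. C (h' s *\<^sub>R z)) = (CLBINT s. C (h s *\<^sub>R z) - C (h' s *\<^sub>R z))"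
    by (intro Bochner_Integration.integral_diff[symmetric] C_integrable h) auto
  also have "ennreal (cmod \<dots>) \<le> (\<integral>\<^sup>+ s. ennreal (cmod (C (h s *\<^sub>R z) - C (h' s *\<^sub>R z))) \<partial>lborel)"
    by (intro integral_norm_bound_ennreal Bochner_Integration.integrable_diff C_integrable h) auto
  also have "\<dots> \<le> (\<integral>\<^sup>+ s. ennreal (1 + norm z) * ennreal (K (h s - h' s)) \<partial>lborel)"
    by (intro nn_integral_mono) (auto intro!: ennreal_le_mult C_scale_diff simp del: ennreal_plus)
  also have "\<dots> = ennreal (1 + norm z) * \<rho> (\<lambda>s. h s - h' s)"
    unfolding \<rho>_def by (rule nn_integral_cmult) auto
  finally show ?thesis .
qed

end

section \<open>Characteristic functions of the process at fixed times\<close>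

text \<open>The name reflects the finite jump measure: \<open>Y\<close> is compound Poisson with
  drift. Only the law at time 1 is given; \<open>\<phi>_Y\<close> recovers the others.\<close>

locale compound_Poisson_process = finite_jumps \<nu> \<gamma> for \<nu> :: "'a::euclidean_space measure" and \<gamma> +
  fixes Q :: "'w measure" and Y :: "real \<Rightarrow> 'w \<Rightarrow> 'a"
  assumes levy: "levy_process Q Y" and ID0: "is_ID0 \<nu> \<gamma> (distr Q borel (Y 1))"
begin

sublocale prob_space Q using levy by (simp add: levy_process_def)

lemma Y_measurable [measurable]: "0 \<le> t \<Longrightarrow> Y t \<in> borel_measurable Q"
  using levy by (simp add: levy_process_def)

lemma Y_0: "AE \<omega> in Q. Y 0 \<omega> = 0"
  using levy by (simp add: levy_process_def)

abbreviation \<phi> :: "('w \<Rightarrow> 'a) \<Rightarrow> 'a \<Rightarrow> complex" where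
  "\<phi> J z \<equiv> (CLINT \<omega>|Q. iexp (z \<bullet> J \<omega>))"

lemma complex_integrable_iexp:
  fixes J :: "'w \<Rightarrow> 'a"
  assumes [measurable]: "J \<in> borel_measurable Q"
  shows "complex_integrable Q (\<lambda>\<omega>. iexp (z \<bullet> J \<omega>))"
  by (rule integrable_const_bound[where B = 1]) simp_all

lemma \<phi>_cong_AE:
  assumes [measurable]: "J \<in> borel_measurable Q" "J' \<in> borel_measurable Q" and "AE \<omega> in Q. J \<omega> = J' \<omega>"
  shows "\<phi> J z = \<phi> J' z"
  by (rule integral_cong_AE) (use assms(3) in auto)

lemma \<phi>_increment:
  assumes "0 \<le> s" "s \<le> t"
  shows "\<phi> (\<lambda>\<omega>. Y t \<omega> - Y s \<omega>) z = \<phi> (Y (t - s)) z"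
proof -
  have [measurable]: "Y t \<in> borel_measurable Q" "Y s \<in> borel_measurable Q" "Y (t - s) \<in> borel_measurable Q" "Y 0 \<in> borel_measurable Q"
    using assms by auto
  have "\<forall>s\<ge>0. \<forall>t\<ge>0. distr Q borel (\<lambda>\<omega>. Y (s + t) \<omega> - Y s \<omega>) = distr Q borel (\<lambda>\<omega>. Y t \<omega> - Y 0 \<omega>)"
    using levy unfolding levy_process_def by (elim conjE)
  then have d: "distr Q borel (\<lambda>\<omega>. Y (s + (t - s)) \<omega> - Y s \<omega>) = distr Q borel (\<lambda>\<omega>. Y (t - s) \<omega> - Y 0 \<omega>)"
    using assms by (metis diff_ge_0_iff_ge)
  have "\<phi> (\<lambda>\<omega>. Y t \<omega> - Y s \<omega>) z = (CLINT x|distr Q borel (\<lambda>\<omega>. Y (s + (t - s)) \<omega> - Y s \<omega>). iexp (z \<bullet> x))"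
    by (subst integral_distr) auto
  also have "\<dots> = \<phi> (\<lambda>\<omega>. Y (t - s) \<omega> - Y 0 \<omega>) z"
    unfolding d by (subst integral_distr) auto
  also have "\<dots> = \<phi> (Y (t - s)) z"
    by (rule \<phi>_cong_AE) (use Y_0 in auto)
  finally show ?thesis .
qed

definition increment :: "(nat \<Rightarrow> real) \<Rightarrow> nat \<Rightarrow> 'w \<Rightarrow> 'a" where
  "increment t i \<omega> = (if i = 0 then Y (t 0) \<omega> else Y (t i) \<omega> - Y (t (i - 1)) \<omega>)"

lemma \<phi>_sum_increments:
  fixes t :: "nat \<Rightarrow> real" and a :: "nat \<Rightarrow> real"
  assumes t: "0 \<le> t 0" "\<And>i. i < n \<Longrightarrow> t i < t (Suc i)"
  shows "\<phi> (\<lambda>\<omega>. \<Sum>i\<le>n. a i *\<^sub>R increment t i \<omega>) z = (\<Prod>i\<le>n. \<phi> (increment t i) (a i *\<^sub>R z))"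
proof -
  have "indep_vars (\<lambda>_. borel) (\<lambda>i \<omega>. if i = 0 then Y (t 0) \<omega> else Y (t i) \<omega> - Y (t (i - 1)) \<omega>) {..n}"
    using levy t unfolding levy_process_def by blast
  then have ind: "indep_vars (\<lambda>_. borel) (increment t) {..n}"
    by (simp add: increment_def[abs_def])
  then have [measurable]: "\<And>i. i \<le> n \<Longrightarrow> increment t i \<in> borel_measurable Q"
    by (auto simp: indep_vars_def)
  have ind2: "indep_vars (\<lambda>_. borel) (\<lambda>i \<omega>. iexp ((a i *\<^sub>R z) \<bullet> increment t i \<omega>)) {..n}"
    by (rule indep_vars_compose2[OF ind, where Y = "\<lambda>i x. iexp ((a i *\<^sub>R z) \<bullet> x)"]) auto
  have "iexp (z \<bullet> (\<Sum>i\<le>n. a i *\<^sub>R increment t i \<omega>)) = (\<Prod>i\<le>n. iexp ((a i *\<^sub>R z) \<bullet> increment t i \<omega>))" for \<omega>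
    by (simp add: inner_sum_right sum_distrib_left exp_sum)
  then have "\<phi> (\<lambda>\<omega>. \<Sum>i\<le>n. a i *\<^sub>R increment t i \<omega>) z = (CLINT \<omega>|Q. (\<Prod>i\<le>n. iexp ((a i *\<^sub>R z) \<bullet> increment t i \<omega>)))"
    by simp
  also have "\<dots> = (\<Prod>i\<le>n. \<phi> (increment t i) (a i *\<^sub>R z))"
    by (rule indep_vars_lebesgue_integral[OF _ ind2]) (auto intro!: complex_integrable_iexp simp del: of_real_mult inner_scaleR_left)
  finally show ?thesis .
qed

lemma \<phi>_Y_0 [simp]: "\<phi> (Y 0) z = 1"
proof -
  have "\<phi> (Y 0) z = \<phi> (\<lambda>_. 0) z"
    by (rule \<phi>_cong_AE) (use Y_0 in auto)
  then show ?thesis by (simp add: prob_space)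
qed

lemma \<phi>_Y_add:
  assumes "0 \<le> s" "0 \<le> t"
  shows "\<phi> (Y (s + t)) z = \<phi> (Y s) z * \<phi> (Y t) z"
\<comment> \<open>Independence is available along strictly increasing grids, so the grid
  \<open>s, s + t\<close> requires \<open>t\<close> to be nonzero.\<close>
proof (cases "t = 0")
  case False
  define u where "u i = (if i = 0 then s else s + t)" for i :: nat
  have "\<phi> (\<lambda>\<omega>. \<Sum>i\<le>1. 1 *\<^sub>R increment u i \<omega>) z = (\<Prod>i\<le>1. \<phi> (increment u i) (1 *\<^sub>R z))"
    by (rule \<phi>_sum_increments) (use assms False in \<open>auto simp: u_def\<close>)
  then show ?thesis
    using \<phi>_increment[of s "s + t" z] assms by (simp add: increment_def[abs_def] u_def)
qed simp

lemma \<phi>_Y_mult: "0 \<le> t \<Longrightarrow> \<phi> (Y (real n * t)) z = \<phi> (Y t) z ^ n"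
proof (induction n)
  case (Suc n)
  then show ?case
    using \<phi>_Y_add[of t "real n * t" z] by (simp add: distrib_right)
qed simp

lemma \<phi>_Y_1: "\<phi> (Y 1) z = exp (C z)"
proof -
  have "char_fn (distr Q borel (Y 1)) z = exp (C z)"
    using ID0 by (simp add: is_ID0_def)
  then show ?thesis
    by (simp add: char_fn_def integral_distr)
qed

lemma continuous_\<phi>:
  assumes [measurable]: "J \<in> borel_measurable Q"
  shows "continuous_on UNIV (\<phi> J)"
proof (rule continuous_at_imp_continuous_on, rule ballI, rule continuous_at_sequentiallyI)
  fix z and u :: "nat \<Rightarrow> 'a" assume u: "u \<longlonglongrightarrow> z"
  show "(\<lambda>n. \<phi> J (u n)) \<longlonglongrightarrow> \<phi> J z"
    by (rule integral_dominated_convergence[where w = "\<lambda>_. 1"]) (auto intro!: tendsto_intros u)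
qed

text \<open>The quotient of the two sides is a continuous function of \<open>z\<close> with values in the \<open>n\<close>-th roots
  of unity, hence constant.\<close>

lemma \<phi>_Y_inverse:
  assumes "n > 0"
  shows "\<phi> (Y (1 / real n)) z = exp (C z / of_nat n)"
proof -
  have [measurable]: "Y (1 / real n) \<in> borel_measurable Q" by simp
  define g where "g z = \<phi> (Y (1 / real n)) z * exp (- C z / of_nat n)" for z
  have "g z ^ n = 1" for z
  proof -
    have "\<phi> (Y (1 / real n)) z ^ n = exp (C z)"
      using \<phi>_Y_mult[where t = "1 / real n" and n = n and z = z] \<phi>_Y_1[of z] assms by simp
    moreover have "exp (- C z / of_nat n) ^ n = exp (- C z)"
      using assms by (subst exp_of_nat_mult[symmetric]) simp
    ultimately show ?thesis
      by (simp add: g_def power_mult_distrib flip: exp_add)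
  qed
  then have "finite (range g)"
    by (intro finite_subset[OF _ finite_roots_unity]) (use assms in auto)
  moreover have "continuous_on UNIV g"
    unfolding g_def by (intro continuous_intros continuous_\<phi> continuous_on_C) (use assms in auto)
  ultimately have "g constant_on UNIV"
    by (intro continuous_finite_range_constant) auto
  then have "g z = g 0" by (auto simp: constant_on_def)
  also have "g 0 = 1" by (simp add: g_def prob_space)
  finally show ?thesis
    by (simp add: g_def exp_minus field_simps)
qed

text \<open>Rational times follow from roots and powers of \<open>\<phi> (Y 1)\<close>; stochastic
  continuity extends the formula to real times.\<close>

lemma \<phi>_Y:
  assumes "0 \<le> t"
  shows "\<phi> (Y t) z = exp (t *\<^sub>R C z)"
proof -
  \<comment> \<open>The largest multiple of \<open>1 / Suc n\<close> not exceeding \<open>t\<close>,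
    hence a time reached by \<open>\<phi>_Y_inverse\<close> and
    \<open>\<phi>_Y_mult\<close>.\<close>
  define r where "r n = real (nat \<lfloor>t * real (Suc n)\<rfloor>) * (1 / real (Suc n))" for n
  have r0: "r n \<ge> 0" for n by (simp add: r_def)
  have "(\<lambda>n. 1 / real (Suc n)) \<longlonglongrightarrow> 0" by (rule LIMSEQ_Suc[OF lim_1_over_n])
  have "r \<longlonglongrightarrow> t"
  proof (rule tendsto_sandwich)
    show "eventually (\<lambda>n. t - 1 / real (Suc n) \<le> r n) sequentially"
    proof (intro always_eventually allI)
      fix n
      have "t * real (Suc n) - 1 \<le> real (nat \<lfloor>t * real (Suc n)\<rfloor>)" by linarith
      then have "(t * real (Suc n) - 1) / real (Suc n) \<le> r n" unfolding r_def by (simp add: divide_right_mono)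
      then show "t - 1 / real (Suc n) \<le> r n" by (simp add: diff_divide_distrib)
    qed
    show "eventually (\<lambda>n. r n \<le> t) sequentially"
    proof (intro always_eventually allI)
      fix n
      have "real (nat \<lfloor>t * real (Suc n)\<rfloor>) \<le> t * real (Suc n)" using \<open>0 \<le> t\<close> by simp
      then have "r n \<le> t * real (Suc n) * (1 / real (Suc n))" unfolding r_def by (rule mult_right_mono) simp
      then show "r n \<le> t" by simp
    qed
    show "(\<lambda>n. t - 1 / real (Suc n)) \<longlonglongrightarrow> t"
      using tendsto_diff[OF tendsto_const[of t] LIMSEQ_Suc[OF lim_1_over_n]] by simp
  qed simp
  have [measurable]: "Y t \<in> borel_measurable Q" "\<And>n. Y (r n) \<in> borel_measurable Q" using assms r0 by auto
  have "tendsto_in_prob Q (\<lambda>n. Y (r n)) (Y t) sequentially"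
    unfolding tendsto_in_prob_def
  proof (intro allI impI)
    fix \<epsilon> :: real assume "\<epsilon> > 0"
    then have "((\<lambda>s. prob {\<omega> \<in> space Q. \<epsilon> < norm (Y s \<omega> - Y t \<omega>)}) \<longlongrightarrow> 0) (at t within {0..})"
      using levy assms by (simp add: levy_process_def)
    \<comment> \<open>The filter \<open>at t within {0..}\<close> omits \<open>t\<close>, but
      \<open>r n\<close> may equal \<open>t\<close>. At \<open>t\<close> the probability is 0, so
      the limit is in fact continuity, which admits such sequences.\<close>
    then have "continuous (at t within {0..}) (\<lambda>s. prob {\<omega> \<in> space Q. \<epsilon> < norm (Y s \<omega> - Y t \<omega>)})"
      using \<open>\<epsilon> > 0\<close> by (simp add: continuous_within not_less)
    then show "(\<lambda>n. prob {\<omega> \<in> space Q. \<epsilon> < norm (Y (r n) \<omega> - Y t \<omega>)}) \<longlonglongrightarrow> 0"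
      unfolding continuous_within_sequentially
      using \<open>r \<longlonglongrightarrow> t\<close> r0 \<open>\<epsilon> > 0\<close> by (auto simp: comp_def not_less)
  qed
  then have "(\<lambda>n. \<phi> (Y (r n)) z) \<longlonglongrightarrow> \<phi> (Y t) z"
    by (intro tendsto_char) auto
  moreover have "\<phi> (Y (r n)) z = exp (r n *\<^sub>R C z)" for n
    unfolding r_def
    using \<phi>_Y_mult[where t = "1 / real (Suc n)" and n = "nat \<lfloor>t * real (Suc n)\<rfloor>" and z = z] \<phi>_Y_inverse[of "Suc n" z]
    by (simp add: scaleR_conv_of_real flip: exp_of_nat_mult del: of_nat_Suc)
  moreover have "(\<lambda>n. exp (r n *\<^sub>R C z)) \<longlonglongrightarrow> exp (t *\<^sub>R C z)"
    by (intro tendsto_intros \<open>r \<longlonglongrightarrow> t\<close>)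
  ultimately show ?thesis
    using LIMSEQ_unique by auto
qed

end

section \<open>Step functions and their closure\<close>

text \<open>Abel summation. It is stated for an arbitrary real vector space because it is applied
  both to indicator functions and to values of \<open>Y\<close>.\<close>

lemma sum_by_parts_increments:
  fixes y :: "nat \<Rightarrow> 'b::real_vector"
  shows "(\<Sum>i\<le>n. b i *\<^sub>R y i) = (\<Sum>i\<le>n. (\<Sum>k=i..n. b k) *\<^sub>R (if i = 0 then y 0 else y i - y (i - 1)))"
    (is "_ = (\<Sum>i\<le>n. _ *\<^sub>R ?d i)")
proof (induction n)
  case (Suc n)
  have tele: "(\<Sum>i\<le>m. ?d i) = y m" for m
    by (induction m) simp_all
  have "(\<Sum>i\<le>Suc n. (\<Sum>k=i..Suc n. b k) *\<^sub>R ?d i) = (\<Sum>i\<le>Suc n. (\<Sum>k=i..n. b k) *\<^sub>R ?d i + b (Suc n) *\<^sub>R ?d i)"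
    by (intro sum.cong refl) (simp add: scaleR_add_left)
  also have "\<dots> = (\<Sum>i\<le>n. (\<Sum>k=i..n. b k) *\<^sub>R ?d i) + b (Suc n) *\<^sub>R (\<Sum>i\<le>Suc n. ?d i)"
    by (simp add: sum.distrib scaleR_sum_right scaleR_add_right)
  finally show ?case
    unfolding tele using Suc.IH by simp
qed simp

text \<open>The mean value inequality on a convex half-plane, where the derivative of
  \<open>exp\<close> has modulus at most 1.\<close>

lemma norm_exp_diff_le:
  fixes w w' :: complex
  assumes "Re w \<le> 0" "Re w' \<le> 0"
  shows "cmod (exp w - exp w') \<le> cmod (w - w')"
proof -
  have "cmod (exp w - exp w') \<le> 1 * cmod (w - w')"
  proof (rule field_differentiable_bound[where S = "{z. Re z \<le> 0}"])
    show "convex {z. Re z \<le> 0}" by (rule convex_halfspace_Re_le)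
    show "(exp has_field_derivative exp z) (at z within {z. Re z \<le> 0})" for z :: complex
      by (rule DERIV_subset[OF DERIV_exp]) simp
  qed (use assms in auto)
  then show ?thesis by simp
qed

context compound_Poisson_process
begin

section \<open>Elementary integrals\<close>

text \<open>Step functions are spanned by intervals starting at 0 instead of cells of a partition:
  the integral is then a combination of values of \<open>Y\<close>, and sums merely unite node sets
  without ordering or refinement.\<close>

definition step_fun :: "real set \<Rightarrow> (real \<Rightarrow> real) \<Rightarrow> real \<Rightarrow> real" where
  "step_fun S a s = (\<Sum>t\<in>S. a t * indicator {0<..t} s)"

definition step_int :: "real set \<Rightarrow> (real \<Rightarrow> real) \<Rightarrow> 'w \<Rightarrow> 'a" where
  "step_int S a \<omega> = (\<Sum>t\<in>S. a t *\<^sub>R Y t \<omega>)"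

lemma step_fun_measurable [measurable]: "step_fun S a \<in> borel_measurable borel"
  unfolding step_fun_def by measurable

lemma step_int_measurable [measurable]: "S \<subseteq> {0..} \<Longrightarrow> step_int S a \<in> borel_measurable Q"
  unfolding step_int_def by (intro borel_measurable_sum borel_measurable_scaleR) auto

lemma \<rho>_sum_finite:
  assumes "finite S" "\<And>t. t \<in> S \<Longrightarrow> g t \<in> borel_measurable borel" "\<And>t. t \<in> S \<Longrightarrow> \<rho> (g t) < \<infinity>"
  shows "\<rho> (\<lambda>s. \<Sum>t\<in>S. g t s) < \<infinity>"
  using assms
proof (induction S rule: finite_induct)
  case (insert t S)
  then have "\<rho> (\<lambda>s. g t s + (\<Sum>t\<in>S. g t s)) \<le> \<rho> (g t) + \<rho> (\<lambda>s. \<Sum>t\<in>S. g t s)"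
    by (intro \<rho>_add borel_measurable_sum) auto
  also have "\<dots> < \<infinity>" using insert by (simp add: less_top)
  finally show ?case using insert by simp
qed simp

lemma \<rho>_step_fun: "finite S \<Longrightarrow> \<rho> (step_fun S a) < \<infinity>"
  unfolding step_fun_def
proof (rule \<rho>_sum_finite)
  show "\<rho> (\<lambda>s. a t * indicator {0<..t} s) < \<infinity>" for t
    by (cases "0 \<le> t") (auto simp: \<rho>_indicator ennreal_mult_less_top)
qed auto

text \<open>Summation by parts rewrites function and integral with the same coefficients
  \<open>A i\<close>, the first over disjoint cells and the second over independent increments. Both
  sides then factor over the cells.\<close>

lemma \<phi>_grid:
  fixes t b :: "nat \<Rightarrow> real"
  assumes t0: "t 0 = 0" and t: "\<And>i. i < n \<Longrightarrow> t i < t (Suc i)"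
  shows "\<phi> (\<lambda>\<omega>. \<Sum>i\<le>n. b i *\<^sub>R Y (t i) \<omega>) z = exp (CLBINT s. C ((\<Sum>i\<le>n. b i * indicator {0<..t i} s) *\<^sub>R z))"
proof -
  define A where "A i = (\<Sum>k=i..n. b k)" for i
  \<comment> \<open>\<open>d i\<close> is the indicator of the cell that ends at node
    \<open>i\<close>. Cell 0 is empty since \<open>t 0 = 0\<close>, in accordance with
    \<open>Y 0 = 0\<close> almost surely.\<close>
  define d :: "nat \<Rightarrow> real \<Rightarrow> real" where "d i = (if i = 0 then (\<lambda>_. 0) else indicator {t (i - 1)<..t i})" for i
  have mono: "t i < t j" if "i < j" "j \<le> n" for i j
    using that by (induction j rule: less_Suc_induct) (auto intro: t less_trans)
  have mono': "t i \<le> t j" if "i \<le> j" "j \<le> n" for i j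
    using mono[of i j] that by (cases "i = j") auto
  have tnn: "0 \<le> t i" if "i \<le> n" for i using mono'[of 0 i] that t0 by simp
  have d: "(if i = 0 then indicator {0<..t 0} s else indicator {0<..t i} s - indicator {0<..t (i - 1)} s) = d i s"
    if "i \<le> n" for i s
    using that tnn[of i] tnn[of "i - 1"] mono'[of "i - 1" i] by (cases i) (auto simp: d_def t0 split: split_indicator)
  have h: "(\<Sum>i\<le>n. b i * indicator {0<..t i} s) = (\<Sum>i\<le>n. A i * d i s)" for s
  proof -
    have "(\<Sum>i\<le>n. b i * indicator {0<..t i} s) = (\<Sum>i\<le>n. A i *
        (if i = 0 then indicator {0<..t 0} s else indicator {0<..t i} s - indicator {0<..t (i - 1)} s))"
      using sum_by_parts_increments[of b "\<lambda>i. indicator {0<..t i} s :: real" n] by (simp only: A_def real_scaleR_def)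
    also have "\<dots> = (\<Sum>i\<le>n. A i * d i s)"
      by (intro sum.cong refl) (simp only: d atMost_iff)
    finally show ?thesis .
  qed
  have J: "(\<Sum>i\<le>n. b i *\<^sub>R Y (t i) \<omega>) = (\<Sum>i\<le>n. A i *\<^sub>R increment t i \<omega>)" for \<omega>
    using sum_by_parts_increments[of b "\<lambda>i. Y (t i) \<omega>" n] by (simp add: A_def increment_def)
  \<comment> \<open>The nonlinear \<open>C\<close> passes through the sum because at most one cell
    contains \<open>s\<close> and \<open>C 0 = 0\<close>.\<close>
  have Ch: "C ((\<Sum>i\<le>n. A i * d i s) *\<^sub>R z) = (\<Sum>i\<le>n. d i s *\<^sub>R C (A i *\<^sub>R z))" for s
  proof (cases "\<exists>j\<le>n. d j s \<noteq> 0")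
    case True
    then obtain j where j: "j \<le> n" "d j s \<noteq> 0" by blast
    then have "j \<noteq> 0" and js: "t (j - 1) < s" "s \<le> t j" by (auto simp: d_def split: if_splits split_indicator_asm)
    have dj: "d i s = (if i = j then 1 else 0)" if "i \<le> n" for i
    proof (cases i j rule: linorder_cases)
      case less
      then have "t i \<le> t (j - 1)" using j(1) by (intro mono') auto
      then show ?thesis using less js by (auto simp: d_def)
    next
      case greater
      then have "t j \<le> t (i - 1)" using that by (intro mono') auto
      then show ?thesis using greater js by (auto simp: d_def)
    next
      case equal
      then show ?thesis using js \<open>j \<noteq> 0\<close> by (auto simp: d_def)
    qed
    have "(\<Sum>i\<le>n. A i * d i s) = (\<Sum>i\<le>n. if i = j then A i else 0)"
      by (intro sum.cong) (auto simp: dj)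
    moreover have "(\<Sum>i\<le>n. d i s *\<^sub>R C (A i *\<^sub>R z)) = (\<Sum>i\<le>n. if i = j then C (A i *\<^sub>R z) else 0)"
      by (intro sum.cong) (auto simp: dj)
    ultimately show ?thesis using j(1) by simp
  next
    case False
    then have "\<And>i. i \<le> n \<Longrightarrow> d i s = 0" by auto
    then have "(\<Sum>i\<le>n. A i * d i s) = 0" "(\<Sum>i\<le>n. d i s *\<^sub>R C (A i *\<^sub>R z)) = 0"
      by (auto intro!: sum.neutral)
    then show ?thesis by simp
  qed
  have int_d: "integrable lborel (d i)" "(LBINT s. d i s) = (if i = 0 then 0 else t i - t (i - 1))" if "i \<le> n" for i
    using mono'[of "i - 1" i] that by (auto simp: d_def)
  have "(CLBINT s. C ((\<Sum>i\<le>n. A i * d i s) *\<^sub>R z)) = (\<Sum>i\<le>n. (if i = 0 then 0 else t i - t (i - 1)) *\<^sub>R C (A i *\<^sub>R z))"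
  proof -
    have "(CLBINT s. (\<Sum>i\<le>n. d i s *\<^sub>R C (A i *\<^sub>R z))) = (\<Sum>i\<le>n. CLBINT s. d i s *\<^sub>R C (A i *\<^sub>R z))"
      using int_d(1) by (intro Bochner_Integration.integral_sum) auto
    also have "\<dots> = (\<Sum>i\<le>n. (if i = 0 then 0 else t i - t (i - 1)) *\<^sub>R C (A i *\<^sub>R z))"
      using int_d by (intro sum.cong refl) simp
    finally show ?thesis by (simp only: Ch)
  qed
  then have "exp (CLBINT s. C ((\<Sum>i\<le>n. A i * d i s) *\<^sub>R z)) = (\<Prod>i\<le>n. exp ((if i = 0 then 0 else t i - t (i - 1)) *\<^sub>R C (A i *\<^sub>R z)))"
    by (simp add: exp_sum)
  also have "\<dots> = (\<Prod>i\<le>n. \<phi> (increment t i) (A i *\<^sub>R z))"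
  proof (intro prod.cong refl)
    fix i assume "i \<in> {..n}"
    then show "exp ((if i = 0 then 0 else t i - t (i - 1)) *\<^sub>R C (A i *\<^sub>R z)) = \<phi> (increment t i) (A i *\<^sub>R z)"
      using \<phi>_increment[of "t (i - 1)" "t i" "A i *\<^sub>R z"] \<phi>_Y[of "t i - t (i - 1)" "A i *\<^sub>R z"] \<phi>_Y_0[of "A i *\<^sub>R z"]
        mono'[of "i - 1" i] tnn[of "i - 1"] t0
      by (cases "i = 0") (simp_all add: increment_def[abs_def])
  qed
  also have "\<dots> = \<phi> (\<lambda>\<omega>. \<Sum>i\<le>n. A i *\<^sub>R increment t i \<omega>) z"
    by (rule \<phi>_sum_increments[symmetric]) (use t t0 in auto)
  finally show ?thesis by (simp only: h J)
qed

text \<open>Sorting the nodes gives a grid; 0 is inserted, with weight 0 if it is a new node,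
  because \<open>\<phi>_grid\<close> starts there.\<close>

lemma \<phi>_step_int:
  assumes "finite S" "S \<subseteq> {0..}"
  shows "\<phi> (step_int S a) z = exp (CLBINT s. C (step_fun S a s *\<^sub>R z))"
proof -
  define S' where "S' = insert 0 S"
  define b where "b t = (if t \<in> S then a t else 0)" for t
  have S': "finite S'" "S' \<subseteq> {0..}" "S \<subseteq> S'" "S' \<noteq> {}" "0 \<in> S'" using assms by (auto simp: S'_def)
  define xs where "xs = sorted_list_of_set S'"
  have xs: "set xs = S'" "distinct xs" "sorted_wrt (<) xs" using S' by (auto simp: xs_def)
  define n where "n = length xs - 1"
  have len: "length xs = Suc n" using xs(1) S' by (cases xs) (auto simp: n_def)
  define t where "t i = xs ! i" for i
  have "bij_betw t {..n} S'"
    unfolding t_def using bij_betw_nth[OF xs(2), of "{..n}" S'] xs(1) len by (auto simp: lessThan_Suc_atMost)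
  note bij = this
  have strict: "t i < t (Suc i)" if "i < n" for i
    unfolding t_def using sorted_wrt_nth_less[OF xs(3)] that len by simp
  have t0: "t 0 = 0"
  proof -
    obtain k where k: "k \<le> n" "t k = 0" using bij S'(5) by (metis atMost_iff bij_betw_def imageE)
    have "t 0 \<in> S'" using bij by (auto simp: bij_betw_def)
    then have "0 \<le> t 0" using S'(2) by auto
    moreover have "t 0 < t k" if "k \<noteq> 0"
      unfolding t_def using sorted_wrt_nth_less[OF xs(3), of 0 k] that k len by simp
    ultimately show ?thesis using k by (cases "k = 0") auto
  qed
  have f: "step_fun S a s = (\<Sum>i\<le>n. b (t i) * indicator {0<..t i} s)" for s
  proof -
    have "step_fun S a s = (\<Sum>r\<in>S'. b r * indicator {0<..r} s)"
      unfolding step_fun_def using S' by (intro sum.mono_neutral_cong_left) (auto simp: b_def)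
    also have "\<dots> = (\<Sum>i\<le>n. b (t i) * indicator {0<..t i} s)"
      by (rule sum.reindex_bij_betw[OF bij, symmetric])
    finally show ?thesis .
  qed
  have i: "step_int S a \<omega> = (\<Sum>i\<le>n. b (t i) *\<^sub>R Y (t i) \<omega>)" for \<omega>
  proof -
    have "step_int S a \<omega> = (\<Sum>r\<in>S'. b r *\<^sub>R Y r \<omega>)"
      unfolding step_int_def using S' by (intro sum.mono_neutral_cong_left) (auto simp: b_def)
    also have "\<dots> = (\<Sum>i\<le>n. b (t i) *\<^sub>R Y (t i) \<omega>)"
      by (rule sum.reindex_bij_betw[OF bij, symmetric])
    finally show ?thesis .
  qed
  show ?thesis
    unfolding f i by (rule \<phi>_grid[OF t0 strict])
qed

text \<open>The graph of the Wiener type integral: the closure of the graph of the elementary integral.\<close>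

definition wiener :: "(real \<Rightarrow> real) \<Rightarrow> ('w \<Rightarrow> 'a) \<Rightarrow> bool" where
  "wiener h J \<longleftrightarrow> h \<in> borel_measurable borel \<and> J \<in> borel_measurable Q \<and>
    (\<forall>\<epsilon>>0. \<exists>S a. finite S \<and> S \<subseteq> {0..} \<and> \<rho> (\<lambda>s. h s - step_fun S a s) < ennreal \<epsilon> \<and>
      prob {\<omega> \<in> space Q. \<epsilon> < norm (J \<omega> - step_int S a \<omega>)} < \<epsilon>)"

lemma wiener_measurable: "wiener h J \<Longrightarrow> h \<in> borel_measurable borel" "wiener h J \<Longrightarrow> J \<in> borel_measurable Q"
  by (auto simp: wiener_def)

lemma wienerE:
  assumes "wiener h J" "\<epsilon> > 0"
  obtains S a where "finite S" "S \<subseteq> {0..}" "\<rho> (\<lambda>s. h s - step_fun S a s) < ennreal \<epsilon>"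
    "prob {\<omega> \<in> space Q. \<epsilon> < norm (J \<omega> - step_int S a \<omega>)} < \<epsilon>"
  using assms unfolding wiener_def by blast

lemma wiener_step: "finite S \<Longrightarrow> S \<subseteq> {0..} \<Longrightarrow> wiener (step_fun S a) (step_int S a)"
  unfolding wiener_def by (auto intro!: exI[of _ S] exI[of _ a] simp: not_less)

lemma prob_gt_mono:
  fixes J :: "'w \<Rightarrow> 'a"
  assumes [measurable]: "J \<in> borel_measurable Q" and "\<epsilon> \<le> \<epsilon>'"
  shows "prob {\<omega> \<in> space Q. \<epsilon>' < norm (J \<omega>)} \<le> prob {\<omega> \<in> space Q. \<epsilon> < norm (J \<omega>)}"
  by (rule finite_measure_mono) (use assms(2) in auto)

text \<open>Weights outside the own node set are arbitrary, so they are cut to 0 before the node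
  sets are merged.\<close>

lemma step_fun_combine:
  assumes "finite S" "finite S'"
  shows "x * step_fun S a s + y * step_fun S' a' s =
      step_fun (S \<union> S') (\<lambda>t. x * (if t \<in> S then a t else 0) + y * (if t \<in> S' then a' t else 0)) s"
    and "x *\<^sub>R step_int S a \<omega> + y *\<^sub>R step_int S' a' \<omega> =
      step_int (S \<union> S') (\<lambda>t. x * (if t \<in> S then a t else 0) + y * (if t \<in> S' then a' t else 0)) \<omega>"
proof -
  have S: "step_fun S a s = (\<Sum>t\<in>S \<union> S'. (if t \<in> S then a t else 0) * indicator {0<..t} s)"
      "step_int S a \<omega> = (\<Sum>t\<in>S \<union> S'. (if t \<in> S then a t else 0) *\<^sub>R Y t \<omega>)"
    unfolding step_fun_def step_int_def using assms by (intro sum.mono_neutral_cong_left; auto)+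
  have S': "step_fun S' a' s = (\<Sum>t\<in>S \<union> S'. (if t \<in> S' then a' t else 0) * indicator {0<..t} s)"
      "step_int S' a' \<omega> = (\<Sum>t\<in>S \<union> S'. (if t \<in> S' then a' t else 0) *\<^sub>R Y t \<omega>)"
    unfolding step_fun_def step_int_def using assms by (intro sum.mono_neutral_cong_left; auto)+
  show "x * step_fun S a s + y * step_fun S' a' s =
      step_fun (S \<union> S') (\<lambda>t. x * (if t \<in> S then a t else 0) + y * (if t \<in> S' then a' t else 0)) s"
    unfolding S S' by (simp add: step_fun_def sum_distrib_left distrib_right mult.assoc flip: sum.distrib)
  show "x *\<^sub>R step_int S a \<omega> + y *\<^sub>R step_int S' a' \<omega> =
      step_int (S \<union> S') (\<lambda>t. x * (if t \<in> S then a t else 0) + y * (if t \<in> S' then a' t else 0)) \<omega>"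
    unfolding S S' by (simp add: step_int_def scaleR_sum_right scaleR_add_left flip: sum.distrib)
qed

lemma wiener_add:
  assumes w: "wiener h J" "wiener h' J'"
  shows "wiener (\<lambda>s. h s + h' s) (\<lambda>\<omega>. J \<omega> + J' \<omega>)"
proof -
  note [measurable] = w[THEN wiener_measurable(1)] w[THEN wiener_measurable(2)]
  show ?thesis
    unfolding wiener_def
  proof (intro conjI allI impI)
    fix \<epsilon> :: real assume "\<epsilon> > 0"
    then have e2: "\<epsilon> / 2 > 0" by simp
    from wienerE[OF w(1) e2] obtain S a where S: "finite S" "S \<subseteq> {0..}" "\<rho> (\<lambda>s. h s - step_fun S a s) < ennreal (\<epsilon> / 2)"
      "prob {\<omega> \<in> space Q. \<epsilon> / 2 < norm (J \<omega> - step_int S a \<omega>)} < \<epsilon> / 2" .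
    from wienerE[OF w(2) e2] obtain S' a' where S': "finite S'" "S' \<subseteq> {0..}" "\<rho> (\<lambda>s. h' s - step_fun S' a' s) < ennreal (\<epsilon> / 2)"
      "prob {\<omega> \<in> space Q. \<epsilon> / 2 < norm (J' \<omega> - step_int S' a' \<omega>)} < \<epsilon> / 2" .
    define b where "b t = (if t \<in> S then a t else 0) + (if t \<in> S' then a' t else 0)" for t
    have b: "step_fun (S \<union> S') b s = step_fun S a s + step_fun S' a' s"
        "step_int (S \<union> S') b \<omega> = step_int S a \<omega> + step_int S' a' \<omega>" for s \<omega>
      using step_fun_combine[OF S(1) S'(1), of 1 a _ 1 a'] by (simp_all add: b_def[abs_def])
    have [measurable]: "step_int S a \<in> borel_measurable Q" "step_int S' a' \<in> borel_measurable Q" using S S' by auto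
    have "\<rho> (\<lambda>s. h s + h' s - step_fun (S \<union> S') b s) = \<rho> (\<lambda>s. (h s - step_fun S a s) + (h' s - step_fun S' a' s))"
      by (simp add: b algebra_simps)
    also have "\<dots> \<le> \<rho> (\<lambda>s. h s - step_fun S a s) + \<rho> (\<lambda>s. h' s - step_fun S' a' s)"
      by (rule \<rho>_add) auto
    also have "\<dots> < ennreal (\<epsilon> / 2) + ennreal (\<epsilon> / 2)" using S S' by (intro add_strict_mono) auto
    also have "\<dots> = ennreal \<epsilon>" using e2 by (subst ennreal_plus[symmetric]) auto
    finally have r: "\<rho> (\<lambda>s. h s + h' s - step_fun (S \<union> S') b s) < ennreal \<epsilon>" .
    have "prob {\<omega> \<in> space Q. \<epsilon> < norm (J \<omega> + J' \<omega> - step_int (S \<union> S') b \<omega>)}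
      \<le> prob {\<omega> \<in> space Q. \<epsilon> / 2 < norm ((J \<omega> + J' \<omega>) - (step_int S a \<omega> + J' \<omega>))}
        + prob {\<omega> \<in> space Q. \<epsilon> / 2 < norm ((step_int S a \<omega> + J' \<omega>) - step_int (S \<union> S') b \<omega>)}"
      by (rule prob_diff_triangle) (auto simp: b)
    also have "\<dots> < \<epsilon>" using S S' by (simp add: b)
    finally show "\<exists>S a. finite S \<and> S \<subseteq> {0..} \<and> \<rho> (\<lambda>s. h s + h' s - step_fun S a s) < ennreal \<epsilon> \<and>
      prob {\<omega> \<in> space Q. \<epsilon> < norm (J \<omega> + J' \<omega> - step_int S a \<omega>)} < \<epsilon>"
      using r S S' by (intro exI[of _ "S \<union> S'"] exI[of _ b]) auto
  qed auto
qed

lemma wiener_scale: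
  assumes w: "wiener h J"
  shows "wiener (\<lambda>s. c * h s) (\<lambda>\<omega>. c *\<^sub>R J \<omega>)"
proof -
  note [measurable] = w[THEN wiener_measurable(1)] w[THEN wiener_measurable(2)]
  show ?thesis
    unfolding wiener_def
  proof (intro conjI allI impI)
    fix \<epsilon> :: real assume "\<epsilon> > 0"
    \<comment> \<open>The divisor is the factor of \<open>\<rho>_mult\<close>. It also exceeds
      \<open>\<bar>c\<bar>\<close>, as the probability bound wants, and is at least 1, so that
      \<open>e \<le> \<epsilon>\<close>.\<close>
    define e where "e = \<epsilon> / (1 + \<bar>c\<bar>)"
    have pos: "1 + \<bar>c\<bar> > 0" by simp
    have e: "e > 0" "(1 + \<bar>c\<bar>) * e = \<epsilon>" "e \<le> \<epsilon>"
      using \<open>\<epsilon> > 0\<close> pos by (auto simp: e_def field_simps)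
    from wienerE[OF w e(1)] obtain S a where S: "finite S" "S \<subseteq> {0..}" "\<rho> (\<lambda>s. h s - step_fun S a s) < ennreal e"
      "prob {\<omega> \<in> space Q. e < norm (J \<omega> - step_int S a \<omega>)} < e" .
    define b where "b t = c * a t" for t
    have b: "step_fun S b s = c * step_fun S a s" "step_int S b \<omega> = c *\<^sub>R step_int S a \<omega>" for s \<omega>
      by (simp_all add: b_def step_fun_def step_int_def sum_distrib_left scaleR_sum_right mult.assoc)
    have [measurable]: "step_int S a \<in> borel_measurable Q" using S by auto
    have "\<rho> (\<lambda>s. c * h s - step_fun S b s) \<le> ennreal (1 + \<bar>c\<bar>) * \<rho> (\<lambda>s. h s - step_fun S a s)"
      using \<rho>_mult[of "\<lambda>s. h s - step_fun S a s" c] by (simp add: b right_diff_distrib)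
    also have "\<dots> < ennreal (1 + \<bar>c\<bar>) * ennreal e"
      using S(3) by (intro ennreal_mult_strict_left_mono) (auto simp del: ennreal_plus simp: ennreal_lessI)
    also have "\<dots> = ennreal \<epsilon>" using e pos by (subst ennreal_mult[symmetric]) auto
    finally have r: "\<rho> (\<lambda>s. c * h s - step_fun S b s) < ennreal \<epsilon>" .
    have "prob {\<omega> \<in> space Q. \<epsilon> < norm (c *\<^sub>R J \<omega> - step_int S b \<omega>)} \<le> prob {\<omega> \<in> space Q. e < norm (J \<omega> - step_int S a \<omega>)}"
    proof (intro finite_measure_mono subsetI)
      fix \<omega> assume "\<omega> \<in> {\<omega> \<in> space Q. \<epsilon> < norm (c *\<^sub>R J \<omega> - step_int S b \<omega>)}"
      then have \<omega>: "\<omega> \<in> space Q" "(1 + \<bar>c\<bar>) * e < \<bar>c\<bar> * norm (J \<omega> - step_int S a \<omega>)"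
        by (simp_all add: b e(2) flip: scaleR_diff_right)
      note \<omega>(2)
      also have "\<dots> \<le> (1 + \<bar>c\<bar>) * norm (J \<omega> - step_int S a \<omega>)"
        by (intro mult_right_mono) auto
      finally show "\<omega> \<in> {\<omega> \<in> space Q. e < norm (J \<omega> - step_int S a \<omega>)}"
        using \<omega>(1) pos by (simp add: mult_less_cancel_left)
    qed simp
    with S(4) e(3) have "prob {\<omega> \<in> space Q. \<epsilon> < norm (c *\<^sub>R J \<omega> - step_int S b \<omega>)} < \<epsilon>" by linarith
    with r S show "\<exists>S a. finite S \<and> S \<subseteq> {0..} \<and> \<rho> (\<lambda>s. c * h s - step_fun S a s) < ennreal \<epsilon> \<and>
      prob {\<omega> \<in> space Q. \<epsilon> < norm (c *\<^sub>R J \<omega> - step_int S a \<omega>)} < \<epsilon>"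
      by (intro exI[of _ S] exI[of _ b]) auto
  qed auto
qed

lemma wiener_diff:
  assumes "wiener h J" "wiener h' J'"
  shows "wiener (\<lambda>s. h s - h' s) (\<lambda>\<omega>. J \<omega> - J' \<omega>)"
  using wiener_add[OF assms(1) wiener_scale[OF assms(2), of "-1"]] by simp

lemma wiener_zero: "wiener (\<lambda>_. 0) (\<lambda>_. 0)"
  using wiener_step[of "{}"] by (simp add: step_fun_def[abs_def] step_int_def[abs_def])

lemma wiener_sum:
  assumes "finite I" "\<And>i. i \<in> I \<Longrightarrow> wiener (h i) (J i)"
  shows "wiener (\<lambda>s. \<Sum>i\<in>I. h i s) (\<lambda>\<omega>. \<Sum>i\<in>I. J i \<omega>)"
  using assms by (induction I rule: finite_induct) (auto intro: wiener_zero wiener_add)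

lemma wiener_cong_AE:
  assumes w: "wiener h J" and h': "h' \<in> borel_measurable borel" "AE s in lborel. h s = h' s"
  shows "wiener h' J"
proof -
  have "\<rho> (\<lambda>s. h' s - g s) = \<rho> (\<lambda>s. h s - g s)" for g
    by (rule \<rho>_cong_AE) (use h'(2) in auto)
  then show ?thesis using w h'(1) by (simp add: wiener_def)
qed

lemma wiener_\<rho>_finite:
  assumes w: "wiener h J"
  shows "\<rho> h < \<infinity>"
proof -
  note [measurable] = w[THEN wiener_measurable(1)]
  from wienerE[OF w zero_less_one] obtain S a where S: "finite S" "\<rho> (\<lambda>s. h s - step_fun S a s) < ennreal 1" by metis
  have "\<rho> h = \<rho> (\<lambda>s. (h s - step_fun S a s) + step_fun S a s)" by simp
  also have "\<dots> \<le> \<rho> (\<lambda>s. h s - step_fun S a s) + \<rho> (step_fun S a)" by (rule \<rho>_add) auto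
  also have "\<dots> < \<infinity>" using S \<rho>_step_fun[OF S(1), of a] by (auto simp: less_top[symmetric] top_unique)
  finally show ?thesis .
qed

lemma wiener_closed:
  assumes w: "\<And>n. wiener (h n) (J n)" and [measurable]: "g \<in> borel_measurable borel" "L \<in> borel_measurable Q"
    and h: "(\<lambda>n. \<rho> (\<lambda>s. h n s - g s)) \<longlonglongrightarrow> 0" and J: "tendsto_in_prob Q J L sequentially"
  shows "wiener g L"
  unfolding wiener_def
proof (intro conjI allI impI)
  note [measurable] = w[THEN wiener_measurable(1)] w[THEN wiener_measurable(2)]
  fix \<epsilon> :: real assume "\<epsilon> > 0"
  then have e2: "\<epsilon> / 2 > 0" by simp
  have "eventually (\<lambda>n. \<rho> (\<lambda>s. h n s - g s) < ennreal (\<epsilon> / 2)) sequentially"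
    using h e2 by (intro order_tendstoD(2)) auto
  moreover have "eventually (\<lambda>n. prob {\<omega> \<in> space Q. \<epsilon> / 2 < norm (J n \<omega> - L \<omega>)} < \<epsilon> / 2) sequentially"
    by (rule order_tendstoD(2)[OF J[unfolded tendsto_in_prob_def, rule_format, OF e2] e2])
  ultimately have "eventually (\<lambda>n. \<rho> (\<lambda>s. h n s - g s) < ennreal (\<epsilon> / 2) \<and>
      prob {\<omega> \<in> space Q. \<epsilon> / 2 < norm (J n \<omega> - L \<omega>)} < \<epsilon> / 2) sequentially"
    by (rule eventually_conj)
  then obtain n where n: "\<rho> (\<lambda>s. h n s - g s) < ennreal (\<epsilon> / 2)" "prob {\<omega> \<in> space Q. \<epsilon> / 2 < norm (J n \<omega> - L \<omega>)} < \<epsilon> / 2"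
    by (auto dest!: eventually_happens simp del: less_divide_eq_numeral1)
  from wienerE[OF w e2] obtain S a where S: "finite S" "S \<subseteq> {0..}" "\<rho> (\<lambda>s. h n s - step_fun S a s) < ennreal (\<epsilon> / 2)"
      "prob {\<omega> \<in> space Q. \<epsilon> / 2 < norm (J n \<omega> - step_int S a \<omega>)} < \<epsilon> / 2" .
  have [measurable]: "step_int S a \<in> borel_measurable Q" using S by auto
  have "\<rho> (\<lambda>s. g s - step_fun S a s) \<le> \<rho> (\<lambda>s. g s - h n s) + \<rho> (\<lambda>s. h n s - step_fun S a s)"
    by (rule \<rho>_diff_triangle) auto
  also have "\<dots> < ennreal (\<epsilon> / 2) + ennreal (\<epsilon> / 2)" using S n by (intro add_strict_mono) (auto simp: \<rho>_minus[of g])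
  also have "\<dots> = ennreal \<epsilon>" using e2 by (subst ennreal_plus[symmetric]) auto
  finally have r: "\<rho> (\<lambda>s. g s - step_fun S a s) < ennreal \<epsilon>" .
  have "prob {\<omega> \<in> space Q. \<epsilon> < norm (L \<omega> - step_int S a \<omega>)}
      \<le> prob {\<omega> \<in> space Q. \<epsilon> / 2 < norm (L \<omega> - J n \<omega>)} + prob {\<omega> \<in> space Q. \<epsilon> / 2 < norm (J n \<omega> - step_int S a \<omega>)}"
    by (rule prob_diff_triangle) auto
  also have "\<dots> < \<epsilon>" using S n by (simp add: norm_minus_commute)
  finally show "\<exists>S a. finite S \<and> S \<subseteq> {0..} \<and> \<rho> (\<lambda>s. g s - step_fun S a s) < ennreal \<epsilon> \<and>
      prob {\<omega> \<in> space Q. \<epsilon> < norm (L \<omega> - step_int S a \<omega>)} < \<epsilon>"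
    using r S by (intro exI[of _ S] exI[of _ a]) auto
qed auto

text \<open>Along approximating step functions the left side converges by
  \<open>tendsto_char\<close> and the right side by \<open>C_integral_diff\<close>.\<close>

lemma \<phi>_wiener:
  assumes w: "wiener h J"
  shows "\<phi> J z = exp (CLBINT s. C (h s *\<^sub>R z))"
proof -
  note [measurable] = w[THEN wiener_measurable(1)] w[THEN wiener_measurable(2)]
  let ?e = "\<lambda>n. 1 / real (Suc n)"
  have "\<forall>n. \<exists>S a. finite S \<and> S \<subseteq> {0..} \<and> \<rho> (\<lambda>s. h s - step_fun S a s) < ennreal (?e n) \<and>
      prob {\<omega> \<in> space Q. ?e n < norm (J \<omega> - step_int S a \<omega>)} < ?e n"
    by (rule allI, rule w[unfolded wiener_def, THEN conjunct2, THEN conjunct2, rule_format]) simp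
  from choice[OF this] obtain S where "\<forall>n. \<exists>a. finite (S n) \<and> S n \<subseteq> {0..} \<and> \<rho> (\<lambda>s. h s - step_fun (S n) a s) < ennreal (?e n) \<and>
      prob {\<omega> \<in> space Q. ?e n < norm (J \<omega> - step_int (S n) a \<omega>)} < ?e n" ..
  from choice[OF this] obtain a where S: "\<And>n. finite (S n)" "\<And>n. S n \<subseteq> {0..}"
      "\<And>n. \<rho> (\<lambda>s. h s - step_fun (S n) (a n) s) < ennreal (?e n)"
      "\<And>n. prob {\<omega> \<in> space Q. ?e n < norm (J \<omega> - step_int (S n) (a n) \<omega>)} < ?e n"
    by blast
  have [measurable]: "step_int (S n) (a n) \<in> borel_measurable Q" for n using S by auto
  have e0: "?e \<longlonglongrightarrow> 0" by (rule LIMSEQ_Suc[OF lim_1_over_n])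
  have "tendsto_in_prob Q (\<lambda>n. step_int (S n) (a n)) J sequentially"
    unfolding tendsto_in_prob_def
  proof (intro allI impI)
    fix \<epsilon> :: real assume "\<epsilon> > 0"
    show "(\<lambda>n. prob {\<omega> \<in> space Q. \<epsilon> < norm (step_int (S n) (a n) \<omega> - J \<omega>)}) \<longlonglongrightarrow> 0"
    proof (rule tendsto_sandwich[OF _ _ tendsto_const e0])
      show "eventually (\<lambda>n. prob {\<omega> \<in> space Q. \<epsilon> < norm (step_int (S n) (a n) \<omega> - J \<omega>)} \<le> ?e n) sequentially"
        using order_tendstoD(2)[OF e0 \<open>\<epsilon> > 0\<close>]
      proof eventually_elim
        case (elim n)
        have "prob {\<omega> \<in> space Q. \<epsilon> < norm (J \<omega> - step_int (S n) (a n) \<omega>)} \<le> prob {\<omega> \<in> space Q. ?e n < norm (J \<omega> - step_int (S n) (a n) \<omega>)}"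
          using elim by (intro prob_gt_mono) auto
        with S(4)[of n] show ?case by (simp add: norm_minus_commute)
      qed
    qed simp
  qed
  then have "(\<lambda>n. \<phi> (step_int (S n) (a n)) z) \<longlonglongrightarrow> \<phi> J z"
    by (intro tendsto_char) auto
  moreover have "(\<lambda>n. \<phi> (step_int (S n) (a n)) z) \<longlonglongrightarrow> exp (CLBINT s. C (h s *\<^sub>R z))"
  proof -
    have b: "cmod ((CLBINT s. C (step_fun (S n) (a n) s *\<^sub>R z)) - (CLBINT s. C (h s *\<^sub>R z))) \<le> (1 + norm z) * ?e n" for n
    proof -
      have "ennreal (cmod ((CLBINT s. C (h s *\<^sub>R z)) - (CLBINT s. C (step_fun (S n) (a n) s *\<^sub>R z))))
        \<le> ennreal (1 + norm z) * \<rho> (\<lambda>s. h s - step_fun (S n) (a n) s)"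
        by (rule C_integral_diff) (use wiener_\<rho>_finite[OF w] \<rho>_step_fun[OF S(1)] in auto)
      also have "\<dots> \<le> ennreal (1 + norm z) * ennreal (?e n)"
        using S(3)[of n] by (intro mult_left_mono) auto
      also have "\<dots> = ennreal ((1 + norm z) * ?e n)"
        by (rule ennreal_mult[symmetric]) auto
      finally show ?thesis
        by (subst (asm) ennreal_le_iff) (auto simp: norm_minus_commute)
    qed
    have "(\<lambda>n. (1 + norm z) * ?e n) \<longlonglongrightarrow> 0"
      using tendsto_mult_left[OF e0, of "1 + norm z"] by simp
    then have "(\<lambda>n. (CLBINT s. C (step_fun (S n) (a n) s *\<^sub>R z)) - (CLBINT s. C (h s *\<^sub>R z))) \<longlonglongrightarrow> 0"
      by (rule Lim_null_comparison[rotated]) (use b in auto)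
    then have "(\<lambda>n. exp (CLBINT s. C (step_fun (S n) (a n) s *\<^sub>R z))) \<longlonglongrightarrow> exp (CLBINT s. C (h s *\<^sub>R z))"
      by (intro tendsto_exp) (simp add: LIM_zero_iff)
    then show ?thesis
      using \<phi>_step_int[OF S(1) S(2)] by simp
  qed
  ultimately show ?thesis by (rule LIMSEQ_unique)
qed

section \<open>Tail estimate and completeness of the integral\<close>

definition tail_const :: "real \<Rightarrow> real" where
  "tail_const \<epsilon> = 2 * DIM('a) * (1 + 2 * DIM('a) / \<epsilon>)"

lemma tail_const_pos: "\<epsilon> > 0 \<Longrightarrow> tail_const \<epsilon> > 0"
  unfolding tail_const_def by (intro mult_pos_pos add_pos_nonneg) auto

text \<open>The exponent \<open>w\<close> has nonpositive real part, so \<open>exp w - 1\<close> has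
  modulus at most \<open>cmod w\<close>, which is at most \<open>(1 + norm z) * m\<close>;
  \<open>tail_bound_of_char\<close> does the rest. Applied to a difference, this is continuity of
  the integral, and with \<open>m = 0\<close> its almost sure uniqueness.\<close>

lemma wiener_tail:
  assumes w: "wiener h J" and "\<epsilon> > 0" "0 \<le> m" and m: "\<rho> h \<le> ennreal m"
  shows "prob {\<omega> \<in> space Q. \<epsilon> < norm (J \<omega>)} \<le> tail_const \<epsilon> * m"
  unfolding tail_const_def
proof (rule tail_bound_of_char)
  note [measurable] = w[THEN wiener_measurable(1)] w[THEN wiener_measurable(2)]
  fix z
  have fin: "\<rho> h < \<infinity>" by (rule wiener_\<rho>_finite[OF w])
  have "Re (CLBINT s. C (h s *\<^sub>R z)) = (LBINT s. Re (C (h s *\<^sub>R z)))"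
    by (rule integral_Re[OF C_integrable[OF _ fin], symmetric]) simp
  also have "\<dots> \<le> (LBINT (s::real). 0 :: real)"
    using C_integrable[of h z] fin by (intro integral_mono) (auto intro!: integrable_Re Re_C_nonpos)
  finally have "Re (CLBINT s. C (h s *\<^sub>R z)) \<le> 0" by simp
  then have "cmod (\<phi> J z - 1) \<le> cmod (CLBINT s. C (h s *\<^sub>R z))"
    using norm_exp_diff_le[of "CLBINT s. C (h s *\<^sub>R z)" 0] by (simp add: \<phi>_wiener[OF w])
  also have "ennreal (cmod (CLBINT s. C (h s *\<^sub>R z))) \<le> ennreal (1 + norm z) * \<rho> h"
    using C_integral_diff[of h "\<lambda>_. 0" z] fin by simp
  then have "ennreal (cmod (CLBINT s. C (h s *\<^sub>R z))) \<le> ennreal (1 + norm z) * ennreal m"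
    by (rule order_trans) (use m in \<open>auto intro!: mult_left_mono simp del: ennreal_plus\<close>)
  then have "cmod (CLBINT s. C (h s *\<^sub>R z)) \<le> (1 + norm z) * m"
    using \<open>0 \<le> m\<close> by (simp add: ennreal_le_iff del: ennreal_plus flip: ennreal_mult)
  finally show "cmod (\<phi> J z - 1) \<le> (1 + norm z) * m" .
qed (use assms wiener_measurable in auto)

text \<open>The filter is general because the same fact serves partial sums of the random measure
  and the limit in a real time horizon.\<close>

lemma wiener_tendsto:
  assumes w: "eventually (\<lambda>i. wiener (h i) (J i)) F" "wiener g L"
    and h: "((\<lambda>i. \<rho> (\<lambda>s. h i s - g s)) \<longlongrightarrow> 0) F"
  shows "tendsto_in_prob Q J L F"
  unfolding tendsto_in_prob_def
proof (intro allI impI tendstoI)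
  fix \<epsilon> e :: real assume "\<epsilon> > 0" "e > 0"
  define m where "m = e / (2 * tail_const \<epsilon>)"
  have m: "m > 0" "tail_const \<epsilon> * m < e"
    using tail_const_pos[OF \<open>\<epsilon> > 0\<close>] \<open>e > 0\<close> by (simp_all add: m_def)
  have "eventually (\<lambda>i. \<rho> (\<lambda>s. h i s - g s) < ennreal m) F"
    using h m by (intro order_tendstoD(2)) auto
  with w(1) show "eventually (\<lambda>i. dist (prob {\<omega> \<in> space Q. \<epsilon> < norm (J i \<omega> - L \<omega>)}) 0 < e) F"
  proof eventually_elim
    case (elim i)
    have "prob {\<omega> \<in> space Q. \<epsilon> < norm (J i \<omega> - L \<omega>)} \<le> tail_const \<epsilon> * m"
      by (rule wiener_tail[OF wiener_diff[OF elim(1) w(2)]]) (use elim m \<open>\<epsilon> > 0\<close> in auto)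
    with m show ?case by simp
  qed
qed

text \<open>Unlike \<open>wiener_tendsto\<close>, no integral of the limit \<open>g\<close> is
  presupposed: \<rho>-convergence makes the integrals Cauchy in probability, and the closed graph
  contains their limit.\<close>

lemma wiener_complete:
  assumes w: "\<And>n::nat. wiener (h n) (J n)" and [measurable]: "g \<in> borel_measurable borel"
    and h: "(\<lambda>n. \<rho> (\<lambda>s. h n s - g s)) \<longlonglongrightarrow> 0"
  obtains L where "wiener g L" "tendsto_in_prob Q J L sequentially"
proof -
  note [measurable] = w[THEN wiener_measurable(1)] w[THEN wiener_measurable(2)]
  have "\<exists>N. \<forall>m\<ge>N. \<forall>n\<ge>N. prob {\<omega> \<in> space Q. \<epsilon> < norm (J m \<omega> - J n \<omega>)} < \<epsilon>" if "\<epsilon> > 0" for \<epsilon>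
  proof -
    \<comment> \<open>Two integrands within \<open>d\<close> of \<open>g\<close> are within
      \<open>2 * d\<close> of each other, and \<open>tail_const \<epsilon> * (2 * d)\<close> is
      \<open>\<epsilon> / 2\<close>.\<close>
    define d where "d = \<epsilon> / (4 * tail_const \<epsilon>)"
    have d: "d > 0" "tail_const \<epsilon> * (d + d) < \<epsilon>"
      using tail_const_pos[OF that] that by (simp_all add: d_def)
    have "eventually (\<lambda>n. \<rho> (\<lambda>s. h n s - g s) < ennreal d) sequentially"
      using h d by (intro order_tendstoD(2)) auto
    then obtain N where N: "\<And>n. n \<ge> N \<Longrightarrow> \<rho> (\<lambda>s. h n s - g s) < ennreal d"
      by (auto simp: eventually_sequentially)
    have "prob {\<omega> \<in> space Q. \<epsilon> < norm (J m \<omega> - J n \<omega>)} < \<epsilon>" if mn: "m \<ge> N" "n \<ge> N" for m n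
    proof -
      have "\<rho> (\<lambda>s. h m s - h n s) \<le> \<rho> (\<lambda>s. h m s - g s) + \<rho> (\<lambda>s. g s - h n s)"
        by (rule \<rho>_diff_triangle) auto
      also have "\<dots> \<le> ennreal d + ennreal d"
        using N[OF mn(1)] N[OF mn(2)] by (intro add_mono) (auto simp: \<rho>_minus[of g])
      also have "\<dots> = ennreal (d + d)" using d by (subst ennreal_plus) auto
      finally have "prob {\<omega> \<in> space Q. \<epsilon> < norm (J m \<omega> - J n \<omega>)} \<le> tail_const \<epsilon> * (d + d)"
        using d \<open>\<epsilon> > 0\<close> by (intro wiener_tail[OF wiener_diff[OF w w]]) auto
      with d show ?thesis by simp
    qed
    then show ?thesis by blast
  qed
  then obtain L where L: "L \<in> borel_measurable Q" "tendsto_in_prob Q J L sequentially"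
    by (rule Cauchy_in_prob_convergent[rotated]) auto
  with wiener_closed[OF w _ L(1) h L(2)] that show thesis by simp
qed

end

section \<open>The induced random measure and stochastic integrals\<close>

context compound_Poisson_process
begin

lemma \<rho>_indicator_finite: "B \<in> sets borel \<Longrightarrow> emeasure lborel B < \<infinity> \<Longrightarrow> \<rho> (\<lambda>s. a * indicator B s) < \<infinity>"
  by (simp add: \<rho>_indicator ennreal_mult_less_top)

text \<open>By disjointness the partial sums lie between 0 and the indicator of the union, which
  therefore dominates the error and has finite \<rho>.\<close>

lemma \<rho>_disjoint_indicators_tendsto:
  fixes A :: "nat \<Rightarrow> real set"
  assumes [measurable]: "\<And>i. A i \<in> sets borel" and disj: "disjoint_family A"
    and fin: "emeasure lborel (\<Union>i. A i) < \<infinity>"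
  shows "(\<lambda>n. \<rho> (\<lambda>s. (\<Sum>i<n. indicator (A i) s) - indicator (\<Union>i. A i) s)) \<longlonglongrightarrow> 0"
proof (rule \<rho>_dominated_convergence[where w = "indicator (\<Union>i. A i)"])
  have sums: "(\<lambda>i. indicator (A i) s :: real) sums indicator (\<Union>i. A i) s" for s
    by (rule indicator_sums) (use disj in \<open>auto simp: disjoint_family_on_def\<close>)
  show "AE s in lborel. (\<lambda>n. \<Sum>i<n. indicator (A i) s :: real) \<longlonglongrightarrow> indicator (\<Union>i. A i) s"
    using sums by (simp add: sums_def)
  show "\<rho> (indicator (\<Union>i. A i)) < \<infinity>"
    using \<rho>_indicator_finite[of "\<Union>i. A i" 1] fin by simp
  show "AE s in lborel. \<bar>(\<Sum>i<n. indicator (A i) s) - indicator (\<Union>i. A i) s\<bar> \<le> \<bar>indicator (\<Union>i. A i) s :: real\<bar>" for n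
  proof (rule AE_I2)
    fix s
    have "(\<Sum>i<n. indicator (A i) s :: real) \<le> indicator (\<Union>i. A i) s"
      using sum_le_suminf[OF sums_summable[OF sums[of s]], of "{..<n}"] sums_unique[OF sums[of s]] by simp
    moreover have "0 \<le> (\<Sum>i<n. indicator (A i) s :: real)" by (intro sum_nonneg) simp
    ultimately show "\<bar>(\<Sum>i<n. indicator (A i) s) - indicator (\<Union>i. A i) s\<bar> \<le> \<bar>indicator (\<Union>i. A i) s :: real\<bar>" by simp
  qed
qed auto

text \<open>The elementary integral uses \<open>{0<..t}\<close>, the random measure
  \<open>{0..t}\<close>; they differ by a Lebesgue null set, invisible to \<rho>.\<close>

lemma wiener_Icc:
  assumes "0 \<le> t"
  shows "wiener (indicator {0..t}) (Y t)"
proof -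
  have "wiener (step_fun {t} (\<lambda>_. 1)) (step_int {t} (\<lambda>_. 1))"
    using assms by (intro wiener_step) auto
  then have w: "wiener (indicator {0<..t}) (Y t)"
  proof -
    have "step_fun {t} (\<lambda>_. 1) = indicator {0<..t}"
      unfolding step_fun_def[abs_def] by (intro ext) (subst sum.insert; simp)
    moreover have "step_int {t} (\<lambda>_. 1) = Y t"
      by (simp add: step_int_def[abs_def])
    ultimately show "wiener (step_fun {t} (\<lambda>_. 1)) (step_int {t} (\<lambda>_. 1)) \<Longrightarrow> ?thesis" by simp
  qed
  have "AE s in lborel. indicator {0<..t} s = (indicator {0..t} s :: real)"
    using AE_lborel_singleton[of "0::real"] by eventually_elim (auto split: split_indicator)
  then show ?thesis by (rule wiener_cong_AE[OF w, rotated]) simp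
qed

text \<open>A \<pi>-\<lambda> argument over half-lines. Cutting everything to \<open>{0..T}\<close>
  keeps complements and countable unions of finite Lebesgue measure.\<close>

lemma wiener_indicator_Int:
  assumes "B \<in> sets borel" and T: "0 \<le> T"
  shows "\<exists>J. wiener (indicator (B \<inter> {0..T})) J"
proof -
  have "Int_stable (range (atMost :: real \<Rightarrow> real set))"
    by (auto simp: Int_stable_def)
  moreover have "range (atMost :: real \<Rightarrow> real set) \<subseteq> Pow UNIV" by simp
  moreover have "B \<in> sigma_sets UNIV (range atMost)"
    using assms(1) by (subst (asm) borel_eq_atMost) simp
  ultimately show ?thesis
  proof (induction B rule: sigma_sets_induct_disjoint[consumes 3, case_names basic empty compl union])
    case (basic B)
    then obtain u where B: "B = {..u}" by auto
    show ?case
    proof (cases "u < 0")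
      case True
      then have "B \<inter> {0..T} = {}" by (auto simp: B)
      then show ?thesis using wiener_zero by auto
    next
      case False
      then have "B \<inter> {0..T} = {0..min u T}" by (auto simp: B)
      then show ?thesis using wiener_Icc[of "min u T"] False T by auto
    qed
  next
    case empty
    show ?case using wiener_zero by auto
  next
    case (compl B)
    then obtain J where J: "wiener (indicator (B \<inter> {0..T})) J" by blast
    have "(\<lambda>s. indicator {0..T} s - indicator (B \<inter> {0..T}) s :: real) = indicator ((UNIV - B) \<inter> {0..T})"
      by (auto split: split_indicator)
    with wiener_diff[OF wiener_Icc[OF T] J] show ?case by auto
  next
    case (union A)
    then obtain J where J: "\<And>i. wiener (indicator (A i \<inter> {0..T})) (J i)" by metis
    have [measurable]: "A i \<in> sets borel" for i
      using union(2) by (auto simp: borel_eq_atMost)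
    have UN: "(\<Union>i. A i \<inter> {0..T}) = (\<Union>i. A i) \<inter> {0..T}" by auto
    have "emeasure lborel (\<Union>i. A i \<inter> {0..T}) \<le> emeasure lborel {0..T}"
      by (intro emeasure_mono) auto
    also have "\<dots> < \<infinity>" using T by simp
    finally have lim: "(\<lambda>n. \<rho> (\<lambda>s. (\<Sum>i<n. indicator (A i \<inter> {0..T}) s) - indicator (\<Union>i. A i \<inter> {0..T}) s)) \<longlonglongrightarrow> 0"
      using union(1) by (intro \<rho>_disjoint_indicators_tendsto) (auto simp: disjoint_family_on_def)
    have w: "wiener (\<lambda>s. \<Sum>i<n. indicator (A i \<inter> {0..T}) s) (\<lambda>\<omega>. \<Sum>i<n. J i \<omega>)" for n
      using J by (intro wiener_sum) auto
    obtain L where "wiener (indicator (\<Union>i. A i \<inter> {0..T})) L"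
      by (rule wiener_complete[OF w _ lim]) auto
    then show ?case unfolding UN by blast
  qed
qed

section \<open>The induced random measure\<close>

text \<open>For each set separately a version is chosen, determined up to a null event. This
  suffices because \<open>random_measure\<close> asks for agreement with \<open>Y\<close> almost
  surely and for additivity in probability.\<close>

definition \<Lambda> :: "real set \<Rightarrow> 'w \<Rightarrow> 'a" where
  "\<Lambda> B = (SOME J. wiener (indicator B) J)"

lemma bounded_borelE:
  assumes "B \<in> bounded_borel"
  obtains T where "0 \<le> T" "B \<in> sets borel" "B \<subseteq> {0..T}"
proof -
  from assms obtain r where "\<forall>x\<in>B. \<bar>x\<bar> \<le> r"
    by (auto simp: bounded_borel_def bounded_iff)
  then have "B \<subseteq> {0..max 0 r}" using assms by (force simp: bounded_borel_def)
  with that[of "max 0 r"] assms show thesis by (auto simp: bounded_borel_def)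
qed

lemma wiener_\<Lambda>:
  assumes "B \<in> bounded_borel"
  shows "wiener (indicator B) (\<Lambda> B)"
proof -
  obtain T where "0 \<le> T" "B \<in> sets borel" "B \<subseteq> {0..T}"
    using assms by (rule bounded_borelE)
  then have "\<exists>J. wiener (indicator B) J"
    using wiener_indicator_Int[of B T] by (simp add: inf.absorb1)
  then show ?thesis unfolding \<Lambda>_def by (rule someI_ex)
qed

lemma random_measure_\<Lambda>: "random_measure Q Y \<Lambda>"
  unfolding random_measure_def
proof (intro conjI ballI allI impI)
  show "\<Lambda> B \<in> borel_measurable Q" if "B \<in> bounded_borel" for B
    by (rule wiener_measurable(2)[OF wiener_\<Lambda>[OF that]])
next
  fix t :: real assume t: "0 \<le> t"
  then have [measurable]: "Y t \<in> borel_measurable Q" by simp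
  have bb: "{0..t} \<in> bounded_borel" by (auto simp: bounded_borel_def)
  note w = wiener_\<Lambda>[OF bb]
  note [measurable] = wiener_measurable(2)[OF w]
  \<comment> \<open>Both variables integrate the same indicator, so their difference integrates 0
    and the tail estimate holds with \<open>m = 0\<close>.\<close>
  have "AE \<omega> in Q. norm (\<Lambda> {0..t} \<omega> - Y t \<omega>) \<le> 1 / real (Suc n)" for n
  proof -
    have "prob {\<omega> \<in> space Q. 1 / real (Suc n) < norm (\<Lambda> {0..t} \<omega> - Y t \<omega>)} \<le> tail_const (1 / real (Suc n)) * 0"
      by (rule wiener_tail[OF wiener_diff[OF w wiener_Icc[OF t]]]) auto
    then have "prob {\<omega> \<in> space Q. 1 / real (Suc n) < norm (\<Lambda> {0..t} \<omega> - Y t \<omega>)} = 0"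
      by (simp add: measure_le_0_iff)
    then have "AE \<omega> in Q. \<not> 1 / real (Suc n) < norm (\<Lambda> {0..t} \<omega> - Y t \<omega>)"
      by (subst (asm) prob_Collect_eq_0) auto
    then show ?thesis by (simp add: not_less)
  qed
  then have "AE \<omega> in Q. \<forall>n. norm (\<Lambda> {0..t} \<omega> - Y t \<omega>) \<le> 1 / real (Suc n)"
    by (simp add: AE_all_countable)
  then show "AE \<omega> in Q. \<Lambda> {0..t} \<omega> = Y t \<omega>"
  proof eventually_elim
    case (elim \<omega>)
    have "norm (\<Lambda> {0..t} \<omega> - Y t \<omega>) \<le> 0"
      by (rule LIMSEQ_le_const[OF LIMSEQ_Suc[OF lim_1_over_n]]) (use elim in auto)
    then show ?case by simp
  qed
next
  fix A :: "nat \<Rightarrow> real set"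
  assume A: "disjoint_family A \<and> range A \<subseteq> bounded_borel \<and> (\<Union>i. A i) \<in> bounded_borel"
  then have Ai: "A i \<in> bounded_borel" for i by auto
  from A obtain T where T: "0 \<le> T" "(\<Union>i. A i) \<subseteq> {0..T}" by (auto elim: bounded_borelE)
  have meas: "A i \<in> sets borel" for i using Ai by (auto simp: bounded_borel_def)
  have "emeasure lborel (\<Union>i. A i) \<le> emeasure lborel {0..T}"
    using T by (intro emeasure_mono) auto
  also have "\<dots> < \<infinity>" using T by simp
  finally have lim: "(\<lambda>n. \<rho> (\<lambda>s. (\<Sum>i<n. indicator (A i) s) - indicator (\<Union>i. A i) s)) \<longlonglongrightarrow> 0"
    using A meas by (intro \<rho>_disjoint_indicators_tendsto) auto
  show "tendsto_in_prob Q (\<lambda>n \<omega>. \<Sum>i<n. \<Lambda> (A i) \<omega>) (\<Lambda> (\<Union>i. A i)) sequentially"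
  proof (rule wiener_tendsto[OF _ _ lim])
    show "wiener (indicator (\<Union>i. A i)) (\<Lambda> (\<Union>i. A i))" using A by (intro wiener_\<Lambda>) auto
    show "\<forall>\<^sub>F n in sequentially. wiener (\<lambda>s. \<Sum>i<n. indicator (A i) s) (\<lambda>\<omega>. \<Sum>i<n. \<Lambda> (A i) \<omega>)"
      by (intro always_eventually allI wiener_sum wiener_\<Lambda> Ai) auto
  qed
qed

section \<open>Stochastic integrals over bounded intervals and the half-line\<close>

lemma wiener_simple:
  assumes g: "simple_function borel g" and B: "B \<in> bounded_borel"
  shows "wiener (\<lambda>s. g s * indicator B s) (simple_stoch_integral \<Lambda> g B)"
proof -
  have fin: "finite (range g)" using simple_functionD(1)[OF g] by simp
  have "B \<inter> g -` {a} \<in> bounded_borel" for a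
    using simple_functionD(2)[OF g, of "{a}"] B by (auto simp: bounded_borel_def intro: bounded_subset)
  then have "wiener (\<lambda>s. \<Sum>a\<in>range g. a * indicator (B \<inter> g -` {a}) s) (\<lambda>\<omega>. \<Sum>a\<in>range g. a *\<^sub>R \<Lambda> (B \<inter> g -` {a}) \<omega>)"
    by (intro wiener_sum wiener_scale wiener_\<Lambda> fin)
  moreover have "(\<Sum>a\<in>range g. a * indicator (B \<inter> g -` {a}) s) = g s * indicator B s" for s
  proof -
    have "(\<Sum>a\<in>range g. a * indicator (B \<inter> g -` {a}) s) = (\<Sum>a\<in>range g. if a = g s then g s * indicator B s else 0)"
      by (intro sum.cong refl) (auto split: split_indicator)
    then show ?thesis using fin by simp
  qed
  ultimately show ?thesis
    by (simp add: simple_stoch_integral_def[abs_def])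
qed

text \<open>One sequence of simple functions must work for all Borel subsets of
  \<open>{0..t}\<close>. It does, since each error is dominated by a constant on
  \<open>{0..t}\<close>, whatever the subset.\<close>

lemma has_stoch_integral_bounded:
  assumes f [measurable]: "f \<in> borel_measurable borel" and f1: "\<And>s. \<bar>f s\<bar> \<le> 1" and t: "0 \<le> t"
  shows "\<exists>Z. wiener (\<lambda>s. f s * indicator {0..t} s) Z \<and> has_stoch_integral Q Y f t Z"
proof -
  obtain g where g: "\<And>n. simple_function borel (g n)" "\<And>s. (\<lambda>n. g n s) \<longlonglongrightarrow> f s"
      "\<And>n s. dist (g n s) 0 \<le> 2 * dist (f s) 0"
    using borel_measurable_implies_sequence_metric[OF f, of 0] by (auto simp: space_borel)
  have [measurable]: "g n \<in> borel_measurable borel" for n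
    by (rule borel_measurable_simple_function[OF g(1)])
  \<comment> \<open>The approximants satisfy
    \<open>\<bar>g n s\<bar> \<le> 2 * \<bar>f s\<bar>\<close>, so the error is at most
    \<open>3 * \<bar>f s\<bar> \<le> 3\<close>.\<close>
  have gb: "\<bar>g n s - f s\<bar> \<le> 3" for n s
    using g(3)[of n s] f1[of s] by (auto simp: dist_real_def)
  have lim: "\<exists>K. wiener (\<lambda>s. f s * indicator B s) K \<and> tendsto_in_prob Q (\<lambda>n. simple_stoch_integral \<Lambda> (g n) B) K sequentially"
    if B: "B \<in> sets borel" "B \<subseteq> {0..t}" for B
  proof -
    note [measurable] = B(1)
    have bb: "B \<in> bounded_borel"
      using B by (auto simp: bounded_borel_def intro: bounded_subset[OF bounded_closed_interval])
    have "(\<lambda>n. \<rho> (\<lambda>s. g n s * indicator B s - f s * indicator B s)) \<longlonglongrightarrow> 0"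
    proof (rule \<rho>_dominated_convergence[where w = "\<lambda>s. 3 * indicator {0..t} s"])
      show "\<rho> (\<lambda>s. 3 * indicator {0..t} s) < \<infinity>"
        by (rule \<rho>_indicator_finite) (use t in auto)
      show "AE s in lborel. (\<lambda>n. g n s * indicator B s) \<longlonglongrightarrow> f s * indicator B s"
        by (intro AE_I2 tendsto_intros g)
      show "AE s in lborel. \<bar>g n s * indicator B s - f s * indicator B s\<bar> \<le> \<bar>3 * indicator {0..t} s\<bar>" for n
        using B(2) gb by (intro AE_I2) (auto split: split_indicator)
    qed auto
    then obtain K where "wiener (\<lambda>s. f s * indicator B s) K"
      "tendsto_in_prob Q (\<lambda>n. simple_stoch_integral \<Lambda> (g n) B) K sequentially"
      by (rule wiener_complete[OF wiener_simple[OF g(1) bb], rotated]) auto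
    then show ?thesis by blast
  qed
  have "{0..t} \<in> sets borel" by simp
  from lim[OF this order_refl] obtain Z where Z: "wiener (\<lambda>s. f s * indicator {0..t} s) Z"
      "tendsto_in_prob Q (\<lambda>n. simple_stoch_integral \<Lambda> (g n) {0..t}) Z sequentially"
    by blast
  have "has_stoch_integral Q Y f t Z"
    unfolding has_stoch_integral_def
  proof (intro conjI exI[of _ \<Lambda>] exI[of _ g] ballI impI allI)
    fix B assume "B \<in> sets borel" "B \<subseteq> {0..t}"
    then show "\<exists>K\<in>borel_measurable Q. tendsto_in_prob Q (\<lambda>n. simple_stoch_integral \<Lambda> (g n) B) K sequentially"
      using lim wiener_measurable(2) by blast
  qed (use Z wiener_measurable(2) random_measure_\<Lambda> g in auto)
  with Z show ?thesis by blast
qed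

theorem has_improper_stoch_integral_bounded:
  assumes f [measurable]: "f \<in> borel_measurable borel" and f1: "\<And>s. \<bar>f s\<bar> \<le> 1"
    and fin: "\<rho> (\<lambda>s. f s * indicator {0..} s) < \<infinity>"
  obtains I where "has_improper_stoch_integral Q Y f I"
    "\<And>z. \<phi> I z = exp (CLBINT s. C ((f s * indicator {0..} s) *\<^sub>R z))"
proof -
  obtain Z where Z: "\<And>t. 0 \<le> t \<Longrightarrow> wiener (\<lambda>s. f s * indicator {0..t} s) (Z t)"
      "\<And>t. 0 \<le> t \<Longrightarrow> has_stoch_integral Q Y f t (Z t)"
    using has_stoch_integral_bounded[OF f f1] by metis
  have lim_seq: "(\<lambda>n. \<rho> (\<lambda>s. f s * indicator {0..u n} s - f s * indicator {0..} s)) \<longlonglongrightarrow> 0"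
    if u: "filterlim u at_top sequentially" for u :: "nat \<Rightarrow> real"
  proof (rule \<rho>_dominated_convergence[where w = "\<lambda>s. f s * indicator {0..} s"])
    show "AE s in lborel. (\<lambda>n. f s * indicator {0..u n} s) \<longlonglongrightarrow> f s * indicator {0..} s"
    proof (rule AE_I2, rule tendsto_eventually)
      fix s
      have "eventually (\<lambda>n. s \<le> u n) sequentially"
        using u by (simp add: filterlim_at_top)
      then show "eventually (\<lambda>n. f s * indicator {0..u n} s = f s * indicator {0..} s) sequentially"
        by eventually_elim (auto split: split_indicator)
    qed
  qed (use fin in \<open>auto split: split_indicator\<close>)
  \<comment> \<open>Dominated convergence is sequential, while the improper integral is a limit in
    real \<open>t\<close>; convergence along every sequence tending to infinity bridges the
    two.\<close>
  have lim: "((\<lambda>t. \<rho> (\<lambda>s. f s * indicator {0..t} s - f s * indicator {0..} s)) \<longlongrightarrow> 0) at_top"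
    by (rule tendsto_at_topI_sequentially) (rule lim_seq)
  obtain I where I: "wiener (\<lambda>s. f s * indicator {0..} s) I"
    by (rule wiener_complete[OF Z(1) _ lim_seq[OF filterlim_real_sequentially]]) auto
  have "tendsto_in_prob Q Z I at_top"
    by (rule wiener_tendsto[OF eventually_mono[OF eventually_ge_at_top[of 0] Z(1)] I lim])
  then have "has_improper_stoch_integral Q Y f I"
    unfolding has_improper_stoch_integral_def using Z(2) wiener_measurable(2)[OF I] by blast
  with \<phi>_wiener[OF I] that show thesis by blast
qed

end

section \<open>The substitution identifying the Levy measure\<close>

text \<open>Both sides are integrals of \<open>h\<close> against measures on the line,
  \<open>M\<close> and \<open>N\<close>, so it suffices to compare these on Borel sets.\<close>

lemma nn_integral_change_of_variables_real:
  fixes g g' :: "real \<Rightarrow> real" and h :: "real \<Rightarrow> ennreal"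
  assumes S [measurable]: "S \<in> sets borel" and gS [measurable]: "g ` S \<in> sets borel"
    and g [measurable]: "g \<in> borel_measurable borel" and g' [measurable]: "g' \<in> borel_measurable borel"
    and h [measurable]: "h \<in> borel_measurable borel"
    and deriv: "\<And>x. x \<in> S \<Longrightarrow> (g has_field_derivative g' x) (at x within S)" and inj: "inj_on g S"
  shows "(\<integral>\<^sup>+ y\<in>g ` S. h y \<partial>lborel) = (\<integral>\<^sup>+ x\<in>S. h (g x) * ennreal \<bar>g' x\<bar> \<partial>lborel)"
proof -
  define M where "M = density lborel (indicator (g ` S))"
  define N where "N = distr (density lborel (\<lambda>x. ennreal \<bar>g' x\<bar> * indicator S x)) borel g"
  have N: "emeasure N A = (\<integral>\<^sup>+ x\<in>S. indicator A (g x) * ennreal \<bar>g' x\<bar> \<partial>lborel)"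
    if [measurable]: "A \<in> sets borel" for A
    unfolding N_def
    by (subst emeasure_distr, simp, simp, subst emeasure_density)
       (use measurable_sets_borel[OF g that] in \<open>auto intro!: nn_integral_cong split: split_indicator\<close>)
  \<comment> \<open>Boundedness makes the indicator Lebesgue integrable, as the change of variables
    for absolutely integrable functions demands; general sets are exhausted by bounded ones.\<close>
  have bounded_case: "emeasure M A = emeasure N A" if A [measurable]: "A \<in> sets borel" and "bounded A" for A
  proof -
    define A' where "A' = A \<inter> g ` S"
    have A' [measurable]: "A' \<in> sets borel" by (simp add: A'_def)
    have "bounded A'" using \<open>bounded A\<close> by (auto simp: A'_def intro: bounded_subset)
    then have fin: "emeasure lborel A' < \<infinity>" by (rule emeasure_bounded_finite)
    then have lm: "A' \<in> lmeasurable"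
      by (intro fmeasurableI) (auto simp: emeasure_completion)
    have meas: "A' \<inter> g ` S = A'" by (auto simp: A'_def)
    have "(indicator A' :: real \<Rightarrow> real) integrable_on (g ` S)"
      using lm meas by (metis integrable_on_indicator)
    then have "(indicator A' :: real \<Rightarrow> real) absolutely_integrable_on (g ` S)"
      by (rule nonnegative_absolutely_integrable_1) simp
    moreover have "integral (g ` S) (indicator A' :: real \<Rightarrow> real) = measure lebesgue A'"
      using integral_indicator[of A' "g ` S"] lm meas by simp
    ultimately have cv: "(\<lambda>x. \<bar>g' x\<bar> * indicator A' (g x)) absolutely_integrable_on S"
        "integral S (\<lambda>x. \<bar>g' x\<bar> * indicator A' (g x)) = measure lebesgue A'"
      using has_absolute_integral_change_of_variables_1'[OF _ deriv inj, of "indicator A'" "measure lebesgue A'"] S by auto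
    have "((\<lambda>x. \<bar>g' x\<bar> * indicator A' (g x)) has_integral measure lebesgue A') S"
      using cv by (metis absolutely_integrable_on_def integrable_integral)
    then have "(\<integral>\<^sup>+ x. ennreal (indicator S x * (\<bar>g' x\<bar> * indicator A' (g x))) \<partial>lborel) = ennreal (measure lebesgue A')"
      by (rule nn_integral_has_integral_lebesgue[rotated]) simp
    moreover have "(\<integral>\<^sup>+ x. ennreal (indicator S x * (\<bar>g' x\<bar> * indicator A' (g x))) \<partial>lborel) = emeasure N A"
      unfolding N[OF A] by (intro nn_integral_cong) (auto simp: A'_def split: split_indicator)
    moreover have "ennreal (measure lebesgue A') = emeasure lborel A'"
      using fin by (simp add: measure_completion emeasure_eq_ennreal_measure top_unique less_top)
    moreover have "emeasure M A = emeasure lborel A'"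
      unfolding M_def by (subst emeasure_density) (auto simp: A'_def indicator_inter_arith[symmetric] Int_commute)
    ultimately show ?thesis by simp
  qed
  have "M = N"
  proof (rule measure_eqI)
    show "sets M = sets N" by (simp add: M_def N_def)
    fix A assume "A \<in> sets M"
    then have A [measurable]: "A \<in> sets borel" by (simp add: M_def)
    define B where "B n = A \<inter> {- real n..real n}" for n
    have [measurable]: "B n \<in> sets borel" for n by (simp add: B_def)
    have UB: "(\<Union>n. B n) = A"
    proof (intro equalityI subsetI)
      fix x assume "x \<in> A"
      then show "x \<in> (\<Union>n. B n)"
        using real_arch_simple[of "\<bar>x\<bar>"] by (auto simp: B_def abs_le_iff minus_le_iff)
    qed (auto simp: B_def)
    have inc: "incseq B" by (auto simp: incseq_def B_def)
    have "emeasure M (B n) = emeasure N (B n)" for n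
      by (rule bounded_case) (auto simp: B_def intro: bounded_subset[OF bounded_closed_interval])
    then have "(SUP n. emeasure M (B n)) = (SUP n. emeasure N (B n))" by simp
    moreover have "range B \<subseteq> sets M" "range B \<subseteq> sets N" by (auto simp: M_def N_def)
    ultimately show "emeasure M A = emeasure N A"
      by (simp only: SUP_emeasure_incseq inc UB)
  qed
  then have "(\<integral>\<^sup>+ y. h y \<partial>M) = (\<integral>\<^sup>+ y. h y \<partial>N)" by simp
  also have "(\<integral>\<^sup>+ y. h y \<partial>M) = (\<integral>\<^sup>+ y\<in>g ` S. h y \<partial>lborel)"
    unfolding M_def by (subst nn_integral_density) (auto intro!: nn_integral_cong simp: mult.commute)
  also have "(\<integral>\<^sup>+ y. h y \<partial>N) = (\<integral>\<^sup>+ x\<in>S. h (g x) * ennreal \<bar>g' x\<bar> \<partial>lborel)"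
    unfolding N_def
    by (subst nn_integral_distr, simp, simp, subst nn_integral_density)
       (auto intro!: nn_integral_cong simp: mult_ac)
  finally show ?thesis .
qed

section \<open>The kernel and its image of Lebesgue measure\<close>

definition kern :: "real \<Rightarrow> real \<Rightarrow> real \<Rightarrow> real" where
  "kern \<alpha> \<theta> s = exp (- ((\<alpha> * s / \<theta>) powr (1 / \<alpha>)))"

lemma kern_measurable [measurable]: "kern \<alpha> \<theta> \<in> borel_measurable borel"
  unfolding kern_def by measurable

lemma kern_bounds: "0 < kern \<alpha> \<theta> s" "kern \<alpha> \<theta> s \<le> 1" "\<bar>kern \<alpha> \<theta> s\<bar> \<le> 1"
  by (simp_all add: kern_def)

context
  fixes \<alpha> \<theta> :: real
  assumes \<alpha>: "0 < \<alpha>" and \<theta>: "0 < \<theta>"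
begin

text \<open>The factor \<alpha> inside the kernel is tuned to the Jacobian: s = \<theta> u^\<alpha>
  / \<alpha> gives ds = \<theta> u^(\<alpha> - 1) du without a further constant. The point 0 is left
  out, as u^(\<alpha> - 1) is singular there for \<alpha> < 1.\<close>

lemma nn_integral_kern_exp:
  assumes [measurable]: "h \<in> borel_measurable borel"
  shows "(\<integral>\<^sup>+ s\<in>{0<..}. h (kern \<alpha> \<theta> s) \<partial>lborel) = (\<integral>\<^sup>+ u\<in>{0<..}. h (exp (- u)) * ennreal (\<theta> * u powr (\<alpha> - 1)) \<partial>lborel)"
proof -
  let ?g = "\<lambda>u. \<theta> * u powr \<alpha> / \<alpha>"
  have inv: "(\<alpha> * ?g u / \<theta>) powr (1 / \<alpha>) = u" if "u > 0" for u
    using \<alpha> \<theta> that by (simp add: powr_powr)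
  have inv': "?g ((\<alpha> * s / \<theta>) powr (1 / \<alpha>)) = s" if "s > 0" for s
    using \<alpha> \<theta> that by (simp add: powr_powr)
  have img: "?g ` {0<..} = {0<..}"
  proof (intro equalityI subsetI)
    fix s :: real assume "s \<in> {0<..}"
    then show "s \<in> ?g ` {0<..}"
      using inv'[of s] \<alpha> \<theta> by (intro image_eqI[of _ _ "(\<alpha> * s / \<theta>) powr (1 / \<alpha>)"]) auto
  qed (use \<alpha> \<theta> in auto)
  have "(\<integral>\<^sup>+ s\<in>?g ` {0<..}. h (kern \<alpha> \<theta> s) \<partial>lborel)
      = (\<integral>\<^sup>+ u\<in>{0<..}. h (kern \<alpha> \<theta> (?g u)) * ennreal \<bar>\<theta> * u powr (\<alpha> - 1)\<bar> \<partial>lborel)"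
  proof (rule nn_integral_change_of_variables_real)
    show "inj_on ?g {0<..}"
      by (rule inj_on_inverseI[where g = "\<lambda>s. (\<alpha> * s / \<theta>) powr (1 / \<alpha>)"]) (use inv in auto)
    show "(?g has_field_derivative \<theta> * u powr (\<alpha> - 1)) (at u within {0<..})" if "u \<in> {0<..}" for u
      using that \<alpha> by (auto intro!: derivative_eq_intros)
  qed (use img in auto)
  also have "\<dots> = (\<integral>\<^sup>+ u\<in>{0<..}. h (exp (- u)) * ennreal (\<theta> * u powr (\<alpha> - 1)) \<partial>lborel)"
    using \<alpha> \<theta> inv by (intro nn_integral_cong) (auto simp: kern_def split: split_indicator)
  finally show ?thesis unfolding img .
qed

lemma nn_integral_log_exp:
  fixes h :: "real \<Rightarrow> ennreal"
  assumes [measurable]: "h \<in> borel_measurable borel"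
  shows "(\<integral>\<^sup>+ r\<in>{0<..<1}. h r * ennreal ((- ln r) powr (\<alpha> - 1) * inverse r) \<partial>lborel)
    = (\<integral>\<^sup>+ u\<in>{0<..}. h (exp (- u)) * ennreal (u powr (\<alpha> - 1)) \<partial>lborel)"
proof -
  let ?g = "\<lambda>u. exp (- u) :: real"
  have img: "?g ` {0<..} = {0<..<1}"
  proof (intro equalityI subsetI)
    fix r :: real assume "r \<in> {0<..<1}"
    then show "r \<in> ?g ` {0<..}"
      by (intro image_eqI[of _ _ "- ln r"]) auto
  qed auto
  have "(\<integral>\<^sup>+ r\<in>?g ` {0<..}. h r * ennreal ((- ln r) powr (\<alpha> - 1) * inverse r) \<partial>lborel)
      = (\<integral>\<^sup>+ u\<in>{0<..}. (h (?g u) * ennreal ((- ln (?g u)) powr (\<alpha> - 1) * inverse (?g u))) * ennreal \<bar>- exp (- u)\<bar> \<partial>lborel)"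
  proof (rule nn_integral_change_of_variables_real)
    show "(?g has_field_derivative - exp (- u)) (at u within {0<..})" for u
      by (auto intro!: derivative_eq_intros)
  qed (auto simp: img inj_on_def)
  also have "\<dots> = (\<integral>\<^sup>+ u\<in>{0<..}. h (exp (- u)) * ennreal (u powr (\<alpha> - 1)) \<partial>lborel)"
    by (intro nn_integral_cong)
       (simp add: mult.assoc flip: ennreal_mult exp_minus exp_add)
  finally show ?thesis unfolding img .
qed

text \<open>Both sides become the same integral in \<open>u\<close>, one through the kernel and one
  through \<open>r = exp (- u)\<close>. The surviving factor \<theta> is what the division of \<nu>
  by \<theta> compensates.\<close>

lemma nn_integral_kern:
  assumes [measurable]: "h \<in> borel_measurable borel"
  shows "(\<integral>\<^sup>+ s\<in>{0<..}. h (kern \<alpha> \<theta> s) \<partial>lborel)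
    = ennreal \<theta> * (\<integral>\<^sup>+ r\<in>{0<..<1}. h r * ennreal ((- ln r) powr (\<alpha> - 1) * inverse r) \<partial>lborel)"
proof -
  have "(\<integral>\<^sup>+ s\<in>{0<..}. h (kern \<alpha> \<theta> s) \<partial>lborel)
    = (\<integral>\<^sup>+ u. ennreal \<theta> * (h (exp (- u)) * ennreal (u powr (\<alpha> - 1)) * indicator {0<..} u) \<partial>lborel)"
    unfolding nn_integral_kern_exp[OF assms]
    using \<theta> by (intro nn_integral_cong) (simp add: ennreal_mult mult_ac)
  also have "\<dots> = ennreal \<theta> * (\<integral>\<^sup>+ u\<in>{0<..}. h (exp (- u)) * ennreal (u powr (\<alpha> - 1)) \<partial>lborel)"
    by (rule nn_integral_cmult) simp
  finally show ?thesis unfolding nn_integral_log_exp[OF assms] .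
qed

text \<open>In the variable \<open>u\<close> this is Euler's integral. It is the factor by which the
  drift of \<open>Y\<close> is multiplied.\<close>

lemma nn_integral_kern_eq_Gamma:
  "(\<integral>\<^sup>+ s\<in>{0<..}. ennreal (kern \<alpha> \<theta> s) \<partial>lborel) = ennreal (\<theta> * Gamma \<alpha>)"
proof -
  have "(\<integral>\<^sup>+ s\<in>{0<..}. ennreal (kern \<alpha> \<theta> s) \<partial>lborel)
      = (\<integral>\<^sup>+ u\<in>{0<..}. ennreal (exp (- u)) * ennreal (\<theta> * u powr (\<alpha> - 1)) \<partial>lborel)"
    by (rule nn_integral_kern_exp) simp
  also have "\<dots> = (\<integral>\<^sup>+ u. ennreal \<theta> * ennreal (indicator {0..} u * (u powr (\<alpha> - 1) / exp u)) \<partial>lborel)"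
    using AE_lborel_singleton[of "0::real"] \<theta>
    by (intro nn_integral_cong_AE)
       (auto elim!: eventually_mono simp: exp_minus field_simps split: split_indicator simp flip: ennreal_mult)
  also have "\<dots> = ennreal \<theta> * (\<integral>\<^sup>+ u. ennreal (indicator {0..} u * (u powr (\<alpha> - 1) / exp u)) \<partial>lborel)"
    by (rule nn_integral_cmult) simp
  also have "(\<integral>\<^sup>+ u. ennreal (indicator {0..} u * (u powr (\<alpha> - 1) / exp u)) \<partial>lborel) = ennreal (Gamma \<alpha>)"
    by (rule nn_integral_has_integral_lebesgue[OF _ Gamma_integral_real[OF \<alpha>]]) simp
  finally show ?thesis
    using \<theta> Gamma_real_pos[OF \<alpha>] by (simp add: ennreal_mult)
qed

end

text \<open>Multiplying \<theta> by \<open>2 powr \<alpha>\<close> halves the exponent, so the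
  majorant \<open>exp (- u / 2)\<close> is again a kernel, with a known integral.\<close>

lemma kern_rescale:
  assumes "0 < \<alpha>" "0 < \<theta>" "0 < s"
  shows "kern \<alpha> (\<theta> * 2 powr \<alpha>) s = exp (- ((\<alpha> * s / \<theta>) powr (1 / \<alpha>) / 2))"
proof -
  have "\<alpha> * s / (\<theta> * 2 powr \<alpha>) = (\<alpha> * s / \<theta>) / 2 powr \<alpha>" by simp
  then have "(\<alpha> * s / (\<theta> * 2 powr \<alpha>)) powr (1 / \<alpha>) = (\<alpha> * s / \<theta>) powr (1 / \<alpha>) / (2 powr \<alpha>) powr (1 / \<alpha>)"
    using assms by (simp only: powr_divide)
  then show ?thesis using assms by (simp add: kern_def powr_powr)
qed

text \<open>With \<open>u = (\<alpha> s / \<theta>) powr (1 / \<alpha>)\<close> and \<open>l = ln (max 1 a)\<close>, the integrand is at most 2 where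
  \<open>u \<le> 2 l\<close>, and at most \<open>exp (- u / 2)\<close> elsewhere.\<close>

lemma nn_integral_min_kern_le:
  assumes \<alpha>: "0 < \<alpha>" and \<theta>: "0 < \<theta>" and a: "0 \<le> a"
  shows "(\<integral>\<^sup>+ s\<in>{0<..}. ennreal (min 2 (kern \<alpha> \<theta> s * a)) \<partial>lborel)
    \<le> ennreal (2 * (\<theta> / \<alpha> * (2 * ln (max 1 a)) powr \<alpha>)) + ennreal (\<theta> * 2 powr \<alpha> * Gamma \<alpha>)"
proof -
  define l where "l = ln (max 1 a)"
  define T where "T = \<theta> / \<alpha> * (2 * l) powr \<alpha>"
  have l: "l \<ge> 0" by (simp add: l_def)
  have T: "T \<ge> 0" using \<alpha> \<theta> by (simp add: T_def)
  have al: "a \<le> exp l" by (simp add: l_def)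
  have "ennreal (min 2 (kern \<alpha> \<theta> s * a)) * indicator {0<..} s
    \<le> ennreal 2 * indicator {0<..T} s + ennreal (kern \<alpha> (\<theta> * 2 powr \<alpha>) s) * indicator {0<..} s" for s
  proof (cases "s > 0")
    case s: True
    define u where "u = (\<alpha> * s / \<theta>) powr (1 / \<alpha>)"
    have su: "s = \<theta> / \<alpha> * u powr \<alpha>" using \<alpha> \<theta> s by (simp add: u_def powr_powr)
    show ?thesis
    proof (cases "u \<le> 2 * l")
      case True
      then have "u powr \<alpha> \<le> (2 * l) powr \<alpha>" using \<alpha> by (intro powr_mono2) (auto simp: u_def)
      then have "s \<le> T" unfolding su T_def using \<alpha> \<theta> by (intro mult_left_mono) auto
      with s have "ennreal (min 2 (kern \<alpha> \<theta> s * a)) * indicator {0<..} s \<le> ennreal 2 * indicator {0<..T} s"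
        by (simp add: ennreal_leI del: ennreal_numeral)
      then show ?thesis by (simp add: add_increasing2)
    next
      case False
      have "kern \<alpha> \<theta> s * a \<le> exp (- u) * exp (u / 2)"
        unfolding kern_def u_def[symmetric] using False al by (intro mult_left_mono order_trans[OF al]) auto
      also have "\<dots> = exp (- u / 2)" by (simp flip: exp_add)
      also have "\<dots> = kern \<alpha> (\<theta> * 2 powr \<alpha>) s" using kern_rescale[OF \<alpha> \<theta> s] by (simp add: u_def)
      finally have "ennreal (min 2 (kern \<alpha> \<theta> s * a)) \<le> ennreal (kern \<alpha> (\<theta> * 2 powr \<alpha>) s)"
        by (intro ennreal_leI) simp
      then show ?thesis using s by (simp add: add_increasing)
    qed
  qed simp
  then have "(\<integral>\<^sup>+ s\<in>{0<..}. ennreal (min 2 (kern \<alpha> \<theta> s * a)) \<partial>lborel)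
    \<le> (\<integral>\<^sup>+ s. ennreal 2 * indicator {0<..T} s + ennreal (kern \<alpha> (\<theta> * 2 powr \<alpha>) s) * indicator {0<..} s \<partial>lborel)"
    by (rule nn_integral_mono)
  also have "\<dots> = (\<integral>\<^sup>+ s. ennreal 2 * indicator {0<..T} s \<partial>lborel) + (\<integral>\<^sup>+ s\<in>{0<..}. ennreal (kern \<alpha> (\<theta> * 2 powr \<alpha>) s) \<partial>lborel)"
    by (rule nn_integral_add) auto
  also have "\<dots> = ennreal (2 * T) + ennreal (\<theta> * 2 powr \<alpha> * Gamma \<alpha>)"
    using T \<theta> by (simp add: nn_integral_kern_eq_Gamma \<alpha> nn_integral_cmult_indicator ennreal_mult del: ennreal_numeral)
  finally show ?thesis by (simp add: T_def l_def)
qed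

text \<open>For each fixed \<open>y\<close> the inner integral is transformed by
  \<open>nn_integral_kern\<close>, and \<theta> cancels. Written as an image measure,
  \<open>M_alpha\<close> lets cumulant integrals be unfolded into double integrals.\<close>

lemma M_alpha_eq_distr:
  fixes \<nu> :: "'a::euclidean_space measure"
  assumes \<alpha>: "0 < \<alpha>" and \<theta>: "0 < \<theta>" and fin: "finite_measure \<nu>" and \<nu>: "sets \<nu> = sets borel"
  defines "\<nu>' \<equiv> scale_measure (ennreal (1 / \<theta>)) \<nu>"
  shows "M_alpha \<alpha> \<nu> = distr (\<nu>' \<Otimes>\<^sub>M restrict_space lborel {0<..}) borel (\<lambda>(y, s). kern \<alpha> \<theta> s *\<^sub>R y)"
proof (rule measure_eqI)
  let ?L = "restrict_space lborel {0::real<..}"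
  interpret L: sigma_finite_measure ?L
    by (rule sigma_finite_measure_restrict_space) (auto intro: lborel.sigma_finite_measure_axioms)
  note [measurable_cong] = \<nu>
  have \<nu>' [measurable_cong]: "sets \<nu>' = sets borel" by (simp add: \<nu>'_def \<nu>)
  have L [measurable_cong]: "sets ?L = sets (restrict_space borel {0<..})" by (rule sets_restrict_space_cong) simp
  have kern [measurable]: "kern \<alpha> \<theta> \<in> borel_measurable ?L"
    by (rule measurable_restrict_space1) simp
  fix B assume "B \<in> sets (M_alpha \<alpha> \<nu>)"
  then have B [measurable]: "B \<in> sets borel" by simp
  have "emeasure (distr (\<nu>' \<Otimes>\<^sub>M ?L) borel (\<lambda>(y, s). kern \<alpha> \<theta> s *\<^sub>R y)) B
      = (\<integral>\<^sup>+ x. indicator B x \<partial>distr (\<nu>' \<Otimes>\<^sub>M ?L) borel (\<lambda>(y, s). kern \<alpha> \<theta> s *\<^sub>R y))"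
    by simp
  also have "\<dots> = (\<integral>\<^sup>+ p. indicator B (case p of (y, s) \<Rightarrow> kern \<alpha> \<theta> s *\<^sub>R y) \<partial>(\<nu>' \<Otimes>\<^sub>M ?L))"
    by (rule nn_integral_distr) measurable
  also have "\<dots> = (\<integral>\<^sup>+ y. (\<integral>\<^sup>+ s. indicator B (kern \<alpha> \<theta> s *\<^sub>R y) \<partial>?L) \<partial>\<nu>')"
    by (subst L.nn_integral_fst[symmetric]) auto
  also have "\<dots> = (\<integral>\<^sup>+ y. (\<integral>\<^sup>+ s\<in>{0<..}. indicator B (kern \<alpha> \<theta> s *\<^sub>R y) \<partial>lborel) \<partial>\<nu>')"
    by (intro nn_integral_cong) (simp add: nn_integral_restrict_space)
  also have "\<dots> = (\<integral>\<^sup>+ y. ennreal \<theta> * (\<integral>\<^sup>+ r\<in>{0<..<1}. indicator B (r *\<^sub>R y) * ennreal ((- ln r) powr (\<alpha> - 1) * inverse r) \<partial>lborel) \<partial>\<nu>')"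
    by (intro nn_integral_cong nn_integral_kern[OF \<alpha> \<theta>, where h = "\<lambda>r. indicator B (r *\<^sub>R _)"]) simp
  also have "\<dots> = ennreal (1 / \<theta>) * (ennreal \<theta> * (\<integral>\<^sup>+ y. (\<integral>\<^sup>+ r\<in>{0<..<1}. indicator B (r *\<^sub>R y) * ennreal ((- ln r) powr (\<alpha> - 1) * inverse r) \<partial>lborel) \<partial>\<nu>))"
    unfolding \<nu>'_def by (subst nn_integral_scale_measure, simp, subst nn_integral_cmult) simp_all
  also have "\<dots> = emeasure (M_alpha \<alpha> \<nu>) B"
    using \<theta> by (simp add: emeasure_M_alpha[OF \<nu> B] mult.assoc[symmetric] flip: ennreal_mult)
  finally show "emeasure (M_alpha \<alpha> \<nu>) B = emeasure (distr (\<nu>' \<Otimes>\<^sub>M ?L) borel (\<lambda>(y, s). kern \<alpha> \<theta> s *\<^sub>R y)) B" ..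
qed simp

section \<open>The distribution of the improper integral\<close>

context finite_jumps
begin

context
  fixes \<alpha> \<theta> :: real
  assumes \<alpha>: "0 < \<alpha>" and \<theta>: "0 < \<theta>"
    and log_moment: "(\<integral>\<^sup>+ y. ennreal (ln (max 1 (norm y)) powr \<alpha>) \<partial>\<nu>) < \<infinity>"
begin

text \<open>The bound for a single jump \<open>y\<close> consists of a multiple of the \<alpha>-th
  power of its logarithm, integrable by the moment condition, and a constant, integrable because
  \<nu> is finite.\<close>

lemma nn_integral_min_kern_finite:
  "(\<integral>\<^sup>+ y. (\<integral>\<^sup>+ s\<in>{0<..}. ennreal (min 2 (kern \<alpha> \<theta> s * norm y)) \<partial>lborel) \<partial>\<nu>) < \<infinity>"
proof -
  define c where "c = 2 * \<theta> / \<alpha> * 2 powr \<alpha>"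
  define c' where "c' = \<theta> * 2 powr \<alpha> * Gamma \<alpha>"
  have fin: "emeasure \<nu> (space \<nu>) < \<infinity>" using \<nu>.emeasure_finite top.not_eq_extremum by fastforce
  have c: "c \<ge> 0" using \<alpha> \<theta> by (simp add: c_def)
  have "(\<integral>\<^sup>+ y. (\<integral>\<^sup>+ s\<in>{0<..}. ennreal (min 2 (kern \<alpha> \<theta> s * norm y)) \<partial>lborel) \<partial>\<nu>)
    \<le> (\<integral>\<^sup>+ y. ennreal c * ennreal (ln (max 1 (norm y)) powr \<alpha>) + ennreal c' \<partial>\<nu>)"
  proof (rule nn_integral_mono)
    fix y
    have "2 * (\<theta> / \<alpha> * (2 * ln (max 1 (norm y))) powr \<alpha>) = c * ln (max 1 (norm y)) powr \<alpha>"
      by (simp add: c_def powr_mult)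
    with nn_integral_min_kern_le[OF \<alpha> \<theta>, of "norm y"]
    show "(\<integral>\<^sup>+ s\<in>{0<..}. ennreal (min 2 (kern \<alpha> \<theta> s * norm y)) \<partial>lborel)
        \<le> ennreal c * ennreal (ln (max 1 (norm y)) powr \<alpha>) + ennreal c'"
      using c by (simp add: c'_def ennreal_mult)
  qed
  also have "\<dots> = ennreal c * (\<integral>\<^sup>+ y. ennreal (ln (max 1 (norm y)) powr \<alpha>) \<partial>\<nu>) + ennreal c' * emeasure \<nu> (space \<nu>)"
    by (subst nn_integral_add) (auto simp: nn_integral_cmult)
  also have "\<dots> < \<infinity>"
    using log_moment fin by (simp add: ennreal_mult_less_top)
  finally show ?thesis .
qed

text \<open>The drift part of \<open>K\<close> integrates to a multiple of \<theta>
  \<Gamma>(\<alpha>); for the jump part Tonelli puts the time integral inside.\<close>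

lemma \<rho>_kern_finite: "\<rho> (\<lambda>s. kern \<alpha> \<theta> s * indicator {0..} s) < \<infinity>"
proof -
  interpret P: pair_sigma_finite \<nu> lborel ..
  have K: "ennreal (K (kern \<alpha> \<theta> s)) = ennreal (norm \<gamma>) * ennreal (kern \<alpha> \<theta> s) + (\<integral>\<^sup>+ y. ennreal (min 2 (kern \<alpha> \<theta> s * norm y)) \<partial>\<nu>)" for s
  proof -
    have k: "0 \<le> kern \<alpha> \<theta> s" using kern_bounds(1)[of \<alpha> \<theta> s] by simp
    have "(\<integral>\<^sup>+ y. ennreal (min 2 (kern \<alpha> \<theta> s * norm y)) \<partial>\<nu>) = ennreal (\<integral>y. min 2 (kern \<alpha> \<theta> s * norm y) \<partial>\<nu>)"
      using k by (intro nn_integral_eq_integral) auto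
    moreover have "0 \<le> (\<integral>y. min 2 (kern \<alpha> \<theta> s * norm y) \<partial>\<nu>)"
      using k by (intro Bochner_Integration.integral_nonneg) auto
    ultimately show ?thesis
      using k by (simp add: K_def ennreal_plus ennreal_mult)
  qed
  have "\<rho> (\<lambda>s. kern \<alpha> \<theta> s * indicator {0..} s)
      = (\<integral>\<^sup>+ s. ennreal (norm \<gamma>) * (ennreal (kern \<alpha> \<theta> s) * indicator {0<..} s)
          + (\<integral>\<^sup>+ y. ennreal (min 2 (kern \<alpha> \<theta> s * norm y)) * indicator {0<..} s \<partial>\<nu>) \<partial>lborel)"
    unfolding \<rho>_def using AE_lborel_singleton[of "0::real"]
    by (intro nn_integral_cong_AE)
       (auto elim!: eventually_mono simp: K split: split_indicator)
  also have "\<dots> = ennreal (norm \<gamma>) * (\<integral>\<^sup>+ s\<in>{0<..}. ennreal (kern \<alpha> \<theta> s) \<partial>lborel)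
      + (\<integral>\<^sup>+ s. (\<integral>\<^sup>+ y. ennreal (min 2 (kern \<alpha> \<theta> s * norm y)) * indicator {0<..} s \<partial>\<nu>) \<partial>lborel)"
    by (subst nn_integral_add) (auto simp: nn_integral_cmult)
  also have "(\<integral>\<^sup>+ s. (\<integral>\<^sup>+ y. ennreal (min 2 (kern \<alpha> \<theta> s * norm y)) * indicator {0<..} s \<partial>\<nu>) \<partial>lborel)
      = (\<integral>\<^sup>+ y. (\<integral>\<^sup>+ s\<in>{0<..}. ennreal (min 2 (kern \<alpha> \<theta> s * norm y)) \<partial>lborel) \<partial>\<nu>)"
    by (rule P.Fubini') measurable
  also have "ennreal (norm \<gamma>) * (\<integral>\<^sup>+ s\<in>{0<..}. ennreal (kern \<alpha> \<theta> s) \<partial>lborel) + \<dots> < \<infinity>"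
    using nn_integral_min_kern_finite nn_integral_kern_eq_Gamma[OF \<alpha> \<theta>]
    by (simp add: ennreal_mult_less_top less_top)
  finally show ?thesis .
qed

lemma absolutely_definable_kern: "absolutely_definable C (kern \<alpha> \<theta>)"
  unfolding absolutely_definable_def
proof
  fix z
  have "(\<integral>\<^sup>+ s\<in>{0..}. ennreal (cmod (C (kern \<alpha> \<theta> s *\<^sub>R z))) \<partial>lborel)
      = (\<integral>\<^sup>+ s. ennreal (cmod (C ((kern \<alpha> \<theta> s * indicator {0..} s) *\<^sub>R z))) \<partial>lborel)"
    by (intro nn_integral_cong) (auto split: split_indicator)
  also have "\<dots> < \<infinity>"
    using C_integrable[OF _ \<rho>_kern_finite, of z] by (simp add: integrable_iff_bounded)
  finally show "(\<integral>\<^sup>+ s\<in>{0..}. ennreal (cmod (C (kern \<alpha> \<theta> s *\<^sub>R z))) \<partial>lborel) < \<infinity>" .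
qed

text \<open>The drift collects the integral of the kernel. In the jump part Fubini exchanges time
  and jump, which makes it an integral against the image of the product measure.\<close>

lemma integral_C_kern:
  defines "L \<equiv> restrict_space lborel {0::real<..}"
  shows "(CLBINT s. C ((kern \<alpha> \<theta> s * indicator {0..} s) *\<^sub>R z))
    = cgf (distr (\<nu> \<Otimes>\<^sub>M L) borel (\<lambda>(y, s). kern \<alpha> \<theta> s *\<^sub>R y)) ((\<theta> * Gamma \<alpha>) *\<^sub>R \<gamma>) z"
proof -
  interpret L: sigma_finite_measure L
    unfolding L_def
    by (rule sigma_finite_measure_restrict_space) (auto intro: lborel.sigma_finite_measure_axioms)
  interpret P: pair_sigma_finite \<nu> L ..
  have L [measurable_cong]: "sets L = sets (restrict_space borel {0<..})"
    unfolding L_def by (rule sets_restrict_space_cong) simp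
  have [measurable]: "kern \<alpha> \<theta> \<in> borel_measurable L"
    unfolding L_def by (rule measurable_restrict_space1) simp
  let ?F = "\<lambda>y s. iexp (z \<bullet> (kern \<alpha> \<theta> s *\<^sub>R y)) - 1"
  have F_le: "cmod (?F y s) \<le> (1 + norm z) * min 2 (kern \<alpha> \<theta> s * norm y)" for y s
  proof -
    have k: "0 \<le> kern \<alpha> \<theta> s" using kern_bounds(1)[of \<alpha> \<theta> s] by simp
    have "cmod (?F y s) \<le> min 2 \<bar>z \<bullet> (kern \<alpha> \<theta> s *\<^sub>R y)\<bar>" by (rule cmod_iexp_minus_one_le)
    also have "\<dots> \<le> min 2 (norm z * (kern \<alpha> \<theta> s * norm y))"
      using Cauchy_Schwarz_ineq2[of z "kern \<alpha> \<theta> s *\<^sub>R y"] k by (intro min.mono) auto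
    also have "\<dots> \<le> (1 + norm z) * min 2 (kern \<alpha> \<theta> s * norm y)"
      using k by (intro min_mult_le) auto
    finally show ?thesis .
  qed
  \<comment> \<open>Fubini for a complex integrand demands absolute integrability, here from the
    majorant \<open>F_le\<close>.\<close>
  have intF: "complex_integrable (\<nu> \<Otimes>\<^sub>M L) (\<lambda>(y, s). ?F y s)"
  proof (rule integrableI_bounded)
    have "(\<integral>\<^sup>+ p. ennreal (cmod (case p of (y, s) \<Rightarrow> ?F y s)) \<partial>(\<nu> \<Otimes>\<^sub>M L))
      = (\<integral>\<^sup>+ y. (\<integral>\<^sup>+ s. ennreal (cmod (?F y s)) \<partial>L) \<partial>\<nu>)"
      by (subst L.nn_integral_fst[symmetric]) auto
    also have "\<dots> \<le> (\<integral>\<^sup>+ y. (\<integral>\<^sup>+ s. ennreal (1 + norm z) * ennreal (min 2 (kern \<alpha> \<theta> s * norm y)) \<partial>L) \<partial>\<nu>)"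
      using F_le kern_bounds(1)[of \<alpha> \<theta>, THEN less_imp_le]
      by (intro nn_integral_mono ennreal_le_mult) auto
    also have "\<dots> = ennreal (1 + norm z) * (\<integral>\<^sup>+ y. (\<integral>\<^sup>+ s. ennreal (min 2 (kern \<alpha> \<theta> s * norm y)) \<partial>L) \<partial>\<nu>)"
      by (subst nn_integral_cmult, measurable, subst nn_integral_cmult) (auto simp del: ennreal_plus)
    also have "(\<integral>\<^sup>+ y. (\<integral>\<^sup>+ s. ennreal (min 2 (kern \<alpha> \<theta> s * norm y)) \<partial>L) \<partial>\<nu>)
        = (\<integral>\<^sup>+ y. (\<integral>\<^sup>+ s\<in>{0<..}. ennreal (min 2 (kern \<alpha> \<theta> s * norm y)) \<partial>lborel) \<partial>\<nu>)"
      unfolding L_def by (simp add: nn_integral_restrict_space)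
    also have "ennreal (1 + norm z) * \<dots> < \<infinity>"
      using nn_integral_min_kern_finite by (simp add: ennreal_mult_less_top)
    finally show "(\<integral>\<^sup>+ p. ennreal (cmod (case p of (y, s) \<Rightarrow> ?F y s)) \<partial>(\<nu> \<Otimes>\<^sub>M L)) < \<infinity>" .
  qed measurable
  have int_kern: "integrable L (kern \<alpha> \<theta>)" "(\<integral>s. kern \<alpha> \<theta> s \<partial>L) = \<theta> * Gamma \<alpha>"
  proof -
    have nn: "(\<integral>\<^sup>+ s. ennreal (kern \<alpha> \<theta> s) \<partial>L) = ennreal (\<theta> * Gamma \<alpha>)"
      unfolding L_def by (simp add: nn_integral_restrict_space nn_integral_kern_eq_Gamma[OF \<alpha> \<theta>])
    have G: "0 \<le> \<theta> * Gamma \<alpha>" using \<theta> Gamma_real_pos[OF \<alpha>] by simp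
    have "has_bochner_integral L (kern \<alpha> \<theta>) (\<theta> * Gamma \<alpha>)"
      by (rule has_bochner_integral_nn_integral)
         (use nn G kern_bounds(1)[of \<alpha> \<theta>, THEN less_imp_le] in auto)
    then show "integrable L (kern \<alpha> \<theta>)" "(\<integral>s. kern \<alpha> \<theta> s \<partial>L) = \<theta> * Gamma \<alpha>"
      by (auto simp: has_bochner_integral_iff)
  qed
  have "(CLBINT s. C ((kern \<alpha> \<theta> s * indicator {0..} s) *\<^sub>R z)) = (CLBINT s. indicator {0<..} s *\<^sub>R C (kern \<alpha> \<theta> s *\<^sub>R z))"
    using AE_lborel_singleton[of "0::real"]
    by (intro integral_cong_AE) (auto elim!: eventually_mono split: split_indicator)
  also have "\<dots> = (CLINT s|L. C (kern \<alpha> \<theta> s *\<^sub>R z))"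
    unfolding L_def by (subst integral_restrict_space) auto
  also have "\<dots> = (CLINT s|L. \<i> * complex_of_real (\<gamma> \<bullet> z) * complex_of_real (kern \<alpha> \<theta> s) + (CLINT y|\<nu>. ?F y s))"
    by (intro Bochner_Integration.integral_cong) (simp_all add: cgf_def)
  also have "\<dots> = \<i> * complex_of_real (\<gamma> \<bullet> z) * complex_of_real (\<theta> * Gamma \<alpha>) + (CLINT s|L. CLINT y|\<nu>. ?F y s)"
    using int_kern P.integrable_snd[OF intF]
    by (subst Bochner_Integration.integral_add) (simp_all del: of_real_mult)
  also have "(CLINT s|L. CLINT y|\<nu>. ?F y s) = (CLINT p|(\<nu> \<Otimes>\<^sub>M L). (case p of (y, s) \<Rightarrow> ?F y s))"
    by (rule P.integral_snd[OF intF])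
  also have "\<dots> = (CLINT x|distr (\<nu> \<Otimes>\<^sub>M L) borel (\<lambda>(y, s). kern \<alpha> \<theta> s *\<^sub>R y). iexp (z \<bullet> x) - 1)"
    by (subst integral_distr) (auto intro!: Bochner_Integration.integral_cong)
  finally show ?thesis
    by (simp add: cgf_def mult_ac)
qed

end

end

text \<open>Up to norm 2 the truncated logarithm is at most \<open>ln 2\<close>, and \<nu> is
  finite. Truncation at 1 keeps the base of \<open>powr\<close> nonnegative.\<close>

lemma log_moment_finite:
  fixes \<nu> :: "'a::euclidean_space measure"
  assumes \<alpha>: "0 < \<alpha>" and fin: "finite_measure \<nu>" and \<nu> [measurable_cong]: "sets \<nu> = sets borel"
    and log: "(\<integral>\<^sup>+ x\<in>{x. 2 < norm x}. ennreal (ln (norm x) powr \<alpha>) \<partial>\<nu>) < \<infinity>"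
  shows "(\<integral>\<^sup>+ y. ennreal (ln (max 1 (norm y)) powr \<alpha>) \<partial>\<nu>) < \<infinity>"
proof -
  interpret finite_measure \<nu> by fact
  have fin': "emeasure \<nu> (space \<nu>) < \<infinity>" using emeasure_finite top.not_eq_extremum by fastforce
  have "(\<integral>\<^sup>+ y. ennreal (ln (max 1 (norm y)) powr \<alpha>) \<partial>\<nu>)
    \<le> (\<integral>\<^sup>+ y. ennreal (ln 2 powr \<alpha>) + ennreal (ln (norm y) powr \<alpha>) * indicator {x. 2 < norm x} y \<partial>\<nu>)"
  proof (rule nn_integral_mono)
    fix y :: 'a
    show "ennreal (ln (max 1 (norm y)) powr \<alpha>) \<le> ennreal (ln 2 powr \<alpha>) + ennreal (ln (norm y) powr \<alpha>) * indicator {x. 2 < norm x} y"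
    proof (cases "2 < norm y")
      case True
      then show ?thesis by (simp add: max_def add_increasing)
    next
      case False
      then have "ln (max 1 (norm y)) powr \<alpha> \<le> ln 2 powr \<alpha>"
        using \<alpha> by (intro powr_mono2) auto
      then show ?thesis using False by (simp add: ennreal_leI)
    qed
  qed
  also have "\<dots> = ennreal (ln 2 powr \<alpha>) * emeasure \<nu> (space \<nu>) + (\<integral>\<^sup>+ x\<in>{x. 2 < norm x}. ennreal (ln (norm x) powr \<alpha>) \<partial>\<nu>)"
    by (subst nn_integral_add) auto
  also have "\<dots> < \<infinity>"
    using log fin' by (simp add: ennreal_mult_less_top)
  finally show ?thesis .
qed

section \<open>Equality in law with the improper integral\<close>

theorem theorem1:
  fixes \<alpha> \<theta> :: real
    and \<gamma> \<gamma>' :: "'a::euclidean_space"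
    and \<nu> \<nu>' :: "'a measure"
    and P :: "'v measure" and X :: "'v \<Rightarrow> 'a"
    and Q :: "'w measure" and Y :: "real \<Rightarrow> 'w \<Rightarrow> 'a"
    and f :: "real \<Rightarrow> real"
  assumes "0 < \<alpha>" and "0 < \<theta>"
    and "finite_measure \<nu>" and "sets \<nu> = sets borel" and "emeasure \<nu> {0} = 0"
    and "(\<integral>\<^sup>+ x\<in>{x. 2 < norm x}. ennreal (ln (norm x) powr \<alpha>) \<partial>\<nu>) < \<infinity>"
    and "prob_space P" and "X \<in> borel_measurable P"
    and "is_L_star \<alpha> \<nu> \<gamma> (distr P borel X)"
    and "\<nu>' = scale_measure (ennreal (1 / \<theta>)) \<nu>"
    and "\<gamma>' = (1 / (\<theta> * Gamma \<alpha>)) *\<^sub>R \<gamma>"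
    and "levy_process Q Y"
    and "is_ID0 \<nu>' \<gamma>' (distr Q borel (Y 1))"
    and "f = (\<lambda>s. exp (- ((\<alpha> * s / \<theta>) powr (1 / \<alpha>))))"
  shows "absolutely_definable (cgf \<nu>' \<gamma>') f \<and>
    (\<exists>I. has_improper_stoch_integral Q Y f I \<and> distr P borel X = distr Q borel I)"
proof -
  note \<alpha> = \<open>0 < \<alpha>\<close> and \<theta> = \<open>0 < \<theta>\<close> and fin = \<open>finite_measure \<nu>\<close> and sets = \<open>sets \<nu> = sets borel\<close>
  note \<nu>' = \<open>\<nu>' = scale_measure (ennreal (1 / \<theta>)) \<nu>\<close>
  have f: "f = kern \<alpha> \<theta>" using assms(14) by (simp add: kern_def[abs_def])
  interpret \<nu>: finite_measure \<nu> by fact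
  have "emeasure \<nu>' (space \<nu>') \<noteq> \<infinity>"
    using \<nu>.emeasure_finite by (simp add: \<nu>' space_scale_measure ennreal_mult_eq_top_iff)
  then have "finite_measure \<nu>'" by (rule finite_measureI)
  moreover have "sets \<nu>' = sets borel" using sets by (simp add: \<nu>')
  ultimately interpret compound_Poisson_process \<nu>' \<gamma>' Q Y
    using assms(12,13)
    by (intro compound_Poisson_process.intro finite_jumps.intro compound_Poisson_process_axioms.intro)
  have "(\<integral>\<^sup>+ y. ennreal (ln (max 1 (norm y)) powr \<alpha>) \<partial>\<nu>') = ennreal (1 / \<theta>) * (\<integral>\<^sup>+ y. ennreal (ln (max 1 (norm y)) powr \<alpha>) \<partial>\<nu>)"
    unfolding \<nu>' by (rule nn_integral_scale_measure) (simp add: measurable_cong_sets[OF sets refl])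
  also have "\<dots> < \<infinity>"
    using log_moment_finite[OF \<alpha> fin sets assms(6)] by (simp add: ennreal_mult_less_top)
  finally have log: "(\<integral>\<^sup>+ y. ennreal (ln (max 1 (norm y)) powr \<alpha>) \<partial>\<nu>') < \<infinity>" .
  obtain I where I: "has_improper_stoch_integral Q Y (kern \<alpha> \<theta>) I"
      "\<And>z. \<phi> I z = exp (CLBINT s. C ((kern \<alpha> \<theta> s * indicator {0..} s) *\<^sub>R z))"
    using has_improper_stoch_integral_bounded[OF kern_measurable kern_bounds(3) \<rho>_kern_finite[OF \<alpha> \<theta> log]] by blast
  have [measurable]: "I \<in> borel_measurable Q" using I(1) by (simp add: has_improper_stoch_integral_def)
  \<comment> \<open>The drift \<gamma>' of \<open>Y\<close> is magnified by the total mass of the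
    kernel; the next two lines check that this gives back \<gamma>.\<close>
  have "\<theta> * Gamma \<alpha> \<noteq> 0" using \<theta> Gamma_real_pos[OF \<alpha>] by simp
  then have \<gamma>: "(\<theta> * Gamma \<alpha>) *\<^sub>R \<gamma>' = \<gamma>" using assms(11) by simp
  have M: "M_alpha \<alpha> \<nu> = distr (\<nu>' \<Otimes>\<^sub>M restrict_space lborel {0<..}) borel (\<lambda>(y, s). kern \<alpha> \<theta> s *\<^sub>R y)"
    unfolding \<nu>' by (rule M_alpha_eq_distr[OF \<alpha> \<theta> fin sets])
  have "distr P borel X = distr Q borel I"
  proof (rule char_fn_uniqueness)
    show "prob_space (distr P borel X)" using assms(7,8) by (rule prob_space.prob_space_distr)
    show "prob_space (distr Q borel I)" by (rule prob_space_distr) simp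
    fix z
    have "char_fn (distr P borel X) z = exp (cgf (M_alpha \<alpha> \<nu>) \<gamma> z)"
      using assms(9) by (simp add: is_L_star_def is_ID0_def)
    \<comment> \<open>The exponent of \<open>\<phi> I\<close> is a cumulant function whose drift is
      \<gamma> and whose Levy measure is the image measure that \<open>M\<close> identifies with
      \<open>M_alpha \<alpha> \<nu>\<close>.\<close>
    also have "\<dots> = \<phi> I z"
      unfolding I(2) integral_C_kern[OF \<alpha> \<theta> log] \<gamma> M ..
    also have "\<dots> = char_fn (distr Q borel I) z"
      by (simp add: char_fn_def integral_distr)
    finally show "char_fn (distr P borel X) z = char_fn (distr Q borel I) z" .
  qed auto
  with I(1) absolutely_definable_kern[OF \<alpha> \<theta> log] show ?thesis
    unfolding f by blast
qed

end
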